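(* Let $(M,g)$ be a compact Riemannian manifold without boundary, of even dimension $n=2r$, and let $k$ be an integer with $2\le 2k\le r$. If $(M,g)$ is $(2k)$-Thorpe, i.e. $\star(g^{r-2k}R^k)=g^{r-2k}R^k$, or if $(M,g)$ is $(2k)$-anti-Thorpe, i.e. $\star(g^{r-2k}R^k)=-g^{r-2k}R^k$, then $R^k$ is a harmonic double form, that is, $DR^k=0$ and $\delta R^k=0$.
   Context: Double forms: for a Euclidean space $(V,g)$ of dimension $n$, a $(p,q)$ double form is an element of $\Lambda^pV^*\otimes\Lambda^qV^*$. The exterior product of double forms is $(\alpha_1\otimes\beta_1)(\alpha_2\otimes\beta_2)=(\alpha_1\wedge\alpha_2)\otimes(\beta_1\wedge\beta_2)$, and powers are taken for this product. The metric $g=\sum e^i\otimes e^i$ is a $(1,1)$ double form. The inner product is the one for which the $e^{i_1}\wedge\dots\wedge e^{i_p}\otimes e^{j_1}\wedge\dots\wedge e^{j_q}$ (increasing indices, $(e^i)$ orthonormal) form an orthonormal basis. The (double) Hodge star is defined by $\star(\theta_1\otimes\theta_2)=(\star\theta_1)\otimes(\star\theta_2)$. On a Riemannian manifold these notions are applied fibrewise. The Riemann curvature tensor $R$ is viewed as a symmetric $(2,2)$ double form, with sign such that $R(x\wedge y;x\wedge y)$ is the sectional curvature for orthonormal $x,y$; $R^k$ is its $k$-th exterior power, a $(2k,2k)$ double form. Differential operators: for a $(p,q)$ double form field $\omega$, $D\omega$ is the $(p+1,q)$ double form $D\omega(x_1,\dots,x_{p+1};y_1,\dots,y_q)=\sum_{j}(-1)^{j+1}(\nabla_{x_j}\omega)(x_1,\dots,\widehat{x_j},\dots,x_{p+1};y_1,\dots,y_q)$,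 with $\nabla$ the Levi-Civita connection, and $\delta$ is its formal adjoint, $\delta\omega(x_1,\dots,x_{p-1};y)=-\sum_i(\nabla_{e_i}\omega)(e_i,x_1,\dots,x_{p-1};y)$. *)

theory Defs
  imports "HOL-Analysis.Analysis"
begin

section \<open>Exterior forms and double forms\<close>

text \<open>
  An element of the exterior algebra of \<open>V\<^sup>*\<close> is represented by the function sending a list of
  vectors \<open>[x\<^sub>1, \<dots>, x\<^sub>p]\<close> to its value on \<open>(x\<^sub>1, \<dots>, x\<^sub>p)\<close>; a \<open>p\<close>-form
  is zero on lists of any other length. Likewise a \<open>(p,q)\<close> double form is a function of
  two lists, zero unless they have lengths \<open>p\<close> and \<open>q\<close>. The degrees are thus part
  of the form and need not be passed to the operations below.
\<close>

type_synonym 'v form = "'v list \<Rightarrow> real"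
type_synonym 'v dform = "'v list \<Rightarrow> 'v list \<Rightarrow> real"

text \<open>The sign of the shuffle of \<open>{..<n}\<close> that lists \<open>S\<close> increasingly and then its
  complement increasingly.\<close>

definition shuffle_sign :: "nat \<Rightarrow> nat set \<Rightarrow> real" where
  "shuffle_sign n S = (-1) ^ card {(i, j). i \<in> S \<and> j \<in> {..<n} - S \<and> j < i}"

text \<open>With this normalisation \<open>(e\<^sup>1 \<and> e\<^sup>2)(x,y) = e\<^sup>1(x) e\<^sup>2(y) - e\<^sup>1(y) e\<^sup>2(x)\<close>.\<close>

definition wedge :: "'v form \<Rightarrow> 'v form \<Rightarrow> 'v form" where
  "wedge \<alpha> \<beta> xs = (\<Sum>S \<in> Pow {..<length xs}.
     shuffle_sign (length xs) S * \<alpha> (nths xs S) * \<beta> (nths xs (- S)))"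

definition form_one :: "'v form" where
  "form_one xs = (if xs = [] then 1 else 0)"

definition form_tensor :: "'v form \<Rightarrow> 'v form \<Rightarrow> 'v dform" where
  "form_tensor \<alpha> \<beta> xs ys = \<alpha> xs * \<beta> ys"

text \<open>The bilinear extension of
  \<open>(\<alpha>\<^sub>1 \<otimes> \<beta>\<^sub>1)(\<alpha>\<^sub>2 \<otimes> \<beta>\<^sub>2) = (\<alpha>\<^sub>1 \<and> \<alpha>\<^sub>2) \<otimes> (\<beta>\<^sub>1 \<and> \<beta>\<^sub>2)\<close>;
  see \<open>dform_mult_form_tensor\<close>.\<close>

definition dform_mult :: "'v dform \<Rightarrow> 'v dform \<Rightarrow> 'v dform" where
  "dform_mult \<omega> \<theta> xs ys = (\<Sum>S \<in> Pow {..<length xs}. \<Sum>T \<in> Pow {..<length ys}.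
     shuffle_sign (length xs) S * shuffle_sign (length ys) T *
     \<omega> (nths xs S) (nths ys T) * \<theta> (nths xs (- S)) (nths ys (- T)))"

lemma dform_mult_form_tensor:
  "dform_mult (form_tensor \<alpha>1 \<beta>1) (form_tensor \<alpha>2 \<beta>2)
     = form_tensor (wedge \<alpha>1 \<alpha>2) (wedge \<beta>1 \<beta>2)"
  by (intro ext, unfold dform_mult_def form_tensor_def wedge_def sum_product, intro sum.cong refl)
    (simp add: algebra_simps)

primrec dpow :: "'v dform \<Rightarrow> nat \<Rightarrow> 'v dform" where
  "dpow \<omega> 0 = form_tensor form_one form_one"
| "dpow \<omega> (Suc k) = dform_mult \<omega> (dpow \<omega> k)"


section \<open>Euclidean structure on a tangent space\<close>

text \<open>The inner product with Gram matrix \<open>A\<close>.\<close>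

definition gip :: "real^'n^'n \<Rightarrow> real^'n \<Rightarrow> real^'n \<Rightarrow> real" where
  "gip A v w = v \<bullet> (A *v w)"

definition pos_def :: "real^'n^'n \<Rightarrow> bool" where
  "pos_def A \<longleftrightarrow> transpose A = A \<and> (\<forall>v. v \<noteq> 0 \<longrightarrow> gip A v v > 0)"

lemma gip_commute: "pos_def A \<Longrightarrow> gip A v w = gip A w v"
  by (metis dot_lmul_matrix gip_def inner_commute pos_def_def transpose_matrix_vector)

definition metric_form :: "real^'n^'n \<Rightarrow> (real^'n) dform" where
  "metric_form A xs ys = (case (xs, ys) of ([x], [y]) \<Rightarrow> gip A x y | _ \<Rightarrow> 0)"

text \<open>Frames are indexed by \<open>0, \<dots>, n - 1\<close>, since increasing multi-indices are needed and the
  index type \<open>'n\<close> carries no order.\<close>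

definition orthonormal_frame :: "real^'n^'n \<Rightarrow> (nat \<Rightarrow> real^'n) \<Rightarrow> bool" where
  "orthonormal_frame A e \<longleftrightarrow>
     (\<forall>i < CARD('n). \<forall>j < CARD('n). gip A (e i) (e j) = (if i = j then 1 else 0))"

lemma orthonormal_frame_exists:
  fixes A :: "real^'n^'n"
  assumes "pos_def A"
  shows "\<exists>e. orthonormal_frame A e"
proof -
  have "\<exists>e. \<forall>i < k. \<forall>j < k. gip A (e i) (e j) = (if i = j then 1 else 0)"
    if "k \<le> CARD('n)" for k
    using that
  proof (induction k)
    case 0
    then show ?case by simp
  next
    case (Suc k)
    then obtain e where e: "\<forall>i < k. \<forall>j < k. gip A (e i) (e j) = (if i = j then 1 else 0)"
      by auto
    have "dim ((\<lambda>i. A *v e i) ` {..<k}) \<le> card ((\<lambda>i. A *v e i) ` {..<k})"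
      by (rule dim_le_card') simp
    also have "\<dots> \<le> k" using card_image_le[of "{..<k}"] by auto
    also have "\<dots> < DIM(real^'n)" using Suc.prems by simp
    finally obtain v where v: "v \<noteq> 0"
      and orth: "\<And>y. y \<in> span ((\<lambda>i. A *v e i) ` {..<k}) \<Longrightarrow> orthogonal v y"
      using orthogonal_to_subspace_exists by blast
    have ve: "gip A v (e i) = 0" if "i < k" for i
      using orth[of "A *v e i"] that
      by (auto simp: gip_def orthogonal_def intro!: span_base)
    have pv: "gip A v v > 0" using assms v by (auto simp: pos_def_def)
    define w where "w = (1 / sqrt (gip A v v)) *\<^sub>R v"
    have we: "gip A w (e i) = 0" if "i < k" for i
      using ve[OF that] by (simp add: w_def gip_def)
    have ww: "gip A w w = 1"
      using pv by (simp add: w_def gip_def matrix_vector_mult_scaleR)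
    have wf: "gip A (e i) w = 0" if "i < k" for i
      using we[OF that] gip_commute[OF assms, of w "e i"] by simp
    have "gip A ((e(k := w)) i) ((e(k := w)) j) = (if i = j then 1 else 0)"
      if "i < Suc k" "j < Suc k" for i j
      using that we wf ww e by (cases "i = k"; cases "j = k") auto
    then show ?case by blast
  qed
  from this[of "CARD('n)"] show ?thesis
    by (simp add: orthonormal_frame_def)
qed

text \<open>A fixed choice of orthonormal frame. The operators defined with it below (the double Hodge
  star and the divergence) do not depend on the choice; in particular the double Hodge star applies
  \<open>\<star>\<close> to both factors, so it does not depend on an orientation either.\<close>

definition onb :: "real^'n^'n \<Rightarrow> nat \<Rightarrow> real^'n" where
  "onb A = (SOME e. orthonormal_frame A e)"

definition covector :: "real^'n^'n \<Rightarrow> real^'n \<Rightarrow> (real^'n) form" where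
  "covector A v xs = (case xs of [x] \<Rightarrow> gip A v x | _ \<Rightarrow> 0)"

text \<open>\<open>basis_form A I\<close> is \<open>e\<^sup>i\<^sup>1 \<and> \<dots> \<and> e\<^sup>i\<^sup>p\<close> for \<open>I = {i\<^sub>1 < \<dots> < i\<^sub>p}\<close>, and
  \<open>basis_vectors A I\<close> is \<open>[e\<^sub>i\<^sub>1, \<dots>, e\<^sub>i\<^sub>p]\<close>.\<close>

definition basis_form :: "real^'n^'n \<Rightarrow> nat set \<Rightarrow> (real^'n) form" where
  "basis_form A I = foldr wedge (map (\<lambda>i. covector A (onb A i)) (sorted_list_of_set I)) form_one"

definition basis_vectors :: "real^'n^'n \<Rightarrow> nat set \<Rightarrow> (real^'n) list" where
  "basis_vectors A I = map (onb A) (sorted_list_of_set I)"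

text \<open>\<open>\<star>e\<^sup>I\<close>, normalised by \<open>e\<^sup>I \<and> \<star>e\<^sup>I = e\<^sup>1 \<and> \<dots> \<and> e\<^sup>n\<close>.\<close>

definition hodge_basis_form :: "real^'n^'n \<Rightarrow> nat set \<Rightarrow> (real^'n) form" where
  "hodge_basis_form A I xs = shuffle_sign CARD('n) I * basis_form A ({..<CARD('n)} - I) xs"

text \<open>The linear extension of \<open>\<star>(e\<^sup>I \<otimes> e\<^sup>J) = \<star>e\<^sup>I \<otimes> \<star>e\<^sup>J\<close>: the coefficient of \<open>\<omega>\<close> at
  \<open>e\<^sup>I \<otimes> e\<^sup>J\<close> is its value on \<open>(e\<^sub>I; e\<^sub>J)\<close>.\<close>

definition double_star :: "real^'n^'n \<Rightarrow> (real^'n) dform \<Rightarrow> (real^'n) dform" where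
  "double_star A \<omega> xs ys = (\<Sum>I \<in> Pow {..<CARD('n)}. \<Sum>J \<in> Pow {..<CARD('n)}.
     \<omega> (basis_vectors A I) (basis_vectors A J) *
     form_tensor (hodge_basis_form A I) (hodge_basis_form A J) xs ys)"


section \<open>Smooth manifolds and Riemannian metrics\<close>

text \<open>Only used for open \<open>S\<close>.\<close>

primrec Ck_on :: "nat \<Rightarrow> ('a::real_normed_vector \<Rightarrow> 'b::real_normed_vector) \<Rightarrow> 'a set \<Rightarrow> bool" where
  "Ck_on 0 f S \<longleftrightarrow> continuous_on S f"
| "Ck_on (Suc k) f S \<longleftrightarrow> (\<forall>x\<in>S. f differentiable (at x)) \<and>
     (\<forall>v. Ck_on k (\<lambda>x. frechet_derivative f (at x) v) S)"

definition smooth_on :: "'a set \<Rightarrow> ('a::real_normed_vector \<Rightarrow> 'b::real_normed_vector) \<Rightarrow> bool" where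
  "smooth_on S f \<longleftrightarrow> (\<forall>k. Ck_on k f S)"

text \<open>A chart is a pair of its domain in the manifold and its coordinate map.\<close>

type_synonym ('m, 'n) chart = "'m set \<times> ('m \<Rightarrow> real^'n)"

definition chart_image :: "('m, 'n::finite) chart \<Rightarrow> (real^'n) set" where
  "chart_image c = snd c ` fst c"

definition is_chart :: "'m topology \<Rightarrow> ('m, 'n::finite) chart \<Rightarrow> bool" where
  "is_chart M c \<longleftrightarrow> openin M (fst c) \<and> open (chart_image c) \<and>
     homeomorphic_map (subtopology M (fst c)) (top_of_set (chart_image c)) (snd c)"

definition transition :: "('m, 'n::finite) chart \<Rightarrow> ('m, 'n::finite) chart \<Rightarrow> real^'n \<Rightarrow> real^'n" where
  "transition c c' x = snd c' (inv_into (fst c) (snd c) x)"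

definition overlap :: "('m, 'n::finite) chart \<Rightarrow> ('m, 'n::finite) chart \<Rightarrow> (real^'n) set" where
  "overlap c c' = snd c ` (fst c \<inter> fst c')"

text \<open>All chart images are open in \<open>real^'n\<close>, so the manifold has dimension \<open>CARD('n)\<close> and no
  boundary.\<close>

definition smooth_manifold :: "'m topology \<Rightarrow> ('m, 'n::finite) chart set \<Rightarrow> bool" where
  "smooth_manifold M \<A> \<longleftrightarrow> Hausdorff_space M \<and> second_countable M \<and>
     (\<forall>c\<in>\<A>. is_chart M c) \<and> (\<Union>c\<in>\<A>. fst c) = topspace M \<and>
     (\<forall>c\<in>\<A>. \<forall>c'\<in>\<A>. smooth_on (overlap c c') (transition c c'))"

text \<open>Tensor fields on the manifold are represented by their coordinate expressions in all charts
  of the atlas. A Riemannian metric is given by its Gram matrices \<open>g c x\<close> with respect to the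
  coordinate frame of the chart \<open>c\<close> at the point with coordinates \<open>x\<close>; the last conjunct is the
  tensor transformation law.\<close>

type_synonym ('m, 'n) metric = "('m, 'n) chart \<Rightarrow> real^'n \<Rightarrow> real^'n^'n"

definition riemannian_metric :: "('m, 'n::finite) chart set \<Rightarrow> ('m, 'n::finite) metric \<Rightarrow> bool" where
  "riemannian_metric \<A> g \<longleftrightarrow>
     (\<forall>c\<in>\<A>. smooth_on (chart_image c) (g c) \<and> (\<forall>x\<in>chart_image c. pos_def (g c x))) \<and>
     (\<forall>c\<in>\<A>. \<forall>c'\<in>\<A>. \<forall>x\<in>overlap c c'. \<forall>v w.
        gip (g c x) v w =
        gip (g c' (transition c c' x))
          (frechet_derivative (transition c c') (at x) v)
          (frechet_derivative (transition c c') (at x) w))"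


section \<open>Levi-Civita connection and curvature in a chart\<close>

text \<open>In this section \<open>G\<close> is the Gram matrix field of the metric in a fixed chart, and vectors in
  \<open>real^'n\<close> also stand for the vector fields with these constant components; such fields commute.
  \<open>koszul G x v w u\<close> is the value of \<open>g(\<nabla>\<^sub>v w, u)\<close> at \<open>x\<close> given by the Koszul formula.\<close>

definition koszul ::
  "(real^'n \<Rightarrow> real^'n^'n) \<Rightarrow> real^'n \<Rightarrow> real^'n \<Rightarrow> real^'n \<Rightarrow> real^'n \<Rightarrow> real" where
  "koszul G x v w u =
     (frechet_derivative (\<lambda>y. gip (G y) w u) (at x) v
      + frechet_derivative (\<lambda>y. gip (G y) v u) (at x) w
      - frechet_derivative (\<lambda>y. gip (G y) v w) (at x) u) / 2"

definition christoffel ::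
  "(real^'n \<Rightarrow> real^'n^'n) \<Rightarrow> real^'n \<Rightarrow> real^'n \<Rightarrow> real^'n \<Rightarrow> real^'n" where
  "christoffel G x v w = matrix_inv (G x) *v (\<chi> l. koszul G x v w (axis l 1))"

text \<open>The two properties that characterise the Levi-Civita connection are
  \<open>christoffel_commute\<close> (no torsion) and \<open>christoffel_metric\<close> (compatibility with the metric).\<close>

lemma bounded_linear_gip: "bounded_linear (\<lambda>A. gip A v w)"
  unfolding linear_conv_bounded_linear[symmetric]
  by (rule linearI)
    (simp_all add: gip_def matrix_vector_mult_add_rdistrib inner_add_right
      scaleR_matrix_vector_assoc [symmetric])

lemma frechet_derivative_gip:
  assumes "G differentiable (at x)"
  shows "frechet_derivative (\<lambda>y. gip (G y) v w) (at x) h = gip (frechet_derivative G (at x) h) v w"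
proof -
  have "(G has_derivative frechet_derivative G (at x)) (at x)"
    using assms by (simp add: frechet_derivative_works)
  then have "((\<lambda>y. gip (G y) v w) has_derivative
      (\<lambda>h. gip (frechet_derivative G (at x) h) v w)) (at x)"
    by (rule bounded_linear.has_derivative[OF bounded_linear_gip])
  then show ?thesis
    using frechet_derivative_at by metis
qed

lemma frechet_derivative_gip_commute:
  assumes "open S" "x \<in> S" "\<And>y. y \<in> S \<Longrightarrow> pos_def (G y)" "G differentiable (at x)"
  shows "frechet_derivative (\<lambda>y. gip (G y) v w) (at x) = frechet_derivative (\<lambda>y. gip (G y) w v) (at x)"
proof (rule frechet_derivative_transform_within_open[where X = S])
  show "(\<lambda>y. gip (G y) v w) differentiable at x"
    using assms(4) unfolding differentiable_def
    by (blast dest: bounded_linear.has_derivative[OF bounded_linear_gip])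
qed (use assms gip_commute in auto)

lemma christoffel_commute:
  assumes "open S" "x \<in> S" "\<And>y. y \<in> S \<Longrightarrow> pos_def (G y)" "G differentiable (at x)"
  shows "christoffel G x v w = christoffel G x w v"
  using frechet_derivative_gip_commute[OF assms, of v w]
  by (simp add: christoffel_def koszul_def algebra_simps)

lemma gip_christoffel:
  fixes G :: "real^'n \<Rightarrow> real^'n^'n"
  assumes pd: "pos_def (G x)" and d: "G differentiable (at x)"
  shows "gip (G x) (christoffel G x v w) u = koszul G x v w u"
proof -
  let ?z = "\<chi> l. koszul G x v w (axis l 1)"
  have "inj ((*v) (G x))"
    unfolding matrix_left_invertible_injective[symmetric] matrix_left_invertible_ker
    using pd by (metis gip_def inner_zero_right less_irrefl pos_def_def)
  then have "invertible (G x)"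
    by (metis invertible_left_inverse matrix_left_invertible_injective)
  then have "G x ** matrix_inv (G x) = mat 1"
    unfolding invertible_def matrix_inv_def by (rule someI2_ex) simp
  then have "G x *v christoffel G x v w = ?z"
    by (simp add: christoffel_def matrix_vector_mul_assoc)
  then have 1: "gip (G x) (christoffel G x v w) u = u \<bullet> ?z"
    using gip_commute[OF pd] by (metis gip_def)
  have lin: "linear (koszul G x v w)"
  proof -
    have L: "linear (frechet_derivative G (at x))"
      by (rule linear_frechet_derivative[OF d])
    show ?thesis
      unfolding koszul_def frechet_derivative_gip[OF d]
      by (rule linearI)
        (simp_all add: linear_add[OF L] linear_scale[OF L] gip_def matrix_vector_mult_add_rdistrib
          inner_add_right inner_add_left matrix_vector_right_distrib matrix_vector_mult_scaleR
          scaleR_matrix_vector_assoc[symmetric] field_simps)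
  qed
  have "koszul G x v w u = koszul G x v w (\<Sum>l\<in>UNIV. u $ l *\<^sub>R axis l 1)"
    by (simp add: basis_expansion scalar_mult_eq_scaleR[symmetric])
  also have "\<dots> = (\<Sum>l\<in>UNIV. u $ l * koszul G x v w (axis l 1))"
    by (simp add: linear_sum[OF lin] linear_scale[OF lin])
  also have "\<dots> = u \<bullet> ?z" by (simp add: inner_vec_def)
  finally show ?thesis using 1 by simp
qed

lemma christoffel_metric:
  assumes "open S" "x \<in> S" "\<And>y. y \<in> S \<Longrightarrow> pos_def (G y)" "G differentiable (at x)"
  shows "frechet_derivative (\<lambda>y. gip (G y) v w) (at x) u =
    gip (G x) (christoffel G x u v) w + gip (G x) v (christoffel G x u w)"
  using frechet_derivative_gip_commute[OF assms]
  by (simp add: gip_commute[OF assms(3)[OF assms(2)], of v] gip_christoffel assms koszul_def)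
    (simp add: field_simps)

definition nabla_vector ::
  "(real^'n \<Rightarrow> real^'n^'n) \<Rightarrow> real^'n \<Rightarrow> (real^'n \<Rightarrow> real^'n) \<Rightarrow> real^'n \<Rightarrow> real^'n" where
  "nabla_vector G v W x = frechet_derivative W (at x) v + christoffel G x v (W x)"

text \<open>\<open>R(u,v)w = \<nabla>\<^sub>u \<nabla>\<^sub>v w - \<nabla>\<^sub>v \<nabla>\<^sub>u w\<close>; the term with \<open>[u,v]\<close> vanishes for constant components.\<close>

definition curvature_op ::
  "(real^'n \<Rightarrow> real^'n^'n) \<Rightarrow> real^'n \<Rightarrow> real^'n \<Rightarrow> real^'n \<Rightarrow> real^'n \<Rightarrow> real^'n" where
  "curvature_op G x u v w =
     nabla_vector G u (nabla_vector G v (\<lambda>_. w)) x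
     - nabla_vector G v (nabla_vector G u (\<lambda>_. w)) x"

text \<open>\<open>R(u \<and> v; z \<and> w) = g(R(u,v)w, z)\<close>, so that \<open>R(u \<and> v; u \<and> v)\<close> is the sectional
  curvature for orthonormal \<open>u\<close>, \<open>v\<close>.\<close>

definition curvature_form :: "(real^'n \<Rightarrow> real^'n^'n) \<Rightarrow> real^'n \<Rightarrow> (real^'n) dform" where
  "curvature_form G x xs ys = (case (xs, ys) of
     ([u, v], [z, w]) \<Rightarrow> gip (G x) (curvature_op G x u v w) z | _ \<Rightarrow> 0)"


section \<open>Differential operators on double form fields in a chart\<close>

text \<open>The covariant derivative \<open>(\<nabla>\<^sub>v \<omega>)(xs; ys)\<close> at \<open>x\<close> of a double form field \<open>\<omega>\<close>.\<close>

definition nabla_dform ::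
  "(real^'n \<Rightarrow> real^'n^'n) \<Rightarrow> real^'n \<Rightarrow> (real^'n \<Rightarrow> (real^'n) dform)
     \<Rightarrow> real^'n \<Rightarrow> (real^'n) dform" where
  "nabla_dform G v \<omega> x xs ys =
     frechet_derivative (\<lambda>y. \<omega> y xs ys) (at x) v
     - (\<Sum>i<length xs. \<omega> x (xs[i := christoffel G x v (xs ! i)]) ys)
     - (\<Sum>i<length ys. \<omega> x xs (ys[i := christoffel G x v (ys ! i)]))"

text \<open>The index \<open>j\<close> starts at \<open>0\<close>, whence the sign \<open>(-1)\<^sup>j\<close>.\<close>

definition D_op ::
  "(real^'n \<Rightarrow> real^'n^'n) \<Rightarrow> (real^'n \<Rightarrow> (real^'n) dform) \<Rightarrow> real^'n \<Rightarrow> (real^'n) dform" where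
  "D_op G \<omega> x xs ys =
     (\<Sum>j<length xs. (-1) ^ j * nabla_dform G (xs ! j) \<omega> x (take j xs @ drop (Suc j) xs) ys)"

definition delta_op ::
  "(real^'n \<Rightarrow> real^'n^'n) \<Rightarrow> (real^'n \<Rightarrow> (real^'n) dform) \<Rightarrow> real^'n \<Rightarrow> (real^'n) dform" where
  "delta_op G \<omega> x xs ys =
     - (\<Sum>i<CARD('n). nabla_dform G (onb (G x) i) \<omega> x (onb (G x) i # xs) ys)"


section \<open>Global notions\<close>

text \<open>The field \<open>R\<^sup>k\<close>, by its coordinate expression in each chart.\<close>

definition curvature_power ::
  "('m, 'n::finite) metric \<Rightarrow> nat \<Rightarrow> ('m, 'n::finite) chart \<Rightarrow> real^'n \<Rightarrow> (real^'n) dform" where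
  "curvature_power g k c x = dpow (curvature_form (g c) x) k"

text \<open>The field \<open>g\<^sup>r\<^sup>-\<^sup>2\<^sup>k R\<^sup>k\<close>, for \<open>n = 2r\<close> and \<open>2k \<le> r\<close>.\<close>

definition thorpe_form ::
  "('m, 'n::finite) metric \<Rightarrow> nat \<Rightarrow> nat \<Rightarrow> ('m, 'n::finite) chart \<Rightarrow> real^'n \<Rightarrow> (real^'n) dform" where
  "thorpe_form g r k c x =
     dform_mult (dpow (metric_form (g c x)) (r - 2 * k)) (curvature_power g k c x)"

definition is_thorpe :: "('m, 'n::finite) chart set \<Rightarrow> ('m, 'n::finite) metric \<Rightarrow> nat \<Rightarrow> nat \<Rightarrow> bool" where
  "is_thorpe \<A> g r k \<longleftrightarrow> (\<forall>c\<in>\<A>. \<forall>x\<in>chart_image c. \<forall>xs ys.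
     double_star (g c x) (thorpe_form g r k c x) xs ys = thorpe_form g r k c x xs ys)"

definition is_anti_thorpe :: "('m, 'n::finite) chart set \<Rightarrow> ('m, 'n::finite) metric \<Rightarrow> nat \<Rightarrow> nat \<Rightarrow> bool" where
  "is_anti_thorpe \<A> g r k \<longleftrightarrow> (\<forall>c\<in>\<A>. \<forall>x\<in>chart_image c. \<forall>xs ys.
     double_star (g c x) (thorpe_form g r k c x) xs ys = - thorpe_form g r k c x xs ys)"

definition harmonic_dform ::
  "('m, 'n::finite) chart set \<Rightarrow> ('m, 'n::finite) metric
     \<Rightarrow> (('m, 'n::finite) chart \<Rightarrow> real^'n \<Rightarrow> (real^'n) dform) \<Rightarrow> bool" where
  "harmonic_dform \<A> g \<omega> \<longleftrightarrow> (\<forall>c\<in>\<A>. \<forall>x\<in>chart_image c. \<forall>xs ys.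
     D_op (g c) (\<omega> c) x xs ys = 0 \<and> delta_op (g c) (\<omega> c) x xs ys = 0)"

end

theory Submission
  imports Defs "HOL-Library.Function_Algebras" "HOL-Combinatorics.Multiset_Permutations"
begin

text \<open>
  The statement is local. Let \<open>T = g\<^sup>l R\<^sup>k\<close> with \<open>l = r - 2k\<close>. The second Bianchi identity and
  the Leibniz rule give \<open>D R\<^sup>k = 0\<close> and, as \<open>\<nabla>g = 0\<close>, also \<open>D T = 0\<close>. The star commutes with \<open>\<nabla>\<close>
  and conjugates \<open>D\<close> into \<open>\<delta>\<close>, so \<open>\<star>T = \<plusminus>T\<close> yields \<open>\<delta> T = 0\<close>. By the symmetry of \<open>R\<close>, the
  operator \<open>D\<close> of the second group of arguments also kills \<open>R\<^sup>k\<close>, whence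
  \<open>\<delta>(g\<^sup>l R\<^sup>k) = \<plusminus> g\<^sup>l \<delta> R\<^sup>k\<close>. Finally \<open>\<delta> R\<^sup>k\<close> has degree \<open>(2k - 1, 2k)\<close>, and multiplication
  by \<open>g\<^sup>l\<close> is injective on \<open>(p,q)\<close> double forms with \<open>p + q + l \<le> n\<close>.
\<close>

section \<open>Exterior products and contractions\<close>

text \<open>Two obstacles shape the proof. First, the star is defined through the frame
  \<open>onb\<close>, chosen pointwise with no continuity in the point, so the Thorpe condition
  cannot be differentiated as it stands. It is rewritten with sums over all multi-indices, which are
  iterated traces and hence the same in every orthonormal frame, and is then differentiated in a
  frame parallel to first order at the point. Second, \<open>nabla_dform\<close> carries Christoffel
  corrections in every argument. Evaluation on fields parallel to first order turns it into an
  ordinary derivative, so that the Leibniz rule, alternation and multilinearity pass to it without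
  index computations. What remains is pointwise algebra: a family of double forms indexed by a
  direction stands for the covariant derivative, and D and the divergence are its alternation and
  its trace. The degree bound closes with room: (2k - 1) + 2k + (r - 2k) = r + 2k - 1, which 2k <= r
  keeps below n = 2r. Of the factor by which the star acts only its being nonzero is used, so both
  signs are handled at once.\<close>

lemma shuffle_sign_image_Suc:
  assumes "S \<subseteq> {..<n}"
  shows "shuffle_sign (Suc n) (Suc ` S) = (-1) ^ card S * shuffle_sign n S"
proof -
  have fS: "finite S" using assms finite_subset by blast
  let ?P = "{(i, j). i \<in> S \<and> j \<in> {..<n} - S \<and> j < i}"
  have fP: "finite ?P" by (rule finite_subset[of _ "S \<times> {..<n}"]) (use fS in auto)
  \<comment> \<open>The new inversions pair each shifted element with the index 0, which lies in the
    complement.\<close>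
  have "{(i, j). i \<in> Suc ` S \<and> j \<in> {..<Suc n} - Suc ` S \<and> j < i} =
      (\<lambda>i. (Suc i, 0)) ` S \<union> map_prod Suc Suc ` ?P" (is "?L = _")
  proof (intro subset_antisym subsetI)
    fix p assume "p \<in> ?L"
    then obtain i j where "p = (Suc i, j)" "i \<in> S" "j < Suc n" "j \<notin> Suc ` S" "j < Suc i" by auto
    then show "p \<in> (\<lambda>i. (Suc i, 0)) ` S \<union> map_prod Suc Suc ` ?P"
      by (cases j) (auto simp: image_iff)
  qed (use assms in auto)
  moreover have "card ((\<lambda>i. (Suc i, 0)) ` S \<union> map_prod Suc Suc ` ?P) =
      card ((\<lambda>i. (Suc i, 0::nat)) ` S) + card (map_prod Suc Suc ` ?P)"
    by (rule card_Un_disjoint) (use fS fP in blast, use fP in blast, auto)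
  moreover have "card ((\<lambda>i. (Suc i, 0::nat)) ` S) = card S" "card (map_prod Suc Suc ` ?P) = card ?P"
    by (auto intro!: card_image simp: inj_on_def)
  ultimately show ?thesis by (simp add: shuffle_sign_def power_add)
qed

lemma shuffle_sign_insert_0:
  assumes "S \<subseteq> {..<n}"
  shows "shuffle_sign (Suc n) (insert 0 (Suc ` S)) = shuffle_sign n S"
proof -
  let ?P = "{(i, j). i \<in> S \<and> j \<in> {..<n} - S \<and> j < i}"
  have "{(i, j). i \<in> insert 0 (Suc ` S) \<and> j \<in> {..<Suc n} - insert 0 (Suc ` S) \<and> j < i} =
      map_prod Suc Suc ` ?P" (is "?L = _")
  proof (intro subset_antisym subsetI)
    fix p assume "p \<in> ?L"
    then obtain i j where "p = (Suc i, j)" "i \<in> S" "j < Suc n" "j \<notin> Suc ` S" "j < Suc i" "j \<noteq> 0"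
      by auto
    then show "p \<in> map_prod Suc Suc ` ?P"
      by (cases j) (auto simp: image_iff)
  qed (use assms in auto)
  moreover have "card \<dots> = card ?P"
    by (auto simp: card_image inj_on_def)
  ultimately show ?thesis by (simp add: shuffle_sign_def)
qed

text \<open>Splitting subsets by membership of 0 turns a sum over shuffles into a recursion on the
  first argument; the two sign lemmas above supply its coefficients.\<close>

lemma sum_Pow_lessThan_Suc:
  fixes f :: "nat set \<Rightarrow> 'a::comm_monoid_add"
  shows "(\<Sum>S\<in>Pow {..<Suc n}. f S) =
    (\<Sum>S\<in>Pow {..<n}. f (insert 0 (Suc ` S))) + (\<Sum>S\<in>Pow {..<n}. f (Suc ` S))"
proof -
  have 1: "Pow {..<Suc n} = insert 0 ` (image Suc ` Pow {..<n}) \<union> image Suc ` Pow {..<n}"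
    unfolding lessThan_Suc_eq_insert_0 Pow_insert by (auto simp: image_Pow_surj)
  have "inj_on (insert 0 \<circ> image Suc) (Pow {..<n})"
    by (auto simp: inj_on_def dest!: insert_ident[THEN iffD1, rotated 2])
  then have 2: "sum f (insert 0 ` (image Suc ` Pow {..<n})) = (\<Sum>S\<in>Pow {..<n}. f (insert 0 (Suc ` S)))"
    unfolding image_comp by (subst sum.reindex) auto
  have 3: "sum f (image Suc ` Pow {..<n}) = (\<Sum>S\<in>Pow {..<n}. f (Suc ` S))"
    by (subst sum.reindex) (auto simp: inj_on_def inj_image_eq_iff)
  show ?thesis unfolding 1 by (subst sum.union_disjoint) (auto simp: 2 3)
qed

text \<open>The grading involution: the sign that a contraction picks up when it passes a form, with
  the degree read off the length of the list.\<close>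

definition sgn_form :: "'v form \<Rightarrow> 'v form" where
  "sgn_form \<alpha> xs = (-1) ^ length xs * \<alpha> xs"

lemma nths_Cons_Suc [simp]:
  "nths (x # xs) (insert 0 (Suc ` S)) = x # nths xs S"
  "nths (x # xs) (Suc ` S) = nths xs S"
  "nths (x # xs) (- insert 0 (Suc ` S)) = nths xs (- S)"
  "nths (x # xs) (- (Suc ` S)) = x # nths xs (- S)"
  by (auto simp: nths_Cons inj_image_mem_iff intro!: arg_cong[where f = "nths xs"])

lemma length_nths_subset: "S \<subseteq> {..<length xs} \<Longrightarrow> length (nths xs S) = card S"
  by (auto simp: length_nths intro!: arg_cong[where f = card])

lemma wedge_Nil [simp]: "wedge \<alpha> \<beta> [] = \<alpha> [] * \<beta> []"
  by (simp add: wedge_def shuffle_sign_def)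

text \<open>Contraction with the first argument is an antiderivation. Together with \<open>wedge_Nil\<close> this
  determines the exterior product, and neither linearity nor alternation is needed.\<close>

lemma wedge_Cons:
  "wedge \<alpha> \<beta> (x # xs) =
     wedge (\<lambda>as. \<alpha> (x # as)) \<beta> xs + wedge (sgn_form \<alpha>) (\<lambda>as. \<beta> (x # as)) xs"
  unfolding wedge_def sgn_form_def length_Cons sum_Pow_lessThan_Suc
  by (intro arg_cong2[where f = "(+)"] sum.cong refl)
    (auto simp: length_nths_subset shuffle_sign_insert_0 shuffle_sign_image_Suc)

section \<open>The algebra of double forms and contractions in either group of arguments\<close>

notation dform_mult (infixl "\<odot>" 70)

definition ins1 :: "'v \<Rightarrow> 'v dform \<Rightarrow> 'v dform" where
  "ins1 x \<omega> = (\<lambda>xs ys. \<omega> (x # xs) ys)"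
definition ins2 :: "'v \<Rightarrow> 'v dform \<Rightarrow> 'v dform" where
  "ins2 y \<omega> = (\<lambda>xs ys. \<omega> xs (y # ys))"
definition sg1 :: "'v dform \<Rightarrow> 'v dform" where
  "sg1 \<omega> = (\<lambda>xs ys. (-1) ^ length xs * \<omega> xs ys)"
definition sg2 :: "'v dform \<Rightarrow> 'v dform" where
  "sg2 \<omega> = (\<lambda>xs ys. (-1) ^ length ys * \<omega> xs ys)"
text \<open>Exchanging the two groups respects products (\<open>flip_mult\<close>), so each fact
  about the second group of arguments is the mirror image of one about the first.\<close>

definition flip :: "'v dform \<Rightarrow> 'v dform" where
  "flip \<omega> = (\<lambda>xs ys. \<omega> ys xs)"
definition dscale :: "real \<Rightarrow> 'v dform \<Rightarrow> 'v dform" where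
  "dscale c \<omega> = (\<lambda>xs ys. c * \<omega> xs ys)"

text \<open>For a fixed shuffle of the second group the product is an ordinary wedge in the first;
  this carries \<open>wedge_Cons\<close> over to double forms.\<close>

lemma dform_mult_wedge:
  "(\<omega> \<odot> \<theta>) xs ys = (\<Sum>T\<in>Pow {..<length ys}. shuffle_sign (length ys) T *
      wedge (\<lambda>as. \<omega> as (nths ys T)) (\<lambda>as. \<theta> as (nths ys (- T))) xs)"
  unfolding dform_mult_def wedge_def
  by (subst sum.swap) (simp add: sum_distrib_left mult_ac)

lemma flip_mult: "flip (\<omega> \<odot> \<theta>) = flip \<omega> \<odot> flip \<theta>"
  unfolding flip_def dform_mult_def
  by (intro ext, subst sum.swap) (simp add: mult_ac)

lemma flip_flip [simp]: "flip (flip \<omega>) = \<omega>"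
  by (simp add: flip_def)

lemma flip_ins [simp]: "flip (ins1 x \<omega>) = ins2 x (flip \<omega>)" "flip (ins2 x \<omega>) = ins1 x (flip \<omega>)"
  "flip (sg1 \<omega>) = sg2 (flip \<omega>)" "flip (sg2 \<omega>) = sg1 (flip \<omega>)"
  "flip (\<omega> + \<theta>) = flip \<omega> + flip \<theta>"  "flip (- \<omega>) = - flip \<omega>" "flip 0 = 0"
  by (auto simp: flip_def ins1_def ins2_def sg1_def sg2_def fun_eq_iff)

lemma flip_eq_iff [simp]: "flip \<omega> = flip \<theta> \<longleftrightarrow> \<omega> = \<theta>"
  by (metis flip_flip)

lemma mult_Nil: "(\<omega> \<odot> \<theta>) [] [] = \<omega> [] [] * \<theta> [] []"
  by (simp add: dform_mult_def shuffle_sign_def)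

lemma ins1_mult: "ins1 x (\<omega> \<odot> \<theta>) = ins1 x \<omega> \<odot> \<theta> + sg1 \<omega> \<odot> ins1 x \<theta>"
  by (intro ext)
    (simp add: ins1_def sg1_def dform_mult_wedge wedge_Cons sum.distrib distrib_left
      sgn_form_def[abs_def])

lemma ins2_mult: "ins2 x (\<omega> \<odot> \<theta>) = ins2 x \<omega> \<odot> \<theta> + sg2 \<omega> \<odot> ins2 x \<theta>"
  by (subst flip_eq_iff[symmetric]) (simp add: flip_mult ins1_mult)

lemma mult_add_left: "(\<omega> + \<omega>') \<odot> \<theta> = \<omega> \<odot> \<theta> + \<omega>' \<odot> \<theta>"
  by (intro ext) (simp add: dform_mult_def algebra_simps sum.distrib)

lemma mult_add_right: "\<theta> \<odot> (\<omega> + \<omega>') = \<theta> \<odot> \<omega> + \<theta> \<odot> \<omega>'"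
  by (intro ext) (simp add: dform_mult_def algebra_simps sum.distrib)

lemma mult_zero [simp]: "0 \<odot> \<omega> = 0" "\<omega> \<odot> 0 = 0"
  by (auto simp: dform_mult_def fun_eq_iff)

lemma mult_dscale: "dscale c \<omega> \<odot> \<theta> = dscale c (\<omega> \<odot> \<theta>)" "\<omega> \<odot> dscale c \<theta> = dscale c (\<omega> \<odot> \<theta>)"
  by (auto simp: dform_mult_def dscale_def fun_eq_iff sum_distrib_left mult_ac)

lemma mult_minus [simp]: "- \<omega> \<odot> \<theta> = - (\<omega> \<odot> \<theta>)" "\<omega> \<odot> - \<theta> = - (\<omega> \<odot> \<theta>)"
  by (auto simp: dform_mult_def fun_eq_iff sum_negf)

lemma length_nths_add:
  assumes "S \<subseteq> {..<length xs}"
  shows "length (nths xs S) + length (nths xs (- S)) = length xs"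
proof -
  have "card {i. i < length xs \<and> i \<in> S} + card {i. i < length xs \<and> i \<in> - S}
      = card ({i. i < length xs \<and> i \<in> S} \<union> {i. i < length xs \<and> i \<in> - S})"
    by (subst card_Un_disjoint) auto
  also have "{i. i < length xs \<and> i \<in> S} \<union> {i. i < length xs \<and> i \<in> - S} = {..<length xs}" by auto
  finally show ?thesis by (simp add: length_nths)
qed

lemma sg_mult: "sg1 (\<omega> \<odot> \<theta>) = sg1 \<omega> \<odot> sg1 \<theta>" "sg2 (\<omega> \<odot> \<theta>) = sg2 \<omega> \<odot> sg2 \<theta>"
proof -
  show 1: "sg1 (\<omega> \<odot> \<theta>) = sg1 \<omega> \<odot> sg1 \<theta>" for \<omega> \<theta> :: "'a dform"
    unfolding sg1_def dform_mult_def sum_distrib_left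
  proof (intro ext sum.cong refl)
    fix xs ys :: "'a list" and S T assume "S \<in> Pow {..<length xs}"
    then have "(- 1 :: real) ^ length xs = (- 1) ^ length (nths xs S) * (- 1) ^ length (nths xs (- S))"
      by (metis PowD length_nths_add power_add)
    then show "(- 1) ^ length xs * (shuffle_sign (length xs) S * shuffle_sign (length ys) T *
        \<omega> (nths xs S) (nths ys T) * \<theta> (nths xs (- S)) (nths ys (- T))) =
      shuffle_sign (length xs) S * shuffle_sign (length ys) T *
        ((- 1) ^ length (nths xs S) * \<omega> (nths xs S) (nths ys T)) *
        ((- 1) ^ length (nths xs (- S)) * \<theta> (nths xs (- S)) (nths ys (- T)))"
      by simp
  qed
  show "sg2 (\<omega> \<odot> \<theta>) = sg2 \<omega> \<odot> sg2 \<theta>"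
    by (subst flip_eq_iff[symmetric]) (simp add: flip_mult 1)
qed

lemma sg_simps [simp]:
  "sg1 (sg1 \<omega>) = \<omega>" "sg2 (sg2 \<omega>) = \<omega>"
  "ins1 x (sg1 \<omega>) = - sg1 (ins1 x \<omega>)" "ins2 x (sg2 \<omega>) = - sg2 (ins2 x \<omega>)"
  "ins1 x (sg2 \<omega>) = sg2 (ins1 x \<omega>)" "ins2 x (sg1 \<omega>) = sg1 (ins2 x \<omega>)"
  "sg1 (\<omega> + \<theta>) = sg1 \<omega> + sg1 \<theta>" "sg2 (\<omega> + \<theta>) = sg2 \<omega> + sg2 \<theta>"
  "sg1 (- \<omega>) = - sg1 \<omega>" "sg2 (- \<omega>) = - sg2 \<omega>"
  "ins1 x (\<omega> + \<theta>) = ins1 x \<omega> + ins1 x \<theta>" "ins2 x (\<omega> + \<theta>) = ins2 x \<omega> + ins2 x \<theta>"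
  "ins1 x (- \<omega>) = - ins1 x \<omega>" "ins2 x (- \<omega>) = - ins2 x \<omega>"
  "ins1 x 0 = 0" "ins2 x 0 = 0" "sg1 0 = 0" "sg2 0 = 0"
  by (auto simp: ins1_def ins2_def sg1_def sg2_def fun_eq_iff distrib_left
      simp flip: mult.assoc power_add)

lemma mult_Cons1: "(\<omega> \<odot> \<theta>) (x # xs) ys = (ins1 x \<omega> \<odot> \<theta>) xs ys + (sg1 \<omega> \<odot> ins1 x \<theta>) xs ys"
  using ins1_mult[of x \<omega> \<theta>] by (simp add: ins1_def fun_eq_iff)

lemma mult_Cons2: "(\<omega> \<odot> \<theta>) xs (y # ys) = (ins2 y \<omega> \<odot> \<theta>) xs ys + (sg2 \<omega> \<odot> ins2 y \<theta>) xs ys"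
  using ins2_mult[of y \<omega> \<theta>] by (simp add: ins2_def fun_eq_iff)

text \<open>Both bracketings agree on empty lists and obey the same contraction rules, so induction
  on the first list and then on the second avoids iterated shuffles altogether.\<close>

lemma mult_assoc: "(\<omega> \<odot> \<theta>) \<odot> \<eta> = \<omega> \<odot> (\<theta> \<odot> \<eta>)"
proof (intro ext)
  fix xs ys
  show "((\<omega> \<odot> \<theta>) \<odot> \<eta>) xs ys = (\<omega> \<odot> (\<theta> \<odot> \<eta>)) xs ys"
  proof (induction xs arbitrary: \<omega> \<theta> \<eta>)
    case Nil
    show ?case
    proof (induction ys arbitrary: \<omega> \<theta> \<eta>)
      case Nil show ?case by (simp add: mult_Nil)
    next
      case (Cons y ys)
      then show ?case
        by (simp add: mult_Cons2 ins2_mult sg_mult mult_add_left mult_add_right)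
    qed
  next
    case (Cons x xs)
    then show ?case
      by (simp add: mult_Cons1 ins1_mult sg_mult mult_add_left mult_add_right)
  qed
qed

definition dform_one :: "'v dform" where "dform_one = form_tensor form_one form_one"

lemma ins_dform_one [simp]: "ins1 x dform_one = 0" "ins2 x dform_one = 0"
  "sg1 dform_one = dform_one" "sg2 dform_one = dform_one"
  by (auto simp: dform_one_def form_tensor_def form_one_def ins1_def ins2_def sg1_def sg2_def fun_eq_iff)

lemma mult_one_left [simp]: "dform_one \<odot> \<omega> = \<omega>"
proof (intro ext)
  fix xs ys
  show "(dform_one \<odot> \<omega>) xs ys = \<omega> xs ys"
  proof (induction xs arbitrary: \<omega>)
    case Nil
    show ?case
    proof (induction ys arbitrary: \<omega>)
      case Nil show ?case by (simp add: mult_Nil dform_one_def form_tensor_def form_one_def)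
    qed (simp add: mult_Cons2, simp add: ins2_def)
  qed (simp add: mult_Cons1, simp add: ins1_def)
qed

section \<open>Exterior derivatives and algebraic forms\<close>

lemma mult_diff_left: "(\<omega> - \<omega>') \<odot> \<theta> = \<omega> \<odot> \<theta> - \<omega>' \<odot> \<theta>"
  using mult_add_left[of \<omega> "- \<omega>'" \<theta>] by simp

lemma mult_diff_right: "\<theta> \<odot> (\<omega> - \<omega>') = \<theta> \<odot> \<omega> - \<theta> \<odot> \<omega>'"
  using mult_add_right[of \<theta> \<omega> "- \<omega>'"] by simp

text \<open>With \<open>F v\<close> the covariant derivative of a field in direction v this is D of
  the field. Keeping only the family \<open>F\<close> makes the Leibniz rule a statement of algebra
  at one point.\<close>

definition dD :: "('v \<Rightarrow> 'v dform) \<Rightarrow> 'v dform" where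
  "dD F = (\<lambda>xs ys. \<Sum>j<length xs. (-1) ^ j * F (xs ! j) (take j xs @ drop (Suc j) xs) ys)"

lemma dD_Nil [simp]: "dD F [] ys = 0"
  by (simp add: dD_def)

text \<open>The term that omits x comes first; in the others x stays in front and every sign shifts
  by one. This Cartan-type recursion drives the inductions for the Leibniz rules.\<close>

lemma dD_Cons: "dD F (x # xs) ys = F x xs ys - dD (\<lambda>v. ins1 x (F v)) xs ys"
  by (simp add: dD_def ins1_def sum.lessThan_Suc_shift sum_negf del: sum.lessThan_Suc)

lemma ins1_dD: "ins1 x (dD F) = F x + - dD (\<lambda>v. ins1 x (F v))"
  by (intro ext) (simp add: ins1_def[of x "dD F"] dD_Cons)

lemma dD_add: "dD (\<lambda>v. F v + H v) = dD F + dD H"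
  by (auto simp: dD_def fun_eq_iff sum.distrib distrib_left)

text \<open>The alternation raises the first degree by one, so the sign taken before it differs from
  the sign taken after it.\<close>

lemma dD_sg1: "dD (\<lambda>v. sg1 (F v)) = - sg1 (dD F)"
proof (intro ext)
  fix xs :: "'a list" and ys
  have "(- 1 :: real) ^ length xs = - ((-1) ^ (length xs - 1))" if "j < length xs" for j
    using that by (cases xs) auto
  then show "dD (\<lambda>v. sg1 (F v)) xs ys = (- sg1 (dD F)) xs ys"
    by (auto simp: dD_def sg1_def sum_distrib_left sum_negf[symmetric] mult_ac intro!: sum.cong)
qed

lemma mult_Nil1_eq_0:
  assumes "\<And>bs. \<omega> [] bs = 0"
  shows "(\<omega> \<odot> \<theta>) [] ys = 0"
  by (simp add: dform_mult_def assms)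

text \<open>Contraction with the first argument yields matching terms on both sides, by
  \<open>dD_Cons\<close> and the antiderivation rule. The direction enters in front of
  \<open>F\<close>, so no sign arises.\<close>

lemma dD_mult_left: "dD (\<lambda>v. F v \<odot> \<theta>) = dD F \<odot> \<theta>"
proof (intro ext)
  fix xs ys
  show "dD (\<lambda>v. F v \<odot> \<theta>) xs ys = (dD F \<odot> \<theta>) xs ys"
  proof (induction xs arbitrary: F \<theta>)
    case Nil then show ?case by (simp add: mult_Nil1_eq_0)
  next
    case (Cons x xs)
    have "dD (\<lambda>v. F v \<odot> \<theta>) (x # xs) ys =
      (F x \<odot> \<theta>) xs ys - ((dD (\<lambda>v. ins1 x (F v)) \<odot> \<theta>) xs ys + (dD (\<lambda>v. sg1 (F v)) \<odot> ins1 x \<theta>) xs ys)"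
      by (simp add: dD_Cons ins1_mult dD_add Cons)
    then show ?case
      by (simp add: mult_Cons1 ins1_dD dD_sg1 mult_diff_left)
  qed
qed

text \<open>Same induction as for \<open>dD_mult_left\<close>, but the direction now has to pass
  \<omega>, which costs the sign of its first degree.\<close>

lemma dD_mult_right: "dD (\<lambda>v. \<omega> \<odot> F v) = sg1 \<omega> \<odot> dD F"
proof (intro ext)
  fix xs ys
  show "dD (\<lambda>v. \<omega> \<odot> F v) xs ys = (sg1 \<omega> \<odot> dD F) xs ys"
  proof (induction xs arbitrary: F \<omega>)
    case Nil then show ?case by (simp add: dform_mult_def)
  next
    case (Cons x xs)
    have "dD (\<lambda>v. \<omega> \<odot> F v) (x # xs) ys =
      (\<omega> \<odot> F x) xs ys - ((sg1 (ins1 x \<omega>) \<odot> dD F) xs ys + (\<omega> \<odot> dD (\<lambda>v. ins1 x (F v))) xs ys)"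
      by (simp add: dD_Cons ins1_mult dD_add Cons)
    then show ?case
      by (simp add: mult_Cons1 ins1_dD mult_diff_right)
  qed
qed

definition dD2 :: "('v \<Rightarrow> 'v dform) \<Rightarrow> 'v dform" where
  "dD2 F = flip (dD (\<lambda>v. flip (F v)))"

lemma dD2_apply: "dD2 F xs ys = (\<Sum>j<length ys. (-1) ^ j * F (ys ! j) xs (take j ys @ drop (Suc j) ys))"
  by (simp add: dD2_def dD_def flip_def)

lemma dD2_mult_right: "dD2 (\<lambda>v. \<omega> \<odot> F v) = sg2 \<omega> \<odot> dD2 F"
  by (simp add: dD2_def flip_mult dD_mult_right)

section \<open>Alternation and multilinearity of functions on lists\<close>

definition alternating :: "'v form \<Rightarrow> bool" where
  "alternating \<alpha> \<longleftrightarrow> (\<forall>us x y vs. \<alpha> (us @ x # y # vs) = - \<alpha> (us @ y # x # vs))"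

definition multilinear :: "'v::real_vector form \<Rightarrow> bool" where
  "multilinear \<alpha> \<longleftrightarrow> (\<forall>us vs. linear (\<lambda>x. \<alpha> (us @ x # vs)))"

lemma alternating_swap: "alternating \<alpha> \<Longrightarrow> \<alpha> (us @ x # y # vs) = - \<alpha> (us @ y # x # vs)"
  unfolding alternating_def by blast

lemma multilinear_linear: "multilinear \<alpha> \<Longrightarrow> linear (\<lambda>x. \<alpha> (us @ x # vs))"
  by (simp add: multilinear_def)

lemma alternating_front:
  assumes "alternating \<alpha>"
  shows "\<alpha> (us @ x # vs) = (-1) ^ length us * \<alpha> (x # us @ vs)"
proof (induction us arbitrary: vs rule: rev_induct)
  case (snoc u us)
  have "\<alpha> ((us @ [u]) @ x # vs) = - \<alpha> (us @ x # u # vs)"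
    using alternating_swap[OF assms, of us u x vs] by simp
  then show ?case unfolding snoc[of "u # vs"] by simp
qed simp

definition alt1 :: "'v dform \<Rightarrow> bool" where "alt1 \<omega> \<longleftrightarrow> (\<forall>ys. alternating (\<lambda>xs. \<omega> xs ys))"
definition lin1 :: "'v::real_vector dform \<Rightarrow> bool" where "lin1 \<omega> \<longleftrightarrow> (\<forall>ys. multilinear (\<lambda>xs. \<omega> xs ys))"

lemma alt1D: "alt1 \<omega> \<Longrightarrow> \<omega> (us @ x # y # vs) ys = - \<omega> (us @ y # x # vs) ys"
  unfolding alt1_def alternating_def by blast

lemma alt1I: "(\<And>us x y vs ys. \<omega> (us @ x # y # vs) ys = - \<omega> (us @ y # x # vs) ys) \<Longrightarrow> alt1 \<omega>"
  unfolding alt1_def alternating_def by blast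

lemma alt1_ins1:
  assumes "alt1 \<omega>" shows "alt1 (ins1 z \<omega>)"
proof (rule alt1I)
  show "ins1 z \<omega> (us @ x # y # vs) ys = - ins1 z \<omega> (us @ y # x # vs) ys" for us x y vs ys
    using alt1D[OF assms, of "z # us" x y vs ys] by (simp add: ins1_def)
qed

lemma alt1_ins2: "alt1 \<omega> \<Longrightarrow> alt1 (ins2 x \<omega>)"
  unfolding ins2_def by (rule alt1I) (rule alt1D)

lemma alt1_sg1: "alt1 \<omega> \<Longrightarrow> alt1 (sg1 \<omega>)"
  unfolding sg1_def by (rule alt1I, subst alt1D) (assumption, simp)

lemma alt1_sum:
  assumes "\<And>i. i \<in> I \<Longrightarrow> alt1 (\<omega> i)" shows "alt1 (\<lambda>xs ys. \<Sum>i\<in>I. \<omega> i xs ys)"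
proof (rule alt1I)
  fix us x y vs ys
  have "(\<Sum>i\<in>I. \<omega> i (us @ x # y # vs) ys) = (\<Sum>i\<in>I. - \<omega> i (us @ y # x # vs) ys)"
    by (rule sum.cong[OF refl]) (rule alt1D[OF assms])
  then show "(\<Sum>i\<in>I. \<omega> i (us @ x # y # vs) ys) = - (\<Sum>i\<in>I. \<omega> i (us @ y # x # vs) ys)"
    by (simp only: sum_negf)
qed

lemma ins1_ins1: "alt1 \<omega> \<Longrightarrow> ins1 x (ins1 y \<omega>) = - ins1 y (ins1 x \<omega>)"
  using alt1D[of \<omega> "[]" y x] unfolding ins1_def fun_eq_iff fun_Compl_def by auto

text \<open>Contractions remove the prefix \<open>us\<close> until the swapped pair stands in front.
  There the two contractions of a single factor anticommute, and the mixed terms exchange places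
  with opposite signs. Stating alternation by adjacent swaps is what makes this induction
  possible.\<close>

lemma alt1_mult:
  assumes "alt1 \<omega>" "alt1 \<theta>"
  shows "alt1 (\<omega> \<odot> \<theta>)"
proof -
  have "(\<omega> \<odot> \<theta>) (us @ x # y # vs) ys = - (\<omega> \<odot> \<theta>) (us @ y # x # vs) ys" for us x y vs ys
    using assms
  proof (induction us arbitrary: \<omega> \<theta>)
    case Nil
    then show ?case
      by (simp add: mult_Cons1 ins1_mult ins1_ins1[of _ y x])
  next
    case (Cons u us)
    then show ?case by (simp add: mult_Cons1 alt1_ins1 alt1_sg1)
  qed
  then show ?thesis by (rule alt1I)
qed

lemma linear_zero_fun [simp]: "linear (\<lambda>x. 0)"
  by (rule linearI) auto

lemma linear_mult_left_const: "linear f \<Longrightarrow> linear (\<lambda>x. (c::real) * f x)"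
  by (rule linear_compose_scale_right[of f c, unfolded real_scaleR_def])

lemma linear_mult_right_const: "linear f \<Longrightarrow> linear (\<lambda>x. f x * (c::real))"
  using linear_mult_left_const[of f c] by (simp add: mult.commute)

lemma linear_mult_left_dform:
  assumes "\<And>xs ys. linear (\<lambda>v. F v xs ys)"
  shows "linear (\<lambda>v. (F v \<odot> \<theta>) xs ys)"
  unfolding dform_mult_def
  by (intro linear_compose_sum ballI linear_mult_left_const linear_mult_right_const assms)

lemma linear_mult_right_dform:
  assumes "\<And>xs ys. linear (\<lambda>v. F v xs ys)"
  shows "linear (\<lambda>v. (\<theta> \<odot> F v) xs ys)"
  unfolding dform_mult_def
  by (intro linear_compose_sum ballI linear_mult_left_const linear_mult_right_const assms)

lemma lin1D: "lin1 \<omega> \<Longrightarrow> linear (\<lambda>x. \<omega> (us @ x # vs) ys)"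
  by (simp add: lin1_def multilinear_def)

lemma lin1_sum: "(\<And>i. i \<in> I \<Longrightarrow> lin1 (\<omega> i)) \<Longrightarrow> lin1 (\<lambda>xs ys. \<Sum>i\<in>I. \<omega> i xs ys)"
  by (simp add: lin1_def multilinear_def linear_compose_sum)

lemma lin1_ins1: "lin1 \<omega> \<Longrightarrow> lin1 (ins1 x \<omega>)"
  using lin1D[of \<omega> "x # us" for us] by (simp add: lin1_def multilinear_def ins1_def)

lemma lin1_ins2: "lin1 \<omega> \<Longrightarrow> lin1 (ins2 x \<omega>)"
  by (simp add: lin1_def multilinear_def ins2_def)

lemma lin1_sg1: "lin1 \<omega> \<Longrightarrow> lin1 (sg1 \<omega>)"
  unfolding lin1_def multilinear_def sg1_def length_append length_Cons
  by (intro allI linear_mult_left_const) blast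

lemma lin1_ins1_linear: "lin1 \<omega> \<Longrightarrow> linear (\<lambda>x. ins1 x \<omega> xs ys)"
  using lin1D[of \<omega> "[]"] by (simp add: ins1_def)

text \<open>Again the prefix is contracted away; once the varying argument is in front, it enters
  each term through one contraction, which is linear in it.\<close>

lemma lin1_mult:
  assumes "lin1 \<omega>" "lin1 \<theta>"
  shows "lin1 (\<omega> \<odot> \<theta>)"
proof -
  have "linear (\<lambda>x. (\<omega> \<odot> \<theta>) (us @ x # vs) ys)" for us vs ys
    using assms
  proof (induction us arbitrary: \<omega> \<theta>)
    case Nil
    then show ?case
      by (simp add: mult_Cons1 linear_compose_add linear_mult_left_dform linear_mult_right_dform
          lin1_ins1_linear)
  next
    case (Cons u us)
    then show ?case
      by (simp add: mult_Cons1 lin1_ins1 lin1_sg1 linear_compose_add)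
  qed
  then show ?thesis by (auto simp: lin1_def multilinear_def)
qed

text \<open>The \<open>(p,q)\<close> double forms, as opposed to arbitrary functions of two lists.\<close>

definition is_dform :: "nat \<Rightarrow> nat \<Rightarrow> 'v::real_vector dform \<Rightarrow> bool" where
  "is_dform p q \<omega> \<longleftrightarrow> (\<forall>xs ys. \<omega> xs ys \<noteq> 0 \<longrightarrow> length xs = p \<and> length ys = q) \<and>
     alt1 \<omega> \<and> alt1 (flip \<omega>) \<and> lin1 \<omega> \<and> lin1 (flip \<omega>)"

lemma is_dform_degree:
  "is_dform p q \<omega> \<Longrightarrow> length xs \<noteq> p \<or> length ys \<noteq> q \<Longrightarrow> \<omega> xs ys = 0"
  by (auto simp: is_dform_def)

lemma is_dform_flip: "is_dform p q \<omega> \<Longrightarrow> is_dform q p (flip \<omega>)"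
  by (auto simp: is_dform_def flip_def)

lemma is_dform_mult:
  assumes "is_dform p q \<omega>" "is_dform p' q' \<theta>"
  shows "is_dform (p + p') (q + q') (\<omega> \<odot> \<theta>)"
proof -
  have "length xs = p + p' \<and> length ys = q + q'" if nz: "(\<omega> \<odot> \<theta>) xs ys \<noteq> 0" for xs ys
  proof -
    obtain S where S: "S \<subseteq> {..<length xs}" "(\<Sum>T\<in>Pow {..<length ys}.
     shuffle_sign (length xs) S * shuffle_sign (length ys) T *
     \<omega> (nths xs S) (nths ys T) * \<theta> (nths xs (- S)) (nths ys (- T))) \<noteq> 0"
      using nz unfolding dform_mult_def by (metis (no_types, lifting) PowD sum.neutral)
    then obtain T where T: "T \<subseteq> {..<length ys}" 
      "\<omega> (nths xs S) (nths ys T) \<noteq> 0" "\<theta> (nths xs (- S)) (nths ys (- T)) \<noteq> 0"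
      by (metis (no_types, lifting) PowD sum.neutral mult_zero_left mult_zero_right)
    have "length (nths xs S) = p \<and> length (nths ys T) = q"
      "length (nths xs (- S)) = p' \<and> length (nths ys (- T)) = q'"
      using T(2,3) assms by (auto simp: is_dform_def)
    then show ?thesis using length_nths_add[OF S(1)] length_nths_add[OF T(1)] by simp
  qed
  then show ?thesis using assms
    by (auto simp: is_dform_def alt1_mult lin1_mult flip_mult)
qed

lemma is_dformI:
  assumes "\<And>xs ys. \<omega> xs ys \<noteq> 0 \<Longrightarrow> length xs = p \<and> length ys = q"
    and "alt1 \<omega>" "alt1 (flip \<omega>)" "lin1 \<omega>" "lin1 (flip \<omega>)"
  shows "is_dform p q \<omega>"
  unfolding is_dform_def using assms by blast

lemma is_dformD:
  assumes "is_dform p q \<omega>"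
  shows "alt1 \<omega>" "alt1 (flip \<omega>)" "lin1 \<omega>" "lin1 (flip \<omega>)"
  using assms unfolding is_dform_def by blast+

lemma is_dform_sum:
  assumes "\<And>i. i \<in> I \<Longrightarrow> is_dform p q (\<omega> i)"
  shows "is_dform p q (\<lambda>xs ys. \<Sum>i\<in>I. \<omega> i xs ys)"
proof (rule is_dformI)
  show "length xs = p \<and> length ys = q" if nz: "(\<Sum>i\<in>I. \<omega> i xs ys) \<noteq> 0" for xs ys
  proof -
    obtain i where "i \<in> I" "\<omega> i xs ys \<noteq> 0" using nz by (meson sum.neutral)
    then show ?thesis using is_dform_degree[OF assms, of i xs ys] by auto
  qed
  have "flip (\<lambda>xs ys. \<Sum>i\<in>I. \<omega> i xs ys) = (\<lambda>xs ys. \<Sum>i\<in>I. flip (\<omega> i) xs ys)"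
    by (simp add: flip_def)
  then show "alt1 (flip (\<lambda>xs ys. \<Sum>i\<in>I. \<omega> i xs ys))" "lin1 (flip (\<lambda>xs ys. \<Sum>i\<in>I. \<omega> i xs ys))"
    by (simp_all add: alt1_sum lin1_sum is_dformD[OF assms])
qed (simp_all add: alt1_sum lin1_sum is_dformD[OF assms])

lemma is_dform_ins1:
  assumes "is_dform (Suc p) q \<omega>" shows "is_dform p q (ins1 x \<omega>)"
proof (rule is_dformI)
  show "length xs = p \<and> length ys = q" if "ins1 x \<omega> xs ys \<noteq> 0" for xs ys
    using is_dform_degree[OF assms, of "x # xs" ys] that by (auto simp: ins1_def)
qed (simp_all add: is_dformD[OF assms] alt1_ins1 lin1_ins1 alt1_ins2 lin1_ins2)

lemma is_dform_ins2: "is_dform p (Suc q) \<omega> \<Longrightarrow> is_dform p q (ins2 x \<omega>)"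
  using is_dform_flip[OF is_dform_ins1[OF is_dform_flip], of p q \<omega> x] by simp

lemma is_dform_one: "is_dform 0 0 dform_one"
  by (auto simp: is_dform_def dform_one_def form_tensor_def form_one_def alt1_def lin1_def
      alternating_def multilinear_def flip_def split: if_splits)

lemma is_dform_dpow: "is_dform p q \<omega> \<Longrightarrow> is_dform (k * p) (k * q) (dpow \<omega> k)"
proof (induction k)
  case 0
  then show ?case using is_dform_one by (simp add: dform_one_def)
next
  case (Suc k)
  then show ?case using is_dform_mult[of p q \<omega> "k * p" "k * q"] by simp
qed

lemma mult_sum_right: "\<omega> \<odot> (\<lambda>xs ys. \<Sum>i\<in>I. \<theta> i xs ys) = (\<lambda>xs ys. \<Sum>i\<in>I. (\<omega> \<odot> \<theta> i) xs ys)"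
proof (cases "finite I")
  case True
  then show ?thesis
  proof (induction I)
    case empty
    then show ?case by (simp add: mult_zero(2)[unfolded zero_fun_def])
  next
    case (insert i I)
    have "(\<lambda>xs ys. \<Sum>i\<in>insert i I. \<theta> i xs ys) = \<theta> i + (\<lambda>xs ys. \<Sum>i\<in>I. \<theta> i xs ys)"
      using insert.hyps by (auto simp: fun_eq_iff)
    then show ?case
      using insert by (simp add: mult_add_right)
  qed
qed (simp add: mult_zero(2)[unfolded zero_fun_def])

text \<open>Returning the j-th argument from the front to its place costs (-1)^j and cancels the
  sign of its term, so all terms are equal. This degree count produces p and q in
  \<open>contract_gmult\<close>.\<close>

lemma dD_ins1:
  assumes "alt1 \<omega>"
  shows "dD (\<lambda>v. ins1 v \<omega>) xs ys = real (length xs) * \<omega> xs ys"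
proof -
  have "(-1) ^ j * \<omega> (xs ! j # take j xs @ drop (Suc j) xs) ys = \<omega> xs ys" if "j < length xs" for j
  proof -
    have "alternating (\<lambda>xs. \<omega> xs ys)" using assms by (simp add: alt1_def)
    from alternating_front[OF this, of "take j xs" "xs ! j" "drop (Suc j) xs"] show ?thesis
      using that by (simp add: id_take_nth_drop[symmetric] min.absorb2)
  qed
  then show ?thesis by (simp add: dD_def ins1_def)
qed

lemma dD2_ins2:
  assumes "alt1 (flip \<omega>)"
  shows "dD2 (\<lambda>v. ins2 v \<omega>) xs ys = real (length ys) * \<omega> xs ys"
  using dD_ins1[OF assms, of ys xs] by (simp add: dD2_def) (simp add: flip_def)

section \<open>The Lefschetz map and its adjoint\<close>

lemma ins_diff [simp]:
  "ins1 x (\<omega> - \<theta>) = ins1 x \<omega> - ins1 x \<theta>" "ins2 x (\<omega> - \<theta>) = ins2 x \<omega> - ins2 x \<theta>"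
  by (simp_all add: ins1_def ins2_def fun_eq_iff)

lemma zero_dform: "(\<lambda>a b. 0) = (0 :: 'v dform)"
  by (simp add: fun_eq_iff)

lemmas mult_zero_lambda [simp] = mult_zero[folded zero_dform]

lemma metric_form_simps [simp]:
  "metric_form A [x] [y] = gip A x y"
  "metric_form A [] ys = 0" "metric_form A xs [] = 0"
  "metric_form A (x # x' # xs) ys = 0" "metric_form A xs (y # y' # ys) = 0"
  by (auto simp: metric_form_def split: list.split)

lemma linear_gip_right: "linear (gip A v)"
  unfolding gip_def[abs_def]
  by (rule linearI) (simp_all add: matrix_vector_right_distrib inner_add_right matrix_vector_mult_scaleR)

lemma linear_gip_left: "linear (\<lambda>v. gip A v w)"
  unfolding gip_def[abs_def] by (rule linearI) (simp_all add: inner_add_left)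

lemma is_dform_metric_form: "is_dform 1 1 (metric_form A)"
proof (rule is_dformI)
  show "length xs = 1 \<and> length ys = 1" if "metric_form A xs ys \<noteq> 0" for xs ys
    using that by (auto simp: metric_form_def split: list.splits)
  show "alt1 (metric_form A)" "alt1 (flip (metric_form A))"
    by (auto intro!: alt1I simp: metric_form_def flip_def split: list.splits simp: append_eq_Cons_conv Cons_eq_append_conv)
  have "linear (\<lambda>x. metric_form A (us @ x # vs) ys)" for us vs ys
  proof (cases "us = [] \<and> vs = [] \<and> length ys = 1")
    case True
    then show ?thesis by (auto simp: length_Suc_conv linear_gip_left)
  next
    case False
    have "metric_form A (us @ x # vs) ys = 0" for x
    proof (rule ccontr)
      assume "metric_form A (us @ x # vs) ys \<noteq> 0"
      then have "length (us @ x # vs) = 1 \<and> length ys = 1"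
        by (cases us; cases vs; auto simp: metric_form_def split: list.splits)
      then show False using False by auto
    qed
    then show ?thesis by simp
  qed
  then show "lin1 (metric_form A)" by (simp add: lin1_def multilinear_def)
  have "linear (\<lambda>x. metric_form A ys (us @ x # vs))" for us vs ys
  proof (cases "us = [] \<and> vs = [] \<and> length ys = 1")
    case True
    then show ?thesis by (auto simp: length_Suc_conv linear_gip_right)
  next
    case False
    have "metric_form A ys (us @ x # vs) = 0" for x
    proof (rule ccontr)
      assume "metric_form A ys (us @ x # vs) \<noteq> 0"
      then have "length (us @ x # vs) = 1 \<and> length ys = 1"
        by (cases us; cases vs; auto simp: metric_form_def split: list.splits)
      then show False using False by auto
    qed
    then show ?thesis by simp
  qed
  then show "lin1 (flip (metric_form A))" by (simp add: lin1_def multilinear_def flip_def)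
qed

lemma ins_metric_form:
  "ins2 y (ins1 x (metric_form A)) = dscale (gip A x y) dform_one"
  "sg1 (metric_form A) = - metric_form A" "sg2 (metric_form A) = - metric_form A"
  "sg2 (ins1 x (metric_form A)) = - ins1 x (metric_form A)"
  by (auto simp: fun_eq_iff ins1_def ins2_def dscale_def dform_one_def form_tensor_def form_one_def
      sg1_def sg2_def metric_form_def split: list.split)

lemma ins_dscale: "ins1 x (dscale c \<omega>) = dscale c (ins1 x \<omega>)" "ins2 x (dscale c \<omega>) = dscale c (ins2 x \<omega>)"
  by (simp_all add: ins1_def ins2_def dscale_def)

lemma flip_metric_form: "pos_def A \<Longrightarrow> flip (metric_form A) = metric_form A"
  by (auto simp: fun_eq_iff flip_def metric_form_def gip_commute split: list.split)

lemma dD2_Nil [simp]: "dD2 F xs [] = 0" by (simp add: dD2_apply)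

lemma dD2_Cons: "dD2 F xs (y # ys) = F y xs ys - dD2 (\<lambda>v. ins2 y (F v)) xs ys"
  by (simp add: dD2_apply ins2_def sum.lessThan_Suc_shift sum_negf del: sum.lessThan_Suc)

text \<open>Contracting the metric with x leaves the covector g(x, .) in the second group, and
  multiplying by a covector is an alternation over the arguments of that group.\<close>

lemma ins1_metric_mult:
  "(ins1 x (metric_form A) \<odot> \<theta>) xs ys = dD2 (\<lambda>v. dscale (gip A x v) \<theta>) xs ys"
proof (induction ys arbitrary: \<theta>)
  case Nil
  then show ?case by (simp add: dform_mult_def ins1_def)
next
  case (Cons y ys)
  then show ?case
    by (simp add: mult_Cons2 dD2_Cons ins_metric_form mult_dscale ins_dscale)
qed

text \<open>The frame is a parameter because two kinds occur: the chosen \<open>onb\<close> at a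
  point and frames adapted to a neighbourhood.\<close>

locale euclidean =
  fixes A :: "real^'n^'n" and e :: "nat \<Rightarrow> real^'n"
  assumes pos_def: "pos_def A" and frame: "orthonormal_frame A e"
begin

lemma gip_frame: "i < CARD('n) \<Longrightarrow> j < CARD('n) \<Longrightarrow> gip A (e i) (e j) = (if i = j then 1 else 0)"
  using frame by (simp add: orthonormal_frame_def)

lemma gip_sum_right: "gip A x (\<Sum>i\<in>I. c i *\<^sub>R f i) = (\<Sum>i\<in>I. c i * gip A x (f i))"
  by (simp add: linear_sum[OF linear_gip_right] linear_scale[OF linear_gip_right])

lemma gip_sum_left: "gip A (\<Sum>i\<in>I. c i *\<^sub>R f i) x = (\<Sum>i\<in>I. c i * gip A (f i) x)"
  by (simp add: linear_sum[OF linear_gip_left] linear_scale[OF linear_gip_left])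

text \<open>The n frame vectors are independent, hence span. A vector orthogonal to all of them is
  then orthogonal to itself, so it is 0, and x minus its expansion is such a vector.\<close>

lemma frame_expansion: "x = (\<Sum>i<CARD('n). gip A x (e i) *\<^sub>R e i)"
proof -
  have inj: "inj_on e {..<CARD('n)}"
    using gip_frame by (metis (mono_tags, lifting) inj_onI lessThan_iff zero_neq_one)
  have ind: "independent (e ` {..<CARD('n)})"
    unfolding independent_explicit_module
  proof (intro allI impI)
    fix t u v
    assume t: "finite t" "t \<subseteq> e ` {..<CARD('n)}" and s: "(\<Sum>v\<in>t. u v *\<^sub>R v) = 0" and v: "v \<in> t"
    then obtain j where j: "j < CARD('n)" "v = e j" by auto
    have "0 = gip A (e j) (\<Sum>v\<in>t. u v *\<^sub>R v)" by (simp add: s linear_0[OF linear_gip_right])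
    also have "\<dots> = (\<Sum>w\<in>t. u w * gip A (e j) w)" by (rule gip_sum_right)
    also have "\<dots> = (\<Sum>w\<in>t. if w = v then u v else 0)"
    proof (rule sum.cong[OF refl])
      fix w assume "w \<in> t"
      then obtain i where i: "i < CARD('n)" "w = e i" using t by auto
      show "u w * gip A (e j) w = (if w = v then u v else 0)"
        using i j gip_frame[of j i] gip_frame[of j j] by auto
    qed
    also have "\<dots> = u v" using t v by simp
    finally show "u v = 0" by simp
  qed
  have "card (e ` {..<CARD('n)}) = DIM(real^'n)" using inj by (simp add: card_image)
  then have sp: "x \<in> span (e ` {..<CARD('n)})" for x
    using card_eq_dim[of "e ` {..<CARD('n)}" UNIV] ind by auto
  have eq: "\<forall>i<CARD('n). gip A y (e i) = 0 \<Longrightarrow> y = 0" for y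
  proof -
    assume y: "\<forall>i<CARD('n). gip A y (e i) = 0"
    have "gip A y z = 0" if "z \<in> span (e ` {..<CARD('n)})" for z
      using that
    proof (induction rule: span_induct_alt)
      case base show ?case by (simp add: linear_0[OF linear_gip_right])
    next
      case (step c a b)
      then show ?case using y
        by (auto simp: linear_add[OF linear_gip_right] linear_scale[OF linear_gip_right])
    qed
    then have "gip A y y = 0" using sp by blast
    then show "y = 0" using pos_def by (auto simp: pos_def_def)
  qed
  have "x - (\<Sum>i<CARD('n). gip A x (e i) *\<^sub>R e i) = 0"
  proof (rule eq, intro allI impI)
    fix j assume j: "j < CARD('n)"
    have "(\<Sum>i<CARD('n). gip A x (e i) * gip A (e i) (e j)) = (\<Sum>i<CARD('n). if i = j then gip A x (e j) else 0)"
      by (rule sum.cong[OF refl]) (use gip_frame j in auto)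
    also have "\<dots> = gip A x (e j)" using j by simp
    finally show "gip A (x - (\<Sum>i<CARD('n). gip A x (e i) *\<^sub>R e i)) (e j) = 0"
      by (simp add: linear_diff[OF linear_gip_left] gip_sum_left)
  qed
  then show ?thesis by simp
qed

lemma linear_frame_expansion:
  assumes "linear f"
  shows "f x = (\<Sum>i<CARD('n). gip A x (e i) *\<^sub>R f (e i))"
  by (subst frame_expansion) (simp add: linear_sum[OF assms] linear_scale[OF assms])

text \<open>By \<open>ins1_metric_mult\<close> each frame vector contributes its inner product with
  an argument of the second group; linearity of \<open>F\<close> reassembles these components into
  that argument.\<close>

lemma sum_ins1_metric_mult:
  assumes "\<And>xs ys. linear (\<lambda>v. F v xs ys)"
  shows "(\<Sum>i<CARD('n). (ins1 (e i) (metric_form A) \<odot> F (e i)) xs ys) = dD2 F xs ys"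
proof -
  have "(\<Sum>i<CARD('n). (ins1 (e i) (metric_form A) \<odot> F (e i)) xs ys) =
    (\<Sum>j<length ys. (-1) ^ j * (\<Sum>i<CARD('n). gip A (ys ! j) (e i) *\<^sub>R
      F (e i) xs (take j ys @ drop (Suc j) ys)))"
    unfolding ins1_metric_mult dD2_apply dscale_def
    by (subst sum.swap) (simp add: sum_distrib_left mult_ac gip_commute[OF pos_def])
  then show ?thesis
    by (simp only: linear_frame_expansion[OF assms, symmetric] dD2_apply)
qed

text \<open>The Ricci contraction of double forms, adjoint to multiplication by the metric.\<close>

definition contract :: "(real^'n) dform \<Rightarrow> (real^'n) dform" where
  "contract \<omega> = (\<lambda>xs ys. \<Sum>i<CARD('n). \<omega> (e i # xs) (e i # ys))"

lemma contract_ins: "contract \<omega> = (\<lambda>xs ys. \<Sum>i<CARD('n). ins2 (e i) (ins1 (e i) \<omega>) xs ys)"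
  by (simp add: contract_def ins1_def ins2_def)

lemma is_dform_contract: "is_dform (Suc p) (Suc q) \<omega> \<Longrightarrow> is_dform p q (contract \<omega>)"
  unfolding contract_ins by (intro is_dform_sum is_dform_ins1 is_dform_ins2)

abbreviation gmult :: "(real^'n) dform \<Rightarrow> (real^'n) dform" where
  "gmult \<equiv> (\<odot>) (metric_form A)"

lemma sum_ins2_metric_mult:
  assumes "\<And>xs ys. linear (\<lambda>v. F v xs ys)"
  shows "(\<Sum>i<CARD('n). (ins2 (e i) (metric_form A) \<odot> F (e i)) xs ys) = dD F xs ys"
proof -
  have "(ins2 (e i) (metric_form A) \<odot> F (e i)) xs ys =
      (ins1 (e i) (metric_form A) \<odot> flip (F (e i))) ys xs" for i
  proof -
    have "flip (ins2 (e i) (metric_form A) \<odot> F (e i)) = ins1 (e i) (metric_form A) \<odot> flip (F (e i))"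
      by (simp add: flip_mult flip_metric_form[OF pos_def])
    then show ?thesis by (metis flip_def)
  qed
  then have "(\<Sum>i<CARD('n). (ins2 (e i) (metric_form A) \<odot> F (e i)) xs ys) = dD2 (\<lambda>v. flip (F v)) ys xs"
    using sum_ins1_metric_mult[of "\<lambda>v. flip (F v)" ys xs] assms by (simp add: flip_def)
  then show ?thesis by (simp add: dD2_def) (simp add: flip_def)
qed

text \<open>This commutator is why multiplication by powers of the metric is injective in low degrees.\<close>

lemma contract_gmult:
  assumes \<eta>: "is_dform p q \<eta>"
  shows "contract (gmult \<eta>) = gmult (contract \<eta>) + dscale (real CARD('n) - real p - real q) \<eta>"
proof (intro ext)
  fix xs ys
  let ?g = "metric_form A"
  have lin2: "linear (\<lambda>v. ins2 v \<eta> xs ys)" for xs ys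
    using lin1_ins1_linear[OF is_dformD(4)[OF \<eta>], of ys xs]
    by (simp add: ins1_def ins2_def flip_def)
  \<comment> \<open>The two contractions hit the metric both, one or not at all. After the trace the
    first case gives n, and the two mixed cases become \<open>dD2\<close> and \<open>dD\<close>,
    which count the degrees q and p.\<close>
  have 1: "ins2 a (ins1 a (gmult \<eta>)) = dscale (gip A a a) \<eta> - ins1 a ?g \<odot> ins2 a \<eta>
     - ins2 a ?g \<odot> ins1 a \<eta> + ?g \<odot> ins2 a (ins1 a \<eta>)" for a
    by (simp add: ins1_mult ins2_mult ins_metric_form mult_dscale)
  have "contract (gmult \<eta>) xs ys = (\<Sum>i<CARD('n). gip A (e i) (e i)) * \<eta> xs ys
     - dD2 (\<lambda>v. ins2 v \<eta>) xs ys - dD (\<lambda>v. ins1 v \<eta>) xs ys + gmult (contract \<eta>) xs ys"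
    unfolding contract_ins 1 mult_sum_right
    by (simp add: sum.distrib sum_subtractf sum_ins1_metric_mult[of "\<lambda>v. ins2 v \<eta>", OF lin2]
        sum_ins2_metric_mult[of "\<lambda>v. ins1 v \<eta>", OF lin1_ins1_linear[OF is_dformD(3)[OF \<eta>]]])
      (simp add: dscale_def sum_distrib_right)
  also have "(\<Sum>i<CARD('n). gip A (e i) (e i)) = real CARD('n)" by (simp add: gip_frame)
  also have "dD2 (\<lambda>v. ins2 v \<eta>) xs ys = real q * \<eta> xs ys"
    using is_dform_degree[OF \<eta>, of xs ys] by (auto simp: dD2_ins2[OF is_dformD(2)[OF \<eta>]])
  also have "dD (\<lambda>v. ins1 v \<eta>) xs ys = real p * \<eta> xs ys"
    using is_dform_degree[OF \<eta>, of xs ys] by (auto simp: dD_ins1[OF is_dformD(1)[OF \<eta>]])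
  finally show "contract (gmult \<eta>) xs ys =
      (gmult (contract \<eta>) + dscale (real CARD('n) - real p - real q) \<eta>) xs ys"
    by (simp add: dscale_def algebra_simps)
qed

lemma is_dform_gmult: "is_dform p q \<eta> \<Longrightarrow> is_dform (Suc p) (Suc q) (gmult \<eta>)"
  using is_dform_mult[OF is_dform_metric_form] by simp

lemma is_dform_gmult_pow: "is_dform p q \<eta> \<Longrightarrow> is_dform (p + m) (q + m) ((gmult ^^ m) \<eta>)"
  by (induction m) (auto simp: is_dform_gmult)

text \<open>Each factor of the metric raises both degrees by one, so the commutators add up to the
  sum of n - p - q - 2j over j = 0, ..., m, which is (m + 1)(n - p - q - m).\<close>

lemma contract_gmult_pow:
  assumes \<eta>: "is_dform p q \<eta>"
  shows "contract ((gmult ^^ Suc m) \<eta>) = (gmult ^^ Suc m) (contract \<eta>) +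
    dscale (real (Suc m) * (real CARD('n) - real p - real q - real m)) ((gmult ^^ m) \<eta>)"
proof (induction m)
  case 0
  then show ?case using contract_gmult[OF \<eta>] by simp
next
  case (Suc m)
  have "contract ((gmult ^^ Suc (Suc m)) \<eta>) = gmult (contract ((gmult ^^ Suc m) \<eta>)) +
      dscale (real CARD('n) - real (p + Suc m) - real (q + Suc m)) ((gmult ^^ Suc m) \<eta>)"
    using contract_gmult[OF is_dform_gmult_pow[OF \<eta>, of "Suc m"]] by simp
  also have "gmult (contract ((gmult ^^ Suc m) \<eta>)) = (gmult ^^ Suc (Suc m)) (contract \<eta>) +
      dscale (real (Suc m) * (real CARD('n) - real p - real q - real m)) ((gmult ^^ Suc m) \<eta>)"
    unfolding Suc by (simp add: mult_add_right mult_dscale)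
  finally show ?case
    by (simp add: dscale_def fun_eq_iff algebra_simps)
qed

lemma gmult_pow_zero: "(gmult ^^ m) 0 = 0"
  by (induction m) auto

lemma contract_zero: "contract 0 = 0"
  by (auto simp: contract_def fun_eq_iff)

text \<open>Contracting the hypothesis relates a power of the metric times
  \<open>contract \<eta>\<close> to a lower power times \<eta>. The outer induction on p kills the
  contraction; since the coefficient is nonzero, the inner induction on m then lowers the
  power.\<close>

lemma gmult_pow_inj:
  assumes "is_dform p q \<eta>" "p + q + m \<le> CARD('n)" "(gmult ^^ m) \<eta> = 0"
  shows "\<eta> = 0"
  using assms
proof (induction p arbitrary: q \<eta> m rule: less_induct)
  case (less p)
  show ?case using less.prems
  proof (induction m)
    case 0
    then show ?case by simp
  next
    case (Suc m)
    let ?c = "real (Suc m) * (real CARD('n) - real p - real q - real m)"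
    \<comment> \<open>The bound on p + q + Suc m makes n - p - q - m at least 1.\<close>
    have c: "?c \<noteq> 0" using Suc.prems(2) by auto
    have eq: "(gmult ^^ Suc m) (contract \<eta>) + dscale ?c ((gmult ^^ m) \<eta>) = 0"
      using contract_gmult_pow[OF Suc.prems(1), of m] Suc.prems(3) contract_zero by metis
    have con: "contract \<eta> = 0"
    proof (cases "p = 0 \<or> q = 0")
      case True
      then show ?thesis using is_dform_degree[OF Suc.prems(1)]
        by (auto simp: contract_def fun_eq_iff)
    next
      case False
      then obtain p' q' where pq: "p = Suc p'" "q = Suc q'" by (metis not0_implies_Suc)
      \<comment> \<open>One more factor of the metric makes the \<eta>-term vanish by hypothesis.
        The exponent grows by one over the hypothesis while the degrees drop by two in total, so the
        outer induction hypothesis applies to the contraction.\<close>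
      have "gmult ((gmult ^^ Suc m) (contract \<eta>) + dscale ?c ((gmult ^^ m) \<eta>)) = 0"
        unfolding eq by simp
      then have "(gmult ^^ Suc (Suc m)) (contract \<eta>) + dscale ?c ((gmult ^^ Suc m) \<eta>) = 0"
        by (simp add: mult_add_right mult_dscale)
      then have "(gmult ^^ Suc (Suc m)) (contract \<eta>) = 0"
        unfolding Suc.prems(3) by (simp add: dscale_def fun_eq_iff)
      then show ?thesis
        using less.IH[of p' q' "contract \<eta>" "Suc (Suc m)"] is_dform_contract[of p' q' \<eta>]
          Suc.prems(1,2) unfolding pq by linarith
    qed
    have "dscale ?c ((gmult ^^ m) \<eta>) = 0"
      using eq unfolding con gmult_pow_zero by simp
    then have "(gmult ^^ m) \<eta> = 0" using c by (simp add: dscale_def fun_eq_iff)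
    then show ?case using Suc.IH[OF Suc.prems(1)] Suc.prems(2) by simp
  qed
qed

lemma dpow_metric_mult: "dpow (metric_form A) m \<odot> \<eta> = (gmult ^^ m) \<eta>"
  by (induction m) (simp_all add: mult_assoc mult_one_left[unfolded dform_one_def])

text \<open>The negative of \<delta> when \<open>F\<close> is the covariant derivative of a field
  and \<open>e\<close> is \<open>onb\<close>.\<close>

definition div_sum :: "(real^'n \<Rightarrow> (real^'n) dform) \<Rightarrow> (real^'n) dform" where
  "div_sum F = (\<lambda>xs ys. \<Sum>i<CARD('n). ins1 (e i) (F (e i)) xs ys)"

text \<open>The divergence contraction either hits a factor of the metric, which after summation
  gives \<open>dD2\<close> of the remaining family, or passes it with a minus sign. Vanishing of
  \<open>dD2\<close> survives multiplication by the metric, so only the sign accumulates.\<close>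

lemma div_sum_gmult_pow:
  assumes lin: "\<And>xs ys. linear (\<lambda>v. F v xs ys)" and D2: "dD2 F = 0"
  shows "div_sum (\<lambda>v. (gmult ^^ m) (F v)) = dscale ((-1) ^ m) ((gmult ^^ m) (div_sum F))"
proof -
  have lin': "linear (\<lambda>v. (gmult ^^ m) (F v) xs ys)" for m xs ys
    by (induction m arbitrary: xs ys) (simp_all add: lin linear_mult_right_dform)
  have D2': "dD2 (\<lambda>v. (gmult ^^ m) (F v)) = 0" for m
    by (induction m) (simp_all add: D2 dD2_mult_right)
  show ?thesis
  proof (induction m)
    case 0
    then show ?case by (simp add: dscale_def)
  next
    case (Suc m)
    have "div_sum (\<lambda>v. (gmult ^^ Suc m) (F v)) = - gmult (div_sum (\<lambda>v. (gmult ^^ m) (F v)))"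
    proof (intro ext)
      fix xs ys
      have "div_sum (\<lambda>v. (gmult ^^ Suc m) (F v)) xs ys =
          (\<Sum>i<CARD('n). (ins1 (e i) (metric_form A) \<odot> (gmult ^^ m) (F (e i))) xs ys)
        - gmult (div_sum (\<lambda>v. (gmult ^^ m) (F v))) xs ys"
        unfolding div_sum_def mult_sum_right
        by (simp add: ins1_mult sum_subtractf ins_metric_form)
      then show "div_sum (\<lambda>v. (gmult ^^ Suc m) (F v)) xs ys =
          (- gmult (div_sum (\<lambda>v. (gmult ^^ m) (F v)))) xs ys"
        using sum_ins1_metric_mult[of "\<lambda>v. (gmult ^^ m) (F v)", OF lin'] D2'[of m] by simp
    qed
    then show ?case unfolding Suc by (simp add: mult_dscale) (simp add: dscale_def fun_eq_iff)
  qed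
qed

end

section \<open>Forms in index notation\<close>

lemma alternating_ins: "alternating \<alpha> \<Longrightarrow> alternating (\<lambda>as. \<alpha> (x # as))"
  unfolding alternating_def by (metis append_Cons)

text \<open>One sign, depending only on the two lists, serves all alternating forms at once. Hence a
  product of two alternating forms is unchanged under reordering, because
  \<open>s * s = 1\<close>.\<close>

lemma alternating_perm:
  "mset ks = mset ls \<Longrightarrow> \<exists>s::real. s * s = 1 \<and> (\<forall>\<alpha>. alternating \<alpha> \<longrightarrow> \<alpha> ls = s * \<alpha> ks)"
proof (induction ks arbitrary: ls)
  case Nil
  then show ?case by (auto intro!: exI[of _ 1])
next
  case (Cons x ks)
  then have "x \<in> set ls" by (metis list.set_intros(1) set_mset_mset)
  then obtain us vs where ls: "ls = us @ x # vs" by (auto simp: in_set_conv_decomp)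
  have "mset ks = mset (us @ vs)" using Cons.prems ls by auto
  from Cons.IH[OF this] obtain s :: real where s: "s * s = 1"
    "\<And>\<alpha>. alternating \<alpha> \<Longrightarrow> \<alpha> (us @ vs) = s * \<alpha> ks" by auto
  have "\<alpha> ls = ((-1) ^ length us * s) * \<alpha> (x # ks)" if "alternating \<alpha>" for \<alpha> :: "'a list \<Rightarrow> real"
    using alternating_front[OF that, of us x vs] s(2)[OF alternating_ins[OF that, of x]] ls by simp
  moreover have "((-1) ^ length us * s) * ((-1) ^ length us * s) = 1"
    using s(1) by (simp add: mult_ac)
  ultimately show ?case by blast
qed

lemma alternating_not_distinct:
  assumes "alternating \<alpha>" "\<not> distinct ks"
  shows "\<alpha> ks = 0"
proof -
  obtain xs y ys zs where ks: "ks = xs @ [y] @ ys @ [y] @ zs"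
    using not_distinct_decomp[OF assms(2)] by auto
  have "mset (y # y # xs @ ys @ zs) = mset ks" using ks by simp
  from alternating_perm[OF this] obtain s where "\<alpha> ks = s * \<alpha> (y # y # xs @ ys @ zs)"
    using assms(1) by blast
  moreover have "\<alpha> (y # y # xs @ ys @ zs) = 0"
    using alternating_swap[OF assms(1), of "[]" y y "xs @ ys @ zs"] by simp
  ultimately show ?thesis by simp
qed

lemma wedge_zero [simp]: "wedge (\<lambda>as. 0) \<beta> xs = 0"
  by (simp add: wedge_def)

lemma form_one_wedge [simp]: "wedge form_one \<beta> xs = \<beta> xs"
proof (induction xs arbitrary: \<beta>)
  case Nil
  then show ?case by (simp add: form_one_def)
next
  case (Cons x xs)
  have "sgn_form form_one = (form_one :: 'a form)" "(\<lambda>as. form_one (x # as)) = (\<lambda>as. 0)"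
    by (auto simp: sgn_form_def form_one_def)
  then show ?case using Cons by (simp add: wedge_Cons)
qed

lemma wedge_map: "wedge \<alpha> \<beta> (map f xs) = wedge (\<lambda>as. \<alpha> (map f as)) (\<lambda>as. \<beta> (map f as)) xs"
  by (simp add: wedge_def nths_map)

lemma wedge_cong:
  assumes "\<And>zs. set zs \<subseteq> set xs \<Longrightarrow> \<alpha> zs = \<alpha>' zs" "\<And>zs. set zs \<subseteq> set xs \<Longrightarrow> \<beta> zs = \<beta>' zs"
  shows "wedge \<alpha> \<beta> xs = wedge \<alpha>' \<beta>' xs"
  using assms by (simp add: wedge_def set_nths_subset cong: sum.cong)

text \<open>Tensoring with \<open>form_one\<close> makes single forms into double forms of second
  degree 0, so the fact for double forms applies.\<close>

lemma alternating_wedge: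
  assumes "alternating \<alpha>" "alternating \<beta>"
  shows "alternating (wedge \<alpha> \<beta>)"
proof -
  have tens: "alt1 (form_tensor \<gamma> form_one)" if "alternating \<gamma>" for \<gamma> :: "'a form"
    by (rule alt1I, unfold form_tensor_def, subst alternating_swap[OF that]) simp
  have "alt1 (form_tensor (wedge \<alpha> \<beta>) (wedge form_one form_one))"
    unfolding dform_mult_form_tensor[symmetric] by (intro alt1_mult tens assms)
  then have "alternating (\<lambda>xs. form_tensor (wedge \<alpha> \<beta>) (wedge form_one form_one) xs [])"
    by (simp add: alt1_def)
  then show ?thesis by (simp add: form_tensor_def form_one_def)
qed

lemma multilinear_wedge:
  assumes "multilinear \<alpha>" "multilinear \<beta>"
  shows "multilinear (wedge \<alpha> \<beta>)"
proof -
  have tens: "lin1 (form_tensor \<gamma> form_one)" if "multilinear \<gamma>" for \<gamma> :: "'a form"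
    using that unfolding lin1_def multilinear_def form_tensor_def
    by (auto intro: linear_mult_right_const)
  have "lin1 (form_tensor (wedge \<alpha> \<beta>) (wedge form_one form_one))"
    unfolding dform_mult_form_tensor[symmetric] by (intro lin1_mult tens assms)
  then have "multilinear (\<lambda>xs. form_tensor (wedge \<alpha> \<beta>) (wedge form_one form_one) xs [])"
    by (simp add: lin1_def)
  then show ?thesis by (simp add: form_tensor_def form_one_def)
qed

text \<open>Forms on \<open>nat\<close> express the components of forms in a frame.\<close>

definition index_form :: "nat list \<Rightarrow> nat form" where
  "index_form L = foldr wedge (map (\<lambda>i ks. if ks = [i] then 1 else 0) L) form_one"

lemma index_form_simps:
  "index_form [] = form_one"
  "index_form (i # L) = wedge (\<lambda>ks. if ks = [i] then 1 else 0) (index_form L)"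
  by (simp_all add: index_form_def)

lemma wedge_index_Cons:
  fixes i k :: nat
  shows "wedge (\<lambda>ks. if ks = [i] then 1 else 0) \<beta> (k # ks) =
   (if k = i then \<beta> ks else 0) - wedge (\<lambda>ks. if ks = [i] then 1 else 0) (\<lambda>as. \<beta> (k # as)) ks"
proof -
  have 1: "(\<lambda>as. if k # as = [i] then 1 else 0) = (if k = i then form_one else (\<lambda>as. 0))"
    by (auto simp: form_one_def)
  have 2: "sgn_form (\<lambda>ks. if ks = [i] then 1 else 0) = (\<lambda>ks. - (if ks = [i] then 1 else 0))"
    by (auto simp: sgn_form_def)

  have 4: "wedge (\<lambda>ks. - \<alpha> ks) \<gamma> ks = - wedge \<alpha> \<gamma> ks" for \<alpha> \<gamma> :: "nat form"
    by (simp add: wedge_def sum_negf)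
  show ?thesis by (simp only: wedge_Cons 1 2 4) simp
qed

lemma wedge_index_append:
  fixes i :: nat
  shows "i \<notin> set ms \<Longrightarrow> wedge (\<lambda>ks. if ks = [i] then 1 else 0) \<beta> (ms @ ks) =
   (-1) ^ length ms * wedge (\<lambda>ks. if ks = [i] then 1 else 0) (\<lambda>as. \<beta> (ms @ as)) ks"
  by (induction ms arbitrary: \<beta>) (auto simp: wedge_index_Cons)

lemma index_form_notin: "k \<notin> set L \<Longrightarrow> index_form L (k # ks) = 0"
proof (induction L arbitrary: ks)
  case Nil
  then show ?case by (simp add: index_form_simps form_one_def)
next
  case (Cons i L)
  then have "(\<lambda>as. index_form L (k # as)) = (\<lambda>as. 0)" by simp
  then show ?case using Cons.prems by (simp add: index_form_simps wedge_index_Cons) (simp add: wedge_def)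
qed

text \<open>An element of S at the front of L is consumed by the first covector; an element outside
  S makes that covector pass all the selected entries. These are exactly the two recursions of
  \<open>shuffle_sign\<close>.\<close>

lemma index_form_nths:
  assumes "S \<subseteq> {..<length L}" "distinct L"
  shows "index_form L (nths L S @ ks) = shuffle_sign (length L) S * index_form (nths L (- S)) ks"
  using assms
proof (induction L arbitrary: S ks)
  case Nil
  then show ?case by (simp add: shuffle_sign_def)
next
  case (Cons i L)
  define S' where "S' = {j. Suc j \<in> S}"
  have S': "S' \<subseteq> {..<length L}" using Cons.prems by (auto simp: S'_def)
  have i: "i \<notin> set L" using Cons.prems by simp
  have "S = (if 0 \<in> S then insert 0 (Suc ` S') else Suc ` S')"
    by (auto simp: S'_def image_iff) (metis not0_implies_Suc)+
  then consider "S = insert 0 (Suc ` S')" | "S = Suc ` S'" by metis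
  then show ?case
  proof cases
    case 1
    have "(\<lambda>as. index_form L (i # as)) = (\<lambda>as. 0)" using index_form_notin[OF i] by simp
    then have "index_form (i # L) (i # nths L S' @ ks) = index_form L (nths L S' @ ks)"
      by (simp add: index_form_simps wedge_index_Cons) (simp add: wedge_def)
    then show ?thesis
      unfolding 1 using Cons.IH[OF S'] Cons.prems(2) S'
      by (simp add: shuffle_sign_insert_0)
  next
    case 2
    have i': "i \<notin> set (nths L S')" using i by (meson in_set_nthsD)
    have "index_form (i # L) (nths L S' @ ks) =
       (-1) ^ card S' * wedge (\<lambda>ks. if ks = [i] then 1 else 0) (\<lambda>as. index_form L (nths L S' @ as)) ks"
      unfolding index_form_simps wedge_index_append[OF i'] length_nths_subset[OF S'] by simp
    also have "(\<lambda>as. index_form L (nths L S' @ as)) =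
        (\<lambda>as. shuffle_sign (length L) S' * index_form (nths L (- S')) as)"
      using Cons.IH[OF S'] Cons.prems(2) by simp
    also have "wedge (\<lambda>ks. if ks = [i] then 1 else 0) \<dots> ks =
        shuffle_sign (length L) S' * index_form (i # nths L (- S')) ks"
      by (simp add: index_form_simps wedge_def sum_distrib_left mult_ac)
    finally show ?thesis unfolding 2 using S' by (simp add: shuffle_sign_image_Suc)
  qed
qed

text \<open>The Levi-Civita symbol: the components of the volume form in its own frame.\<close>

definition vol_index :: "nat \<Rightarrow> nat form" where "vol_index n = index_form [0..<n]"

lemma sorted_list_of_set_nths:
  assumes "I \<subseteq> {..<n}"
  shows "sorted_list_of_set I = nths [0..<n] I"
    "sorted_list_of_set ({..<n} - I) = nths [0..<n] (- I)"
proof -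
  have s: "set (nths [0..<n] S) = {..<n} \<inter> S" for S
    by (auto simp: set_nths intro!: exI)
  show "sorted_list_of_set I = nths [0..<n] I"
    by (rule sorted_distinct_set_unique) (use assms finite_subset[OF assms] s in \<open>auto simp: sorted_nths\<close>)
  show "sorted_list_of_set ({..<n} - I) = nths [0..<n] (- I)"
    by (rule sorted_distinct_set_unique) (use s in \<open>auto simp: sorted_nths\<close>)
qed

text \<open>This identifies the star of a basis form with the volume form contracted by the
  corresponding frame vectors, and so removes \<open>shuffle_sign\<close> from the rest of the
  proof.\<close>

lemma vol_index_append:
  assumes "I \<subseteq> {..<n}"
  shows "vol_index n (sorted_list_of_set I @ ks) =
    shuffle_sign n I * index_form (sorted_list_of_set ({..<n} - I)) ks"
  unfolding vol_index_def sorted_list_of_set_nths[OF assms]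
  using assms index_form_nths[of I "[0..<n]" ks] by simp

lemma vol_index_self: "vol_index n [0..<n] = 1"
  using vol_index_append[of "{..<n}" n "[]"]
  by (simp add: atLeast0LessThan[symmetric] shuffle_sign_def index_form_simps form_one_def)

lemma alternating_index_form: "alternating (index_form L)"
proof (induction L)
  case Nil
  then show ?case by (auto simp: index_form_simps alternating_def form_one_def)
next
  case (Cons i L)
  have "alternating (\<lambda>ks. if ks = [i] then 1 else (0::real))"
    by (auto simp: alternating_def append_eq_Cons_conv)
  then show ?case unfolding index_form_simps using Cons by (intro alternating_wedge)
qed

lemma alternating_vol_index: "alternating (vol_index n)"
  by (simp add: vol_index_def alternating_index_form)

section \<open>Sums over all multi-indices\<close>

definition lists_of :: "nat \<Rightarrow> nat \<Rightarrow> nat list set" where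
  "lists_of n r = {ks. set ks \<subseteq> {..<n} \<and> length ks = r}"

lemma finite_lists_of [simp]: "finite (lists_of n r)"
  by (simp add: lists_of_def finite_lists_length_eq)

lemma lists_of_0 [simp]: "lists_of n 0 = {[]}"
  by (auto simp: lists_of_def)

text \<open>Deleting the entry at position j is a bijection onto pairs of an index and a shorter
  list, whatever j is; the divergence computation uses it at every position.\<close>

lemma sum_lists_of_insert:
  assumes "j \<le> r"
  shows "(\<Sum>ks\<in>lists_of n (Suc r). H (ks ! j) (take j ks @ drop (Suc j) ks)) =
    (\<Sum>i<n. \<Sum>is\<in>lists_of n r. H i is)"
proof -
  define ins where "ins p = take j (snd p) @ fst p # drop j (snd p)" for p :: "nat \<times> nat list"
  define del where "del ks = (ks ! j, take j ks @ drop (Suc j) ks)" for ks :: "nat list"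
  have "(\<Sum>i<n. \<Sum>is\<in>lists_of n r. H i is) = (\<Sum>p\<in>{..<n} \<times> lists_of n r. case_prod H p)"
    by (simp add: sum.cartesian_product)
  also have "\<dots> = (\<Sum>ks\<in>lists_of n (Suc r). case_prod H (del ks))"
  proof (rule sum.reindex_bij_witness[where j = ins and i = del])
    fix p assume p: "p \<in> {..<n} \<times> lists_of n r"
    then show 1: "del (ins p) = p"
      using assms by (auto simp: ins_def del_def nth_append lists_of_def)
    show "ins p \<in> lists_of n (Suc r)"
      using p assms by (auto simp: ins_def lists_of_def subset_iff dest: in_set_takeD in_set_dropD)
    show "case_prod H (del (ins p)) = case_prod H p" by (simp add: 1)
  next
    fix ks assume ks: "ks \<in> lists_of n (Suc r)"
    then show "ins (del ks) = ks"
      using assms by (simp add: ins_def del_def lists_of_def min.absorb2 id_take_nth_drop[symmetric])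
    show "del ks \<in> {..<n} \<times> lists_of n r"
      using ks assms by (auto simp: del_def lists_of_def subset_iff dest: in_set_takeD in_set_dropD)
  qed
  finally show ?thesis by (simp add: del_def)
qed

lemma sum_lists_of_Suc:
  "(\<Sum>ks\<in>lists_of n (Suc r). f ks) = (\<Sum>i<n. \<Sum>is\<in>lists_of n r. f (i # is))"
proof -
  have "(\<Sum>ks\<in>lists_of n (Suc r). f ks) =
    (\<Sum>ks\<in>lists_of n (Suc r). f (ks ! 0 # (take 0 ks @ drop (Suc 0) ks)))"
    by (rule sum.cong) (auto simp: lists_of_def length_Suc_conv)
  then show ?thesis using sum_lists_of_insert[of 0 r "\<lambda>i is. f (i # is)" n] by simp
qed

text \<open>Lists with a repeated entry contribute 0. The r! orderings of a set contribute equally,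
  since \<alpha> and \<beta> change by the same sign.\<close>

lemma sum_lists_of_alternating:
  assumes "alternating \<alpha>" "alternating \<beta>"
  shows "(\<Sum>is\<in>lists_of n r. \<alpha> is * \<beta> is) =
    fact r * (\<Sum>I | I \<subseteq> {..<n} \<and> card I = r. \<alpha> (sorted_list_of_set I) * \<beta> (sorted_list_of_set I))"
proof -
  let ?S = "{is \<in> lists_of n r. distinct is}" and ?T = "{I. I \<subseteq> {..<n} \<and> card I = r}"
  let ?f = "\<lambda>is. \<alpha> is * \<beta> is"
  have "(\<Sum>is\<in>lists_of n r. ?f is) = (\<Sum>is\<in>?S. ?f is)"
    by (rule sum.mono_neutral_right) (auto simp: alternating_not_distinct assms)
  also have "\<dots> = (\<Sum>I\<in>?T. \<Sum>is\<in>{is\<in>?S. set is = I}. ?f is)"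
    by (rule sum.group[symmetric]) (auto simp: distinct_card, auto simp: lists_of_def distinct_card)
  also have "\<dots> = (\<Sum>I\<in>?T. fact r * ?f (sorted_list_of_set I))"
  proof (rule sum.cong[OF refl])
    fix I assume I: "I \<in> ?T"
    then have fI: "finite I" using finite_subset by blast
    have eq: "{is\<in>?S. set is = I} = permutations_of_set I"
      using I by (auto simp: permutations_of_set_def lists_of_def distinct_card)
    have "?f is = ?f (sorted_list_of_set I)" if "is \<in> permutations_of_set I" for "is"
    proof -
      have "mset (sorted_list_of_set I) = mset is"
        using that fI set_eq_iff_mset_eq_distinct[of "sorted_list_of_set I" "is"]
        by (auto simp: permutations_of_set_def)
      from alternating_perm[OF this] obtain s where "s * s = 1" "\<alpha> is = s * \<alpha> (sorted_list_of_set I)"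
        "\<beta> is = s * \<beta> (sorted_list_of_set I)" using assms by blast
      then show ?thesis by (simp add: mult_ac)
    qed
    then have "(\<Sum>is\<in>permutations_of_set I. ?f is) =
        (\<Sum>is\<in>permutations_of_set I. ?f (sorted_list_of_set I))" by (rule sum.cong[OF refl])
    then show "(\<Sum>is\<in>{is\<in>?S. set is = I}. ?f is) = fact r * ?f (sorted_list_of_set I)"
      unfolding eq using I fI by simp
  qed
  finally show ?thesis by (simp add: sum_distrib_left)
qed

section \<open>The double Hodge star in an arbitrary frame\<close>

lemma linear_eqI_frame:
  assumes "euclidean A e" "linear f" "linear h" "\<And>i. i < CARD('n) \<Longrightarrow> f (e i) = h (e i)"
  shows "f x = h (x :: real^'n)"
  unfolding euclidean.linear_frame_expansion[OF assms(1,2), of x]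
    euclidean.linear_frame_expansion[OF assms(1,3), of x]
  by (rule sum.cong) (simp_all add: assms(4))

lemma multilinear_eqI_frame:
  fixes \<alpha> \<beta> :: "(real^'n) form"
  assumes E: "euclidean A e" and ml: "multilinear \<alpha>" "multilinear \<beta>"
    and eq: "\<And>ks. ks \<in> lists_of CARD('n) m \<Longrightarrow> \<alpha> (map e ks) = \<beta> (map e ks)"
    and len: "length xs = m"
  shows "\<alpha> xs = \<beta> xs"
proof -
  have "\<alpha> (map e ks @ xs) = \<beta> (map e ks @ xs)"
    if "set ks \<subseteq> {..<CARD('n)}" "length ks + length xs = m" for ks xs
    using that
  proof (induction xs arbitrary: ks)
    case Nil
    then show ?case using eq[of ks] by (simp add: lists_of_def)
  next
    case (Cons x xs)
    show ?case
    proof (rule linear_eqI_frame[OF E multilinear_linear[OF ml(1)] multilinear_linear[OF ml(2)]])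
      fix i assume "i < CARD('n)"
      then show "\<alpha> (map e ks @ e i # xs) = \<beta> (map e ks @ e i # xs)"
        using Cons.IH[of "ks @ [i]"] Cons.prems by simp
    qed
  qed
  from this[of "[]" xs] show ?thesis using len by simp
qed

text \<open>Expanding the first argument in \<open>f\<close> and then collecting the second from its
  components in \<open>e\<close> shows that the trace of a bilinear form does not depend on the
  frame.\<close>

lemma sum_frame_change:
  fixes b :: "real^'n \<Rightarrow> real^'n \<Rightarrow> real"
  assumes E: "euclidean A e" and F: "euclidean A f"
    and l1: "\<And>y. linear (\<lambda>x. b x y)" and l2: "\<And>x. linear (b x)"
  shows "(\<Sum>i<CARD('n). b (e i) (e i)) = (\<Sum>i<CARD('n). b (f i) (f i))"
proof -
  have c: "gip A v w = gip A w v" for v w using euclidean.pos_def[OF E] by (rule gip_commute)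
  have "(\<Sum>i<CARD('n). b (e i) (e i)) = (\<Sum>i<CARD('n). \<Sum>j<CARD('n). gip A (e i) (f j) *\<^sub>R b (f j) (e i))"
    by (intro sum.cong refl) (rule euclidean.linear_frame_expansion[OF F l1])
  also have "\<dots> = (\<Sum>j<CARD('n). \<Sum>i<CARD('n). gip A (f j) (e i) *\<^sub>R b (f j) (e i))"
    by (subst sum.swap) (simp add: c)
  also have "\<dots> = (\<Sum>j<CARD('n). b (f j) (f j))"
    by (intro sum.cong refl) (rule euclidean.linear_frame_expansion[OF E l2, symmetric])
  finally show ?thesis .
qed

lemma multilinear_ins: "multilinear \<alpha> \<Longrightarrow> multilinear (\<lambda>xs. \<alpha> (us @ xs))"
  unfolding multilinear_def append_assoc[symmetric] by blast

lemma multilinear_ins_Cons: "multilinear \<alpha> \<Longrightarrow> multilinear (\<lambda>xs. \<alpha> (x # xs))"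
  using multilinear_ins[of \<alpha> "[x]"] by simp

lemma multilinear_append: "multilinear \<alpha> \<Longrightarrow> multilinear (\<lambda>xs. \<alpha> (xs @ us))"
  unfolding multilinear_def by simp

lemma multilinear_cmult: "multilinear \<alpha> \<Longrightarrow> multilinear (\<lambda>xs. c * \<alpha> xs)"
  unfolding multilinear_def by (auto intro: linear_mult_left_const)

lemma multilinear_cmult_right: "multilinear \<alpha> \<Longrightarrow> multilinear (\<lambda>xs. \<alpha> xs * c)"
  unfolding multilinear_def by (auto intro: linear_mult_right_const)

lemma multilinear_sum: "(\<And>i. i \<in> I \<Longrightarrow> multilinear (\<alpha> i)) \<Longrightarrow> multilinear (\<lambda>xs. \<Sum>i\<in>I. \<alpha> i xs)"
  unfolding multilinear_def by (auto intro: linear_compose_sum)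

text \<open>An iterated trace, so the frame can be exchanged in one slot at a time.\<close>

lemma sum_lists_frame_change:
  fixes B :: "(real^'n) list \<Rightarrow> (real^'n) list \<Rightarrow> real"
  assumes E: "euclidean A e" and F: "euclidean A f"
    and "\<And>ys. multilinear (\<lambda>xs. B xs ys)" and "\<And>xs. multilinear (B xs)"
  shows "(\<Sum>is\<in>lists_of CARD('n) r. B (map e is) (map e is)) =
    (\<Sum>is\<in>lists_of CARD('n) r. B (map f is) (map f is))"
  using assms(3,4)
proof (induction r arbitrary: B)
  case 0
  then show ?case by simp
next
  case (Suc r)
  have "(\<Sum>is\<in>lists_of CARD('n) (Suc r). B (map e is) (map e is)) =
      (\<Sum>i<CARD('n). \<Sum>is\<in>lists_of CARD('n) r. B (e i # map e is) (e i # map e is))"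
    by (simp add: sum_lists_of_Suc)
  also have "\<dots> = (\<Sum>i<CARD('n). \<Sum>is\<in>lists_of CARD('n) r. B (e i # map f is) (e i # map f is))"
  proof (rule sum.cong[OF refl])
    fix i
    show "(\<Sum>is\<in>lists_of CARD('n) r. B (e i # map e is) (e i # map e is)) =
        (\<Sum>is\<in>lists_of CARD('n) r. B (e i # map f is) (e i # map f is))"
      by (rule Suc.IH[of "\<lambda>xs ys. B (e i # xs) (e i # ys)"]) (intro multilinear_ins_Cons Suc.prems)+
  qed
  also have "\<dots> = (\<Sum>is\<in>lists_of CARD('n) r. \<Sum>i<CARD('n). B (e i # map f is) (e i # map f is))"
    by (rule sum.swap)
  also have "\<dots> = (\<Sum>is\<in>lists_of CARD('n) r. \<Sum>i<CARD('n). B (f i # map f is) (f i # map f is))"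
  proof (rule sum.cong[OF refl])
    fix "is"
    show "(\<Sum>i<CARD('n). B (e i # map f is) (e i # map f is)) =
        (\<Sum>i<CARD('n). B (f i # map f is) (f i # map f is))"
      by (rule sum_frame_change[OF E F, of "\<lambda>x y. B (x # map f is) (y # map f is)"])
        (use multilinear_linear[OF Suc.prems(1), of "[]"] multilinear_linear[OF Suc.prems(2), of _ "[]"] in simp_all)
  qed
  also have "\<dots> = (\<Sum>is\<in>lists_of CARD('n) (Suc r). B (map f is) (map f is))"
    unfolding sum_lists_of_Suc by (subst sum.swap) simp
  finally show ?case .
qed

section \<open>Wedges of frame covectors and the volume form in two frames\<close>

definition frame_form :: "real^'n^'n \<Rightarrow> (nat \<Rightarrow> real^'n) \<Rightarrow> nat list \<Rightarrow> (real^'n) form" where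
  "frame_form A e L = foldr wedge (map (\<lambda>i. covector A (e i)) L) form_one"

lemma alternating_map: "alternating \<alpha> \<Longrightarrow> alternating (\<lambda>ks. \<alpha> (map f ks))"
  unfolding alternating_def map_append list.map by blast

lemma alternating_append: "alternating \<alpha> \<Longrightarrow> alternating (\<lambda>ks. \<alpha> (ks @ us))"
  unfolding alternating_def append_assoc append_Cons by blast

lemma alternating_frame_form: "alternating (frame_form A e L)"
proof (induction L)
  case Nil
  then show ?case by (auto simp: frame_form_def alternating_def form_one_def)
next
  case (Cons i L)
  have "alternating (covector A v)" for v
    unfolding alternating_def
  proof (intro allI)
    fix us x y vs
    show "covector A v (us @ x # y # vs) = - covector A v (us @ y # x # vs)"
      by (cases us) (auto simp: covector_def split: list.split)
  qed
  then show ?case using Cons by (simp add: frame_form_def alternating_wedge)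
qed

lemma multilinear_frame_form: "multilinear (frame_form A e L)"
proof (induction L)
  case Nil
  then show ?case by (auto simp: frame_form_def multilinear_def form_one_def)
next
  case (Cons i L)
  have "multilinear (covector A v)" for v
    unfolding multilinear_def
  proof (intro allI)
    fix us vs
    show "linear (\<lambda>x. covector A v (us @ x # vs))"
    proof (cases "us = [] \<and> vs = []")
      case True
      then show ?thesis by (simp add: covector_def linear_gip_right)
    next
      case False
      then have "covector A v (us @ x # vs) = 0" for x
        by (cases us; cases vs; auto simp: covector_def split: list.split)
      then show ?thesis by simp
    qed
  qed
  then show ?case using Cons by (simp add: frame_form_def multilinear_wedge)
qed

lemma frame_form_map:
  fixes A :: "real^'n^'n"
  assumes E: "euclidean A e" and "set L \<subseteq> {..<CARD('n)}" "set ks \<subseteq> {..<CARD('n)}"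
  shows "frame_form A e L (map e ks) = index_form L ks"
  using assms(2,3)
proof (induction L arbitrary: ks)
  case Nil
  then show ?case by (simp add: frame_form_def index_form_simps form_one_def)
next
  case (Cons i L)
  have "frame_form A e (i # L) (map e ks) =
      wedge (\<lambda>as. covector A (e i) (map e as)) (\<lambda>as. frame_form A e L (map e as)) ks"
    by (simp add: frame_form_def wedge_map)
  also have "\<dots> = index_form (i # L) ks"
    unfolding index_form_simps
  proof (rule wedge_cong)
    fix zs assume zs: "set zs \<subseteq> set ks"
    then show "frame_form A e L (map e zs) = index_form L zs" using Cons by auto
    show "covector A (e i) (map e zs) = (if zs = [i] then 1 else 0)"
    proof (cases "length zs = 1")
      case True
      then obtain z where "zs = [z]" by (auto simp: length_Suc_conv)
      then show ?thesis using zs Cons.prems euclidean.gip_frame[OF E, of i z]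
        by (auto simp: covector_def subset_iff)
    next
      case False
      then show ?thesis by (auto simp: covector_def split: list.split)
    qed
  qed
  finally show ?case .
qed

lemma frame_form_vol:
  fixes A :: "real^'n^'n"
  assumes "euclidean A e" "set ks \<subseteq> {..<CARD('n)}"
  shows "frame_form A e [0..<CARD('n)] (map e ks) = vol_index CARD('n) ks"
  using frame_form_map[OF assms(1) _ assms(2), of "[0..<CARD('n)]"]
  by (simp add: vol_index_def atLeast0LessThan)

text \<open>The factor l is the determinant of the change of frame. That its square is 1 comes from
  invariance of the norm of the volume form rather than from matrix algebra.\<close>

lemma frame_form_vol_other:
  fixes A :: "real^'n^'n"
  assumes E: "euclidean A e" and F: "euclidean A f"
  shows "\<exists>l::real. l * l = 1 \<and> (\<forall>ks\<in>lists_of CARD('n) CARD('n).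
    frame_form A e [0..<CARD('n)] (map f ks) = l * vol_index CARD('n) ks)"
proof -
  let ?n = "CARD('n)" let ?\<mu> = "frame_form A e [0..<?n]"
  have alt: "alternating (\<lambda>ks. ?\<mu> (map f ks))"
    by (intro alternating_map alternating_frame_form)
  define l where "l = ?\<mu> (map f [0..<?n])"
  have l: "?\<mu> (map f ks) = l * vol_index ?n ks" if ks: "ks \<in> lists_of ?n ?n" for ks
  proof (cases "distinct ks")
    case True
    have "card (set ks) = ?n" "set ks \<subseteq> {..<?n}"
      using ks distinct_card[OF True] by (auto simp: lists_of_def)
    then have "set ks = {..<?n}" by (simp add: card_subset_eq)
    then have "mset [0..<?n] = mset ks"
      using iffD1[OF set_eq_iff_mset_eq_distinct[OF distinct_upt True], of 0 ?n]
      by (simp add: atLeast0LessThan)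
    from alternating_perm[OF this] obtain s where
      s: "\<And>\<alpha>. alternating \<alpha> \<Longrightarrow> \<alpha> ks = s * \<alpha> [0..<?n]" by blast
    show ?thesis using s[OF alt] s[OF alternating_vol_index, of ?n]
      by (simp add: vol_index_self l_def)
  next
    case False
    then show ?thesis
      using alternating_not_distinct[OF alt] alternating_not_distinct[OF alternating_vol_index] by simp
  qed
  \<comment> \<open>The squared norm of the volume form up to a factorial. As an iterated trace it
    has the same value in \<open>e\<close> and \<open>f\<close>, which yields
    \<open>S = l * l * S\<close> with S positive.\<close>
  define S where "S = (\<Sum>ks\<in>lists_of ?n ?n. (vol_index ?n ks)\<^sup>2)"
  have "S = (\<Sum>ks\<in>lists_of ?n ?n. ?\<mu> (map e ks) * ?\<mu> (map e ks))"
    unfolding S_def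
    by (intro sum.cong refl) (simp add: lists_of_def frame_form_vol[OF E] power2_eq_square)
  also have "\<dots> = (\<Sum>ks\<in>lists_of ?n ?n. ?\<mu> (map f ks) * ?\<mu> (map f ks))"
    by (rule sum_lists_frame_change[OF E F])
      (simp_all only: mult.commute[of "?\<mu> _" "?\<mu> ys" for ys] multilinear_cmult multilinear_frame_form)
  also have "\<dots> = l * l * S"
    unfolding S_def sum_distrib_left
    by (intro sum.cong refl) (simp add: l power2_eq_square mult_ac)
  finally have "S = l * l * S" .
  moreover have "S > 0"
    unfolding S_def
  proof (rule sum_pos2[where i = "[0..<?n]"])
    show "[0..<?n] \<in> lists_of ?n ?n" by (auto simp: lists_of_def)
  qed (simp_all add: vol_index_self)
  ultimately have "l * l = 1" by (metis less_irrefl mult_cancel_right1)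
  then show ?thesis using l by blast
qed

text \<open>The double Hodge star of an \<open>(r,r)\<close> double form with components \<open>t\<close>. Summing over all multi-indices
  instead of increasing ones turns it into iterated traces, which do not depend on the frame.\<close>

definition star_index :: "nat \<Rightarrow> nat \<Rightarrow> nat dform \<Rightarrow> nat dform" where
  "star_index n r t = (\<lambda>K L. \<Sum>is\<in>lists_of n r. \<Sum>js\<in>lists_of n r.
     t is js * vol_index n (is @ K) * vol_index n (js @ L) / (fact r * fact r))"

lemma hodge_basis_form_index:
  fixes A :: "real^'n^'n"
  assumes E: "euclidean A (onb A)" and "I \<subseteq> {..<CARD('n)}" "set ks \<subseteq> {..<CARD('n)}"
  shows "hodge_basis_form A I (map (onb A) ks) = vol_index CARD('n) (sorted_list_of_set I @ ks)"
proof -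
  have "basis_form A J = frame_form A (onb A) (sorted_list_of_set J)" for J
    by (simp add: basis_form_def frame_form_def)
  moreover have "set (sorted_list_of_set ({..<CARD('n)} - I)) \<subseteq> {..<CARD('n)}"
    by simp
  ultimately show ?thesis
    by (simp only: hodge_basis_form_def vol_index_append[OF assms(2)] frame_form_map[OF E _ assms(3)])
qed

text \<open>Only index sets of size r see a nonzero coefficient of T. In each group T and the volume
  symbol are both alternating, so passing to all multi-indices costs one factor 1 / r!.\<close>

lemma double_star_onb:
  fixes A :: "real^'n^'n"
  assumes E: "euclidean A (onb A)" and T: "is_dform r r T"
    and K: "set K \<subseteq> {..<CARD('n)}" and L: "set L \<subseteq> {..<CARD('n)}"
  shows "double_star A T (map (onb A) K) (map (onb A) L) =
    star_index CARD('n) r (\<lambda>is js. T (map (onb A) is) (map (onb A) js)) K L"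
proof -
  let ?n = "CARD('n)" let ?e = "onb A" let ?s = sorted_list_of_set
  let ?P = "{I. I \<subseteq> {..<?n} \<and> card I = r}"
  have alt_vol: "alternating (\<lambda>is. vol_index ?n (is @ K))" for K
    by (rule alternating_append[OF alternating_vol_index])
  have alt1: "alternating (\<lambda>is. T (map ?e is) ys)" for ys
    using is_dformD(1)[OF T] alternating_map unfolding alt1_def by blast
  have alt2: "alternating (\<lambda>js. T xs (map ?e js))" for xs
    using is_dformD(2)[OF T] alternating_map unfolding alt1_def flip_def by blast
  define c where "c I J = T (map ?e (?s I)) (map ?e (?s J)) *
     (vol_index ?n (?s I @ K) * vol_index ?n (?s J @ L))" for I J
  have c0: "c I J = 0" if "I \<subseteq> {..<?n}" "J \<subseteq> {..<?n}" "card I \<noteq> r \<or> card J \<noteq> r" for I J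
    using that is_dform_degree[OF T, of "map ?e (?s I)" "map ?e (?s J)"] by (simp add: c_def)
  have "double_star A T (map ?e K) (map ?e L) = (\<Sum>I\<in>Pow {..<?n}. \<Sum>J\<in>Pow {..<?n}. c I J)"
    unfolding double_star_def c_def
    by (intro sum.cong refl)
      (simp add: form_tensor_def basis_vectors_def hodge_basis_form_index[OF E] K L)
  also have "\<dots> = (\<Sum>I\<in>?P. \<Sum>J\<in>Pow {..<?n}. c I J)"
    by (rule sum.mono_neutral_right) (auto intro!: sum.neutral c0)
  also have "\<dots> = (\<Sum>I\<in>?P. \<Sum>J\<in>?P. c I J)"
    by (intro sum.cong refl sum.mono_neutral_right) (auto intro!: c0)
  also have "\<dots> = (\<Sum>I\<in>?P. (\<Sum>js\<in>lists_of ?n r. T (map ?e (?s I)) (map ?e js) *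
      vol_index ?n (js @ L)) / fact r * vol_index ?n (?s I @ K))"
    by (intro sum.cong refl, subst sum_lists_of_alternating[OF alt2 alt_vol])
      (simp add: c_def sum_distrib_left sum_divide_distrib mult_ac)
  also have "\<dots> = (\<Sum>js\<in>lists_of ?n r. (\<Sum>I\<in>?P. T (map ?e (?s I)) (map ?e js) *
      vol_index ?n (?s I @ K)) * vol_index ?n (js @ L) / fact r)"
    by (simp add: sum_distrib_right sum_divide_distrib) (subst sum.swap, simp add: mult_ac)
  also have "\<dots> = (\<Sum>js\<in>lists_of ?n r. (\<Sum>is\<in>lists_of ?n r. T (map ?e is) (map ?e js) *
      vol_index ?n (is @ K)) / fact r * vol_index ?n (js @ L) / fact r)"
    by (intro sum.cong refl, subst sum_lists_of_alternating[OF alt1 alt_vol]) simp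
  also have "\<dots> = star_index ?n r (\<lambda>is js. T (map ?e is) (map ?e js)) K L"
    unfolding star_index_def
    by (subst sum.swap) (simp add: sum_distrib_left sum_divide_distrib mult_ac)
  finally show ?thesis .
qed

text \<open>The equation holds on the frame \<open>onb\<close>, hence on all vectors by
  multilinearity. The free slots are then filled with \<open>f\<close>, and the traces over both
  summed groups are moved to \<open>f\<close> as well.\<close>

lemma star_frame:
  fixes A :: "real^'n^'n"
  assumes F: "euclidean A f" and T: "is_dform r r T" and n: "CARD('n) = 2 * r"
    and star: "\<And>xs ys. double_star A T xs ys = \<epsilon> * T xs ys"
    and K: "K \<in> lists_of CARD('n) r" and L: "L \<in> lists_of CARD('n) r"
  shows "\<epsilon> * T (map f K) (map f L) =
    star_index CARD('n) r (\<lambda>is js. T (map f is) (map f js)) K L"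
proof -
  let ?n = "CARD('n)" let ?e = "onb A" let ?\<mu> = "frame_form A ?e [0..<?n]" let ?l = "lists_of ?n r"
  have pd: "pos_def A" using F by (rule euclidean.pos_def)
  have E: "euclidean A ?e"
    using pd someI_ex[OF orthonormal_frame_exists[OF pd]]
    by unfold_locales (auto simp: onb_def)
  define c :: real where "c = 1 / (fact r * fact r)"
  have m1: "multilinear (\<lambda>xs. T xs ys)" for ys using is_dformD(3)[OF T] by (simp add: lin1_def)
  have m2: "multilinear (T xs)" for xs using is_dformD(4)[OF T] by (simp add: lin1_def flip_def)
  have \<mu>: "multilinear ?\<mu>" by (rule multilinear_frame_form)
  \<comment> \<open>The star of T extended to arbitrary arguments, with an actual volume form in
    place of the symbol, so that it is multilinear.\<close>
  define S where "S = (\<lambda>xs ys. \<Sum>is\<in>?l. \<Sum>js\<in>?l.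
    c * T (map ?e is) (map ?e js) * ?\<mu> (map ?e is @ xs) * ?\<mu> (map ?e js @ ys))"
  have S1: "multilinear (\<lambda>xs. S xs ys)" for ys
  proof -
    have "(\<lambda>xs. S xs ys) = (\<lambda>xs. \<Sum>is\<in>?l. \<Sum>js\<in>?l.
      (c * T (map ?e is) (map ?e js) * ?\<mu> (map ?e js @ ys)) * ?\<mu> (map ?e is @ xs))"
      by (simp add: S_def mult_ac)
    then show ?thesis by (simp add: multilinear_sum multilinear_cmult multilinear_ins \<mu>)
  qed
  have S2: "multilinear (S xs)" for xs
    by (simp add: S_def multilinear_sum multilinear_cmult multilinear_ins \<mu>)
  have eq: "\<epsilon> * T (map ?e K) (map ?e L) = S (map ?e K) (map ?e L)"
    if "K \<in> ?l" "L \<in> ?l" for K L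
  proof -
    have "\<epsilon> * T (map ?e K) (map ?e L) = star_index ?n r (\<lambda>is js. T (map ?e is) (map ?e js)) K L"
      using that unfolding star[symmetric] by (intro double_star_onb[OF E T]) (auto simp: lists_of_def)
    also have "\<dots> = S (map ?e K) (map ?e L)"
      unfolding star_index_def S_def c_def
    proof (intro sum.cong refl)
      fix "is" js assume "is \<in> ?l" "js \<in> ?l"
      then show "T (map ?e is) (map ?e js) * vol_index ?n (is @ K) * vol_index ?n (js @ L) / (fact r * fact r) =
        1 / (fact r * fact r) * T (map ?e is) (map ?e js) * ?\<mu> (map ?e is @ map ?e K) * ?\<mu> (map ?e js @ map ?e L)"
        using that frame_form_vol[OF E, of "is @ K"] frame_form_vol[OF E, of "js @ L"]
        by (simp add: lists_of_def)
    qed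
    finally show ?thesis .
  qed
  have "\<epsilon> * T (map f K) (map f L) = S (map f K) (map f L)"
  proof (rule multilinear_eqI_frame[OF E, of "\<lambda>xs. \<epsilon> * T xs (map f L)" "\<lambda>xs. S xs (map f L)" r])
    fix ks assume ks: "ks \<in> lists_of ?n r"
    show "\<epsilon> * T (map ?e ks) (map f L) = S (map ?e ks) (map f L)"
    proof (rule multilinear_eqI_frame[OF E, of "\<lambda>ys. \<epsilon> * T (map ?e ks) ys" "S (map ?e ks)" r])
      show "\<epsilon> * T (map ?e ks) (map ?e js) = S (map ?e ks) (map ?e js)" if "js \<in> ?l" for js
        using ks that by (rule eq)
      show "multilinear (\<lambda>ys. \<epsilon> * T (map ?e ks) ys)" by (intro multilinear_cmult m2)
      show "multilinear (S (map ?e ks))" by (rule S2)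
      show "length (map f L) = r" using L by (simp add: lists_of_def)
    qed
  next
    show "multilinear (\<lambda>xs. \<epsilon> * T xs (map f L))" by (intro multilinear_cmult m1)
    show "multilinear (\<lambda>xs. S xs (map f L))" by (rule S1)
    show "length (map f K) = r" using K by (simp add: lists_of_def)
  qed
  also have "\<dots> = (\<Sum>js\<in>?l. \<Sum>is\<in>?l.
      c * ?\<mu> (map ?e js @ map f L) * T (map ?e is) (map ?e js) * ?\<mu> (map ?e is @ map f K))"
    unfolding S_def by (subst sum.swap) (simp add: mult_ac)
  also have "\<dots> = (\<Sum>js\<in>?l. \<Sum>is\<in>?l.
      c * ?\<mu> (map ?e js @ map f L) * T (map f is) (map ?e js) * ?\<mu> (map f is @ map f K))"
  proof (rule sum.cong[OF refl])
    fix js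
    show "(\<Sum>is\<in>?l. c * ?\<mu> (map ?e js @ map f L) * T (map ?e is) (map ?e js) * ?\<mu> (map ?e is @ map f K)) =
      (\<Sum>is\<in>?l. c * ?\<mu> (map ?e js @ map f L) * T (map f is) (map ?e js) * ?\<mu> (map f is @ map f K))"
      by (rule sum_lists_frame_change[OF E F, of "\<lambda>xs xs'.
          c * ?\<mu> (map ?e js @ map f L) * T xs (map ?e js) * ?\<mu> (xs' @ map f K)"])
        (intro multilinear_cmult multilinear_cmult_right m1 multilinear_append \<mu>)+
  qed
  also have "\<dots> = (\<Sum>is\<in>?l. \<Sum>js\<in>?l.
      c * ?\<mu> (map f is @ map f K) * T (map f is) (map ?e js) * ?\<mu> (map ?e js @ map f L))"
    by (subst sum.swap) (simp add: mult_ac)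
  also have "\<dots> = (\<Sum>is\<in>?l. \<Sum>js\<in>?l.
      c * ?\<mu> (map f is @ map f K) * T (map f is) (map f js) * ?\<mu> (map f js @ map f L))"
  proof (rule sum.cong[OF refl])
    fix "is"
    show "(\<Sum>js\<in>?l. c * ?\<mu> (map f is @ map f K) * T (map f is) (map ?e js) * ?\<mu> (map ?e js @ map f L)) =
      (\<Sum>js\<in>?l. c * ?\<mu> (map f is @ map f K) * T (map f is) (map f js) * ?\<mu> (map f js @ map f L))"
      by (rule sum_lists_frame_change[OF E F, of "\<lambda>ys ys'.
          c * ?\<mu> (map f is @ map f K) * T (map f is) ys * ?\<mu> (ys' @ map f L)"])
        (intro multilinear_cmult multilinear_cmult_right m2 multilinear_append \<mu>)+
  qed
  also have "\<dots> = star_index ?n r (\<lambda>is js. T (map f is) (map f js)) K L"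
  proof -
    obtain l where l: "l * l = 1"
      "\<And>ks. ks \<in> lists_of ?n ?n \<Longrightarrow> ?\<mu> (map f ks) = l * vol_index ?n ks"
      using frame_form_vol_other[OF E F] by blast
    have "?\<mu> (map f is @ map f K) = l * vol_index ?n (is @ K)" "?\<mu> (map f is @ map f L) = l * vol_index ?n (is @ L)"
      if "is \<in> ?l" for "is"
      using l(2)[of "is @ K"] l(2)[of "is @ L"] that K L n by (auto simp: lists_of_def)
    \<comment> \<open>Each group contributes one volume factor, so the unknown orientation sign
      enters as l * l. This is why the double star needs no orientation.\<close>
    moreover have "c * (l * x) * y * (l * z) = y * x * z / (fact r * fact r)" for x y z
    proof -
      have "c * (l * x) * y * (l * z) = c * (l * l) * x * y * z" by (simp only: mult_ac)
      then show ?thesis unfolding l(1) c_def by simp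
    qed
    ultimately show ?thesis unfolding star_index_def
      by (intro sum.cong refl) (simp only: )
  qed
  finally show ?thesis .
qed

text \<open>A self-dual closed form is coclosed: moving an argument past \<open>vol_index\<close> turns the divergence
  of \<open>\<star>F\<close> into the exterior derivative of \<open>F\<close>.\<close>

lemma divergence_eq_0_index:
  fixes F :: "nat \<Rightarrow> nat dform"
  assumes \<epsilon>: "\<epsilon> \<noteq> 0"
    and star: "\<And>i K L. i < n \<Longrightarrow> K \<in> lists_of n r \<Longrightarrow> L \<in> lists_of n r \<Longrightarrow> \<epsilon> * F i K L = star_index n r (F i) K L"
    and closed: "\<And>ks L. ks \<in> lists_of n (Suc r) \<Longrightarrow> L \<in> lists_of n r \<Longrightarrow> dD F ks L = 0"
    and K: "K \<in> lists_of n r'" and r: "r = Suc r'" and L: "L \<in> lists_of n r"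
  shows "(\<Sum>i<n. F i (i # K) L) = 0"
proof -
  let ?v = "vol_index n"
  have zero: "(\<Sum>i<n. \<Sum>is\<in>lists_of n r. F i is js * ?v (is @ i # K)) = 0"
    if js: "js \<in> lists_of n r" for js
  proof -
    define H where "H i is = F i is js * ?v (i # is @ K)" for i "is"
    \<comment> \<open>Closedness is contracted with the volume symbol. Moving the j-th index to the
      front cancels the sign (-1)^j, so all Suc r positions give the same sum, which must therefore
      vanish.\<close>
    have "0 = (\<Sum>ks\<in>lists_of n (Suc r). dD F ks js * ?v (ks @ K))"
      using closed js by simp
    also have "\<dots> = (\<Sum>ks\<in>lists_of n (Suc r). \<Sum>j<Suc r. H (ks ! j) (take j ks @ drop (Suc j) ks))"
    proof (rule sum.cong[OF refl])
      fix ks assume "ks \<in> lists_of n (Suc r)"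
      then have len: "length ks = Suc r" by (simp add: lists_of_def)
      have "?v (ks @ K) = (-1) ^ j * ?v (ks ! j # (take j ks @ drop (Suc j) ks) @ K)" if "j < Suc r" for j
      proof -
        have "ks @ K = take j ks @ ks ! j # (drop (Suc j) ks @ K)"
          by (subst id_take_nth_drop[of j ks]) (use that len in simp_all)
        then have "?v (ks @ K) = (-1) ^ length (take j ks) * ?v (ks ! j # take j ks @ (drop (Suc j) ks @ K))"
          by (simp only: alternating_front[OF alternating_vol_index])
        then show ?thesis using that len by simp
      qed
      then show "dD F ks js * ?v (ks @ K) = (\<Sum>j<Suc r. H (ks ! j) (take j ks @ drop (Suc j) ks))"
        unfolding dD_def len sum_distrib_right H_def by (intro sum.cong refl) (simp add: mult_ac)
    qed
    also have "\<dots> = (\<Sum>j<Suc r. \<Sum>ks\<in>lists_of n (Suc r). H (ks ! j) (take j ks @ drop (Suc j) ks))"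
      by (rule sum.swap)
    also have "\<dots> = (\<Sum>j<Suc r. \<Sum>i<n. \<Sum>is\<in>lists_of n r. H i is)"
      by (intro sum.cong refl sum_lists_of_insert) simp
    finally have "(\<Sum>i<n. \<Sum>is\<in>lists_of n r. H i is) = 0" by simp
    moreover have "F i is js * ?v (is @ i # K) = (-1) ^ r * H i is" if "is \<in> lists_of n r" for i "is"
      using alternating_front[OF alternating_vol_index, of n "is" i K] that
      by (simp add: H_def lists_of_def mult_ac)
    ultimately show ?thesis by (simp add: sum_distrib_left[symmetric])
  qed
  have "\<epsilon> * (\<Sum>i<n. F i (i # K) L) = (\<Sum>i<n. star_index n r (F i) (i # K) L)"
    unfolding sum_distrib_left using K L r by (intro sum.cong refl star) (auto simp: lists_of_def)
  also have "\<dots> = (\<Sum>i<n. \<Sum>js\<in>lists_of n r. \<Sum>is\<in>lists_of n r.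
      F i is js * ?v (is @ i # K) * ?v (js @ L) / (fact r * fact r))"
    unfolding star_index_def by (intro sum.cong refl sum.swap)
  also have "\<dots> = (\<Sum>js\<in>lists_of n r. (\<Sum>i<n. \<Sum>is\<in>lists_of n r. F i is js * ?v (is @ i # K)) *
      ?v (js @ L) / (fact r * fact r))"
    by (subst sum.swap) (simp add: sum_distrib_right sum_divide_distrib)
  also have "\<dots> = 0" using zero by simp
  finally show ?thesis using \<epsilon> by simp
qed

section \<open>Functions of class C^k\<close>

lemma Ck_on_cong:
  assumes "open S" "\<And>x. x \<in> S \<Longrightarrow> f x = g x" "Ck_on k f S"
  shows "Ck_on k g S"
  using assms(2,3)
proof (induction k arbitrary: f g)
  case 0
  then show ?case by (simp cong: continuous_on_cong)
next
  case (Suc k)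
  have "frechet_derivative f (at x) = frechet_derivative g (at x)" if "x \<in> S" for x
    using Suc.prems assms(1) that by (intro frechet_derivative_transform_within_open) auto
  moreover have "g differentiable (at x)" if "x \<in> S" for x
    using Suc.prems assms(1) that
    by (metis Ck_on.simps(2) differentiable_def has_derivative_transform_within_open)
  ultimately show ?case using Suc.prems(2)
    by (auto intro: Suc.IH[rotated])
qed

lemma Ck_on_SucI:
  assumes "open S" "\<And>x. x \<in> S \<Longrightarrow> (f has_derivative f' x) (at x)" "\<And>v. Ck_on k (\<lambda>x. f' x v) S"
  shows "Ck_on (Suc k) f S"
proof -
  have "frechet_derivative f (at x) = f' x" if "x \<in> S" for x
    using frechet_derivative_at[OF assms(2)[OF that]] by simp
  then have "Ck_on k (\<lambda>x. frechet_derivative f (at x) v) S" for v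
    by (intro Ck_on_cong[OF assms(1) _ assms(3)]) simp
  then show ?thesis using assms(2) by (auto simp: differentiable_def)
qed

lemma Ck_on_Suc_has_derivative:
  "Ck_on (Suc k) f S \<Longrightarrow> x \<in> S \<Longrightarrow> (f has_derivative frechet_derivative f (at x)) (at x)"
  by (simp add: frechet_derivative_works)

lemma Ck_on_Suc_D: "Ck_on (Suc k) f S \<Longrightarrow> Ck_on k f S"
proof (induction k arbitrary: f)
  case 0
  then show ?case by (auto intro!: continuous_at_imp_continuous_on differentiable_imp_continuous_within)
next
  case (Suc k)
  from Suc.prems show ?case
    unfolding Ck_on.simps(2)[of "Suc k"] by (subst Ck_on.simps(2)) (blast intro: Suc.IH)
qed

lemma Ck_on_const: "open S \<Longrightarrow> Ck_on k (\<lambda>x. c) S"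
proof (induction k arbitrary: c)
  case (Suc k)
  show ?case by (rule Ck_on_SucI[OF Suc.prems has_derivative_const Suc.IH[OF Suc.prems]])
qed simp

lemma Ck_on_bounded_linear:
  assumes "open S" "bounded_linear L"
  shows "Ck_on k f S \<Longrightarrow> Ck_on k (\<lambda>x. L (f x)) S"
proof (induction k arbitrary: f)
  case 0
  then show ?case using assms(2) by (simp add: bounded_linear.continuous_on)
next
  case (Suc k)
  show ?case
    by (rule Ck_on_SucI[OF assms(1) bounded_linear.has_derivative[OF assms(2)
          Ck_on_Suc_has_derivative[OF Suc.prems]]]) (use Suc in auto)
qed

lemma Ck_on_add:
  assumes "open S" shows "Ck_on k f S \<Longrightarrow> Ck_on k g S \<Longrightarrow> Ck_on k (\<lambda>x. f x + g x) S"
proof (induction k arbitrary: f g)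
  case 0
  then show ?case by (simp add: continuous_on_add)
next
  case (Suc k)
  show ?case
    by (rule Ck_on_SucI[OF assms has_derivative_add[OF
          Ck_on_Suc_has_derivative[OF Suc.prems(1)] Ck_on_Suc_has_derivative[OF Suc.prems(2)]]])
      (use Suc in auto)
qed

lemma Ck_on_sum:
  assumes "open S" "\<And>i. i \<in> I \<Longrightarrow> Ck_on k (f i) S"
  shows "Ck_on k (\<lambda>x. \<Sum>i\<in>I. f i x) S"
  using assms(2)
  by (induction I rule: infinite_finite_induct) (auto simp: Ck_on_const Ck_on_add assms(1))

lemma Ck_on_mult:
  fixes f g :: "'a::real_normed_vector \<Rightarrow> real"
  assumes "open S" shows "Ck_on k f S \<Longrightarrow> Ck_on k g S \<Longrightarrow> Ck_on k (\<lambda>x. f x * g x) S"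
proof (induction k arbitrary: f g)
  case 0
  then show ?case by (simp add: continuous_on_mult)
next
  case (Suc k)
  note D = Suc.prems[THEN Ck_on_Suc_D] Suc.prems[unfolded Ck_on.simps(2), THEN conjunct2, THEN spec]
  have "Ck_on k (\<lambda>x. f x * frechet_derivative g (at x) v + frechet_derivative f (at x) v * g x) S" for v
    by (rule Ck_on_add[OF assms Suc.IH[OF D(1) D(4)] Suc.IH[OF D(3) D(2)]])
  then show ?case
    by (intro Ck_on_SucI[OF assms has_derivative_mult[OF
          Ck_on_Suc_has_derivative[OF Suc.prems(1)] Ck_on_Suc_has_derivative[OF Suc.prems(2)]]])
qed

lemma Ck_on_prod:
  fixes f :: "'i \<Rightarrow> 'a::real_normed_vector \<Rightarrow> real"
  assumes "open S" "\<And>i. i \<in> I \<Longrightarrow> Ck_on k (f i) S"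
  shows "Ck_on k (\<lambda>x. \<Prod>i\<in>I. f i x) S"
  using assms(2)
  by (induction I rule: infinite_finite_induct) (auto simp: Ck_on_const Ck_on_mult assms(1))

text \<open>The derivative of 1/f involves 1/f itself, but only in class C^k, which the induction
  hypothesis provides.\<close>

lemma Ck_on_inverse:
  fixes f :: "'a::real_normed_vector \<Rightarrow> real"
  assumes "open S" and nz: "\<And>x. x \<in> S \<Longrightarrow> f x \<noteq> 0"
  shows "Ck_on k f S \<Longrightarrow> Ck_on k (\<lambda>x. inverse (f x)) S"
proof (induction k)
  case 0
  then show ?case using nz by (auto intro: continuous_on_inverse)
next
  case (Suc k)
  have "Ck_on k (\<lambda>x. inverse (f x)) S" using Suc.IH Ck_on_Suc_D[OF Suc.prems] by blast
  moreover have "Ck_on k (\<lambda>x. frechet_derivative f (at x) v) S" for v using Suc.prems by simp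
  ultimately have "Ck_on k (\<lambda>x. (-1) * (inverse (f x) * frechet_derivative f (at x) v * inverse (f x))) S" for v
    by (intro Ck_on_mult[OF assms(1)] Ck_on_const[OF assms(1)])
  then show ?case
    by (intro Ck_on_SucI[OF assms(1) Deriv.has_derivative_inverse[OF nz Ck_on_Suc_has_derivative[OF Suc.prems]]])
      auto
qed

lemma bounded_linear_mat_nth: "bounded_linear (\<lambda>A::real^'n^'m. A $ i $ j)"
  by (rule bounded_linear_compose[OF bounded_linear_vec_nth bounded_linear_vec_nth])

lemma Ck_on_vecI:
  fixes f :: "'a::real_normed_vector \<Rightarrow> real^'n"
  assumes "open S" "\<And>i. Ck_on k (\<lambda>x. f x $ i) S"
  shows "Ck_on k f S"
proof -
  have "f = (\<lambda>x. \<Sum>i\<in>UNIV. f x $ i *\<^sub>R axis i 1)"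
    by (simp add: basis_expansion scalar_mult_eq_scaleR[symmetric])
  moreover have "Ck_on k (\<lambda>x. \<Sum>i\<in>UNIV. f x $ i *\<^sub>R axis i (1::real)) S"
    by (intro Ck_on_sum assms Ck_on_bounded_linear[of S "\<lambda>c. c *\<^sub>R axis i (1::real)" for i]
        bounded_linear_scaleR_left)
  ultimately show ?thesis by metis
qed

section \<open>Symmetry of second derivatives\<close>

lemma DERIV_along:
  fixes f :: "'a::real_normed_vector \<Rightarrow> real"
  assumes "f differentiable (at (p + s *\<^sub>R u))"
  shows "((\<lambda>s. f (p + s *\<^sub>R u)) has_real_derivative frechet_derivative f (at (p + s *\<^sub>R u)) u) (at s)"
proof -
  let ?f' = "frechet_derivative f (at (p + s *\<^sub>R u))"
  have f: "(f has_derivative ?f') (at (p + s *\<^sub>R u))"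
    using assms by (simp add: frechet_derivative_works)
  have "((\<lambda>s. p + s *\<^sub>R u) has_derivative (\<lambda>h. h *\<^sub>R u)) (at s)"
    by (auto intro!: derivative_eq_intros)
  from has_derivative_compose[OF this f] have "((\<lambda>s. f (p + s *\<^sub>R u)) has_derivative (\<lambda>h. ?f' (h *\<^sub>R u))) (at s)" .
  then show ?thesis
    by (simp add: has_field_derivative_def linear_scale[OF linear_frechet_derivative[OF assms]] mult.commute)
      (simp add: mult.commute[of _ "?f' u"])
qed

text \<open>The mean value theorem is applied twice: first along u to the difference of f in
  direction v, then along v to the derivative of f in direction u.\<close>

lemma second_difference:
  fixes f :: "'a::real_normed_vector \<Rightarrow> real"
  assumes C2: "Ck_on 2 f S" and t: "t > 0"
    and S: "\<And>a b. 0 \<le> a \<Longrightarrow> a \<le> t \<Longrightarrow> 0 \<le> b \<Longrightarrow> b \<le> t \<Longrightarrow> x + a *\<^sub>R u + b *\<^sub>R v \<in> S"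
  shows "\<exists>a b. 0 \<le> a \<and> a \<le> t \<and> 0 \<le> b \<and> b \<le> t \<and>
    f (x + t *\<^sub>R u + t *\<^sub>R v) - f (x + t *\<^sub>R u) - f (x + t *\<^sub>R v) + f x =
    t * t * frechet_derivative (\<lambda>y. frechet_derivative f (at y) u) (at (x + a *\<^sub>R u + b *\<^sub>R v)) v"
proof -
  have df: "\<And>y. y \<in> S \<Longrightarrow> f differentiable (at y)"
    and ddf: "\<And>y. y \<in> S \<Longrightarrow> (\<lambda>y. frechet_derivative f (at y) u) differentiable (at y)"
    using C2 by (auto simp: numeral_2_eq_2)
  let ?h = "\<lambda>y. frechet_derivative f (at y) u"
  let ?\<phi> = "\<lambda>s. f ((x + t *\<^sub>R v) + s *\<^sub>R u) - f (x + s *\<^sub>R u)"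
  have "\<exists>z>0. z < t \<and> ?\<phi> t - ?\<phi> 0 = (t - 0) * (?h ((x + t *\<^sub>R v) + z *\<^sub>R u) - ?h (x + z *\<^sub>R u))"
  proof (rule MVT2[OF t])
    fix s assume s: "0 \<le> s" "s \<le> t"
    have "(x + t *\<^sub>R v) + s *\<^sub>R u \<in> S" "x + s *\<^sub>R u \<in> S"
      using S[of s t] S[of s 0] s t by (simp_all add: algebra_simps)
    then show "(?\<phi> has_real_derivative ?h ((x + t *\<^sub>R v) + s *\<^sub>R u) - ?h (x + s *\<^sub>R u)) (at s)"
      by (intro DERIV_diff DERIV_along df)
  qed
  then obtain a where a: "0 < a" "a < t"
    "?\<phi> t - ?\<phi> 0 = t * (?h ((x + t *\<^sub>R v) + a *\<^sub>R u) - ?h (x + a *\<^sub>R u))" by auto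
  have "\<exists>z>0. z < t \<and> ?h ((x + a *\<^sub>R u) + t *\<^sub>R v) - ?h ((x + a *\<^sub>R u) + 0 *\<^sub>R v) =
      (t - 0) * frechet_derivative ?h (at ((x + a *\<^sub>R u) + z *\<^sub>R v)) v"
  proof (rule MVT2[OF t])
    fix s assume s: "0 \<le> s" "s \<le> t"
    have "(x + a *\<^sub>R u) + s *\<^sub>R v \<in> S" using S[of a s] s a by simp
    then show "((\<lambda>s. ?h ((x + a *\<^sub>R u) + s *\<^sub>R v)) has_real_derivative
      frechet_derivative ?h (at ((x + a *\<^sub>R u) + s *\<^sub>R v)) v) (at s)"
      by (intro DERIV_along ddf)
  qed
  then obtain b where b: "0 < b" "b < t" "?h ((x + a *\<^sub>R u) + t *\<^sub>R v) - ?h (x + a *\<^sub>R u) =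
      t * frechet_derivative ?h (at ((x + a *\<^sub>R u) + b *\<^sub>R v)) v" by auto
  have "f (x + t *\<^sub>R u + t *\<^sub>R v) - f (x + t *\<^sub>R u) - f (x + t *\<^sub>R v) + f x = ?\<phi> t - ?\<phi> 0"
    by (simp add: algebra_simps)
  also have "\<dots> = t * (?h ((x + a *\<^sub>R u) + t *\<^sub>R v) - ?h (x + a *\<^sub>R u))"
    using a(3) by (simp add: algebra_simps)
  also have "\<dots> = t * t * frechet_derivative ?h (at (x + a *\<^sub>R u + b *\<^sub>R v)) v"
    unfolding b(3) by simp
  finally show ?thesis using a b by (intro exI[of _ a] exI[of _ b]) auto
qed

text \<open>The second difference is symmetric in u and v, so the two mixed derivatives take a
  common value at points arbitrarily close to x. Continuity at x then forces equality.\<close>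

lemma Ck_on_2_symmetric_real:
  fixes f :: "'a::real_normed_vector \<Rightarrow> real"
  assumes C2: "Ck_on 2 f S" and "open S" "x \<in> S"
  shows "frechet_derivative (\<lambda>y. frechet_derivative f (at y) u) (at x) v =
    frechet_derivative (\<lambda>y. frechet_derivative f (at y) v) (at x) u" (is "?H u v x = ?H v u x")
proof (rule ccontr)
  assume ne: "?H u v x \<noteq> ?H v u x"
  \<comment> \<open>Half the gap, so that no number lies within \<epsilon> of both values.\<close>
  define \<epsilon> where "\<epsilon> = \<bar>?H u v x - ?H v u x\<bar> / 2"
  have \<epsilon>: "\<epsilon> > 0" using ne by (simp add: \<epsilon>_def)
  have cont: "continuous_on S (?H u v)" for u v using C2 by (simp add: numeral_2_eq_2)
  have near: "\<exists>d>0. ball x d \<subseteq> S \<and> (\<forall>y\<in>ball x d. \<bar>?H u v y - ?H u v x\<bar> < \<epsilon>)" for u v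
  proof -
    obtain d1 where d1: "d1 > 0" "\<forall>y\<in>S. dist y x < d1 \<longrightarrow> dist (?H u v y) (?H u v x) < \<epsilon>"
      using cont[of u v] assms(3) \<epsilon> unfolding continuous_on_iff by blast
    obtain d2 where "d2 > 0" "ball x d2 \<subseteq> S" using assms(2,3) open_contains_ball by blast
    then show ?thesis using d1
      by (intro exI[of _ "min d1 d2"]) (auto simp: dist_commute dist_real_def subset_iff)
  qed
  obtain d1 where d1: "d1 > 0" "ball x d1 \<subseteq> S" "\<forall>y\<in>ball x d1. \<bar>?H u v y - ?H u v x\<bar> < \<epsilon>"
    using near by blast
  obtain d2 where d2: "d2 > 0" "ball x d2 \<subseteq> S" "\<forall>y\<in>ball x d2. \<bar>?H v u y - ?H v u x\<bar> < \<epsilon>"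
    using near by blast
  define d where "d = min d1 d2"
  \<comment> \<open>This keeps the parallelogram within distance d/2 of x; the summand 1 covers u =
    v = 0.\<close>
  define t where "t = d / (2 * (norm u + norm v + 1))"
  have d: "d > 0" using d1 d2 by (simp add: d_def)
  have nn: "norm u + norm v + 1 > 0" by (meson add_nonneg_pos add_nonneg_nonneg norm_ge_zero zero_less_one)
  have t: "t > 0" using d nn by (simp add: t_def)
  have inb: "x + a *\<^sub>R u + b *\<^sub>R v \<in> ball x d" "x + a *\<^sub>R v + b *\<^sub>R u \<in> ball x d"
    if "0 \<le> a" "a \<le> t" "0 \<le> b" "b \<le> t" for a b
  proof -
    have 1: "norm (a *\<^sub>R p + b *\<^sub>R q) < d" if "norm p + norm q = norm u + norm v" for p q :: 'a
    proof -
      have "norm (a *\<^sub>R p + b *\<^sub>R q) \<le> norm (a *\<^sub>R p) + norm (b *\<^sub>R q)" by (rule norm_triangle_ineq)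
      also have "\<dots> \<le> t * norm p + t * norm q"
        using \<open>0 \<le> a\<close> \<open>a \<le> t\<close> \<open>0 \<le> b\<close> \<open>b \<le> t\<close> by (intro add_mono) (auto intro: mult_right_mono)
      also have "\<dots> \<le> t * (norm u + norm v + 1)"
        using that t by (simp flip: distrib_left)
      also have "\<dots> = d / 2"
      proof -
        have "d / (2 * N) * N = d / 2" if "N > 0" for N :: real using that by simp
        from this[OF nn] show ?thesis by (simp only: t_def)
      qed
      finally show ?thesis using d by simp
    qed
    have 2: "x + p + q \<in> ball x d" if "norm (p + q) < d" for p q
      using that unfolding mem_ball add.assoc by (subst dist_commute) (simp add: dist_norm)
    show "x + a *\<^sub>R u + b *\<^sub>R v \<in> ball x d" "x + a *\<^sub>R v + b *\<^sub>R u \<in> ball x d"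
      using 1[of u v] 1[of v u] 2 by simp_all
  qed
  have sub: "ball x d \<subseteq> S" using d1 by (auto simp: d_def)
  obtain a b where ab: "0 \<le> a" "a \<le> t" "0 \<le> b" "b \<le> t"
    "f (x + t *\<^sub>R u + t *\<^sub>R v) - f (x + t *\<^sub>R u) - f (x + t *\<^sub>R v) + f x =
      t * t * ?H u v (x + a *\<^sub>R u + b *\<^sub>R v)"
    using second_difference[OF C2 t subsetD[OF sub inb(1)]] by auto
  obtain a' b' where ab': "0 \<le> a'" "a' \<le> t" "0 \<le> b'" "b' \<le> t"
    "f (x + t *\<^sub>R v + t *\<^sub>R u) - f (x + t *\<^sub>R v) - f (x + t *\<^sub>R u) + f x =
      t * t * ?H v u (x + a' *\<^sub>R v + b' *\<^sub>R u)"
    using second_difference[OF C2 t subsetD[OF sub inb(2)]] by auto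
  have "t * t * ?H u v (x + a *\<^sub>R u + b *\<^sub>R v) = t * t * ?H v u (x + a' *\<^sub>R v + b' *\<^sub>R u)"
    unfolding ab(5)[symmetric] ab'(5)[symmetric] by (simp add: algebra_simps)
  then have eq: "?H u v (x + a *\<^sub>R u + b *\<^sub>R v) = ?H v u (x + a' *\<^sub>R v + b' *\<^sub>R u)" using t by simp
  have "\<bar>?H u v (x + a *\<^sub>R u + b *\<^sub>R v) - ?H u v x\<bar> < \<epsilon>"
    using inb(1)[OF ab(1-4)] d1(3) by (auto simp: d_def)
  moreover have "\<bar>?H v u (x + a' *\<^sub>R v + b' *\<^sub>R u) - ?H v u x\<bar> < \<epsilon>"
    using inb(2)[OF ab'(1-4)] d2(3) by (auto simp: d_def)
  moreover have "\<not> (\<bar>A - p\<bar> < \<bar>p - q\<bar> / 2 \<and> \<bar>A - q\<bar> < \<bar>p - q\<bar> / 2)" for A p q :: real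
    by (auto simp: abs_if split: if_splits)
  ultimately show False unfolding eq \<epsilon>_def by blast
qed

lemma frechet_derivative_bounded_linear:
  assumes "bounded_linear L" "f differentiable (at x)"
  shows "frechet_derivative (\<lambda>y. L (f y)) (at x) v = L (frechet_derivative f (at x) v)"
proof -
  have "((\<lambda>y. L (f y)) has_derivative (\<lambda>v. L (frechet_derivative f (at x) v))) (at x)"
    by (rule bounded_linear.has_derivative[OF assms(1) assms(2)[unfolded frechet_derivative_works]])
  from fun_cong[OF frechet_derivative_at[OF this], of v] show ?thesis by (rule sym)
qed

lemma Ck_on_2_symmetric:
  fixes f :: "'a::real_normed_vector \<Rightarrow> real^'n"
  assumes C2: "Ck_on 2 f S" and S: "open S" "x \<in> S"
  shows "frechet_derivative (\<lambda>y. frechet_derivative f (at y) u) (at x) v =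
    frechet_derivative (\<lambda>y. frechet_derivative f (at y) v) (at x) u"
proof -
  have comp: "frechet_derivative (\<lambda>y. frechet_derivative f (at y) u) (at x) v $ i =
      frechet_derivative (\<lambda>y. frechet_derivative (\<lambda>y. f y $ i) (at y) u) (at x) v" for i u v
  proof -
    have d1: "f differentiable (at y)" if "y \<in> S" for y
      using C2 that unfolding numeral_2_eq_2 Ck_on.simps(2) by blast
    have d2: "(\<lambda>y. frechet_derivative f (at y) u) differentiable (at x)"
      using C2 S(2) unfolding numeral_2_eq_2 Ck_on.simps(2) by blast
    have "frechet_derivative (\<lambda>y. frechet_derivative f (at y) u) (at x) v $ i =
        frechet_derivative (\<lambda>y. frechet_derivative f (at y) u $ i) (at x) v"
      by (rule frechet_derivative_bounded_linear[OF bounded_linear_vec_nth d2, symmetric])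
    also have "frechet_derivative (\<lambda>y. frechet_derivative f (at y) u $ i) (at x) =
        frechet_derivative (\<lambda>y. frechet_derivative (\<lambda>y. f y $ i) (at y) u) (at x)"
    proof (rule frechet_derivative_transform_within_open[OF _ S])
      show "(\<lambda>y. frechet_derivative f (at y) u $ i) differentiable at x"
        by (rule differentiableI[OF bounded_linear.has_derivative[OF bounded_linear_vec_nth
              d2[unfolded frechet_derivative_works]]])
      show "frechet_derivative f (at y) u $ i = frechet_derivative (\<lambda>y. f y $ i) (at y) u" if "y \<in> S" for y
        by (rule frechet_derivative_bounded_linear[OF bounded_linear_vec_nth d1[OF that], symmetric])
    qed
    finally show ?thesis .
  qed
  have "Ck_on 2 (\<lambda>y. f y $ i) S" for i
    by (rule Ck_on_bounded_linear[OF S(1) bounded_linear_vec_nth C2])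
  then show ?thesis
    unfolding vec_eq_iff comp by (intro allI Ck_on_2_symmetric_real[OF _ S])
qed

text \<open>Expanding the argument in the standard basis reduces this product rule to finitely many
  scalar products, so differentiability of \<Lambda> at each fixed vector is enough.\<close>

lemma linear_family_has_derivative:
  fixes \<Lambda> :: "'a::real_normed_vector \<Rightarrow> real^'n \<Rightarrow> 'b::real_normed_vector"
  assumes S: "open S" "x \<in> S" and lin: "\<And>y. y \<in> S \<Longrightarrow> linear (\<Lambda> y)"
    and diff: "\<And>w. (\<lambda>y. \<Lambda> y w) differentiable (at x)"
    and X: "(X has_derivative X') (at x)"
  shows "((\<lambda>y. \<Lambda> y (X y)) has_derivative
    (\<lambda>z. frechet_derivative (\<lambda>y. \<Lambda> y (X x)) (at x) z + \<Lambda> x (X' z))) (at x)"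
proof -
  let ?b = "\<lambda>a. axis a (1::real) :: real^'n"
  let ?d = "\<lambda>a. frechet_derivative (\<lambda>y. \<Lambda> y (?b a)) (at x)"
  have exp: "\<Lambda> y w = (\<Sum>a\<in>UNIV. w $ a *\<^sub>R \<Lambda> y (?b a))" if "y \<in> S" for y w
  proof -
    have "\<Lambda> y w = \<Lambda> y (\<Sum>a\<in>UNIV. w $ a *\<^sub>R ?b a)"
      by (simp add: basis_expansion scalar_mult_eq_scaleR[symmetric])
    then show ?thesis by (simp add: linear_sum[OF lin[OF that]] linear_scale[OF lin[OF that]])
  qed
  have d: "((\<lambda>y. \<Lambda> y (?b a)) has_derivative ?d a) (at x)" for a
    using diff by (simp add: frechet_derivative_works)
  have "((\<lambda>y. \<Sum>a\<in>UNIV. X y $ a *\<^sub>R \<Lambda> y (?b a)) has_derivative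
      (\<lambda>z. \<Sum>a\<in>UNIV. X x $ a *\<^sub>R ?d a z + X' z $ a *\<^sub>R \<Lambda> x (?b a))) (at x)"
    by (intro has_derivative_sum has_derivative_scaleR d
        bounded_linear.has_derivative[OF bounded_linear_vec_nth X])
  then have 1: "((\<lambda>y. \<Lambda> y (X y)) has_derivative
      (\<lambda>z. \<Sum>a\<in>UNIV. X x $ a *\<^sub>R ?d a z + X' z $ a *\<^sub>R \<Lambda> x (?b a))) (at x)"
    by (rule has_derivative_transform_within_open[OF _ S]) (simp add: exp[symmetric])
  have "((\<lambda>y. \<Sum>a\<in>UNIV. X x $ a *\<^sub>R \<Lambda> y (?b a)) has_derivative
      (\<lambda>z. \<Sum>a\<in>UNIV. X x $ a *\<^sub>R ?d a z)) (at x)"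
    by (intro has_derivative_sum has_derivative_scaleR_right d)
  then have "((\<lambda>y. \<Lambda> y (X x)) has_derivative (\<lambda>z. \<Sum>a\<in>UNIV. X x $ a *\<^sub>R ?d a z)) (at x)"
    by (rule has_derivative_transform_within_open[OF _ S]) (simp add: exp[symmetric])
  then have "frechet_derivative (\<lambda>y. \<Lambda> y (X x)) (at x) = (\<lambda>z. \<Sum>a\<in>UNIV. X x $ a *\<^sub>R ?d a z)"
    by (rule frechet_derivative_at[symmetric])
  then show ?thesis using 1 by (simp add: sum.distrib exp[OF S(2), of "X' _"])
qed

section \<open>Curvature in a chart\<close>

locale chart =
  fixes G :: "real^'n \<Rightarrow> real^'n^'n" and S :: "(real^'n) set"
  assumes open_S: "open S" and smooth_G: "smooth_on S G"
    and pos_def_G: "\<And>y. y \<in> S \<Longrightarrow> pos_def (G y)"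
begin

abbreviation \<Gamma> :: "real^'n \<Rightarrow> real^'n \<Rightarrow> real^'n \<Rightarrow> real^'n" where
  "\<Gamma> \<equiv> christoffel G"

lemma Ck_on_G: "Ck_on k G S"
  using smooth_G by (simp add: smooth_on_def)

lemma differentiable_G: "y \<in> S \<Longrightarrow> G differentiable (at y)"
  using Ck_on_G[of 1] by simp

lemma Ck_on_gip: "Ck_on k (\<lambda>y. gip (G y) v w) S"
  by (rule Ck_on_bounded_linear[OF open_S bounded_linear_gip Ck_on_G])

lemma koszul_eq:
  "y \<in> S \<Longrightarrow> koszul G y v w u =
     (gip (frechet_derivative G (at y) v) w u + gip (frechet_derivative G (at y) w) v u
      - gip (frechet_derivative G (at y) u) v w) / 2"
  by (simp add: koszul_def frechet_derivative_gip differentiable_G)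

lemma Ck_on_koszul: "Ck_on k (\<lambda>y. koszul G y v w u) S"
proof -
  have D: "Ck_on k (\<lambda>y. gip (frechet_derivative G (at y) a) b c) S" for a b c
    using Ck_on_G[of "Suc k"] by (intro Ck_on_bounded_linear[OF open_S bounded_linear_gip]) simp
  have "Ck_on k (\<lambda>y. (gip (frechet_derivative G (at y) v) w u + gip (frechet_derivative G (at y) w) v u
      + (-1) * gip (frechet_derivative G (at y) u) v w) * (1 / 2)) S"
    by (intro Ck_on_mult[OF open_S] Ck_on_add[OF open_S] Ck_on_const[OF open_S] D)
  then show ?thesis
    by (rule Ck_on_cong[OF open_S, rotated]) (simp add: koszul_eq)
qed

lemma invertible_G:
  assumes "y \<in> S" shows "G y ** matrix_inv (G y) = mat 1" "det (G y) \<noteq> 0"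
proof -
  have "inj ((*v) (G y))"
    unfolding matrix_left_invertible_injective[symmetric] matrix_left_invertible_ker
    using pos_def_G[OF assms] by (metis gip_def inner_zero_right less_irrefl pos_def_def)
  then have inv: "invertible (G y)"
    by (metis invertible_left_inverse matrix_left_invertible_injective)
  then show "det (G y) \<noteq> 0" by (simp add: invertible_det_nz)
  show "G y ** matrix_inv (G y) = mat 1"
    using inv unfolding invertible_def matrix_inv_def by (rule someI2_ex) simp
qed

lemma Ck_on_det:
  fixes M :: "real^'n \<Rightarrow> real^'n^'n"
  assumes "\<And>i j. Ck_on k (\<lambda>y. M y $ i $ j) S"
  shows "Ck_on k (\<lambda>y. det (M y)) S"
  unfolding det_def
  by (intro Ck_on_sum[OF open_S] Ck_on_mult[OF open_S] Ck_on_const[OF open_S] Ck_on_prod[OF open_S] assms)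

text \<open>Cramer's rule writes each component as a quotient of determinants whose entries are
  metric coefficients and Koszul terms, so smoothness needs only sums, products and one
  reciprocal.\<close>

lemma Ck_on_christoffel: "Ck_on k (\<lambda>y. \<Gamma> y v w) S"
proof (rule Ck_on_vecI[OF open_S])
  fix l
  let ?M = "\<lambda>y. \<chi> i j. if j = l then koszul G y v w (axis i 1) else G y $ i $ j"
  have G: "Ck_on k (\<lambda>y. G y $ i $ j) S" for i j
    by (rule Ck_on_bounded_linear[OF open_S bounded_linear_mat_nth Ck_on_G])
  have "Ck_on k (\<lambda>y. ?M y $ i $ j) S" for i j
    by (cases "j = l") (simp_all add: Ck_on_koszul G)
  then have "Ck_on k (\<lambda>y. det (?M y) * inverse (det (G y))) S"
    by (intro Ck_on_mult[OF open_S] Ck_on_inverse[OF open_S] Ck_on_det G invertible_G(2))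
  moreover have "det (?M y) * inverse (det (G y)) = \<Gamma> y v w $ l" if y: "y \<in> S" for y
  proof -
    let ?b = "\<chi> l. koszul G y v w (axis l 1)"
    have "G y *v \<Gamma> y v w = ?b"
      by (simp add: christoffel_def matrix_vector_mul_assoc invertible_G(1)[OF y])
    then have "\<Gamma> y v w = (\<chi> k. det(\<chi> i j. if j=k then ?b$i else G y$i$j) / det (G y))"
      using cramer[OF invertible_G(2)[OF y]] by blast
    then show ?thesis by (simp add: divide_inverse cong: if_cong)
  qed
  ultimately show "Ck_on k (\<lambda>y. \<Gamma> y v w $ l) S"
    by (rule Ck_on_cong[OF open_S, rotated])
qed

lemma christoffel_has_derivative:
  "y \<in> S \<Longrightarrow> ((\<lambda>y. \<Gamma> y v w) has_derivative frechet_derivative (\<lambda>y. \<Gamma> y v w) (at y)) (at y)"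
  using Ck_on_Suc_has_derivative[OF Ck_on_christoffel] by blast

lemma christoffel_differentiable: "y \<in> S \<Longrightarrow> (\<lambda>y. \<Gamma> y v w) differentiable (at y)"
  using christoffel_has_derivative by (blast intro: differentiableI)

lemma christoffel_sym: "y \<in> S \<Longrightarrow> \<Gamma> y v w = \<Gamma> y w v"
  by (rule christoffel_commute[OF open_S _ pos_def_G differentiable_G])

lemma gip_add_scale:
  "gip (A + B) v w = gip A v w + gip B v w" "gip (c *\<^sub>R A) v w = c * gip A v w"
  "gip A (v + v') w = gip A v w + gip A v' w" "gip A (c *\<^sub>R v) w = c * gip A v w"
  by (simp_all add: gip_def matrix_vector_mult_add_rdistrib inner_add_right inner_add_left
      scaleR_matrix_vector_assoc[symmetric])

lemma linear_christoffel_right: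
  assumes y: "y \<in> S" shows "linear (\<Gamma> y v)"
proof -
  have L: "linear (frechet_derivative G (at y))"
    by (rule linear_frechet_derivative[OF differentiable_G[OF y]])
  have K: "koszul G y v (a + b) u = koszul G y v a u + koszul G y v b u"
    "koszul G y v (c *\<^sub>R a) u = c * koszul G y v a u" for a b c u
    by (simp_all add: koszul_eq[OF y] linear_add[OF L] linear_scale[OF L] gip_add_scale
        linear_add[OF linear_gip_right] linear_scale[OF linear_gip_right] field_simps)
  show ?thesis
  proof (rule linearI)
    fix a b c
    have "(\<chi> l. koszul G y v (a + b) (axis l 1)) =
        (\<chi> l. koszul G y v a (axis l 1)) + (\<chi> l. koszul G y v b (axis l 1))"
      by (simp add: vec_eq_iff K)
    then show "\<Gamma> y v (a + b) = \<Gamma> y v a + \<Gamma> y v b"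
      by (simp add: christoffel_def matrix_vector_right_distrib)
    have "(\<chi> l. koszul G y v (c *\<^sub>R a) (axis l 1)) = c *\<^sub>R (\<chi> l. koszul G y v a (axis l 1))"
      by (simp add: vec_eq_iff K)
    then show "\<Gamma> y v (c *\<^sub>R a) = c *\<^sub>R \<Gamma> y v a"
      by (simp add: christoffel_def matrix_vector_mult_scaleR)
  qed
qed

lemma linear_christoffel_left: "y \<in> S \<Longrightarrow> linear (\<lambda>v. \<Gamma> y v w)"
  using linear_christoffel_right[of y w] by (simp add: christoffel_sym[of y _ w])

text \<open>Metric compatibility for a moving first vector: the two terms contain the covariant
  derivatives of X and of the constant field b.\<close>

lemma gip_has_derivative:
  assumes y: "y \<in> S" and X: "(X has_derivative X') (at y)"
  shows "((\<lambda>y. gip (G y) (X y) b) has_derivative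
    (\<lambda>z. gip (G y) (X' z + \<Gamma> y z (X y)) b + gip (G y) (X y) (\<Gamma> y z b))) (at y)"
proof -
  have d: "(\<lambda>y. gip (G y) w b) differentiable (at y)" for w
    using Ck_on_gip[of 1 w b] y by simp
  have "((\<lambda>y. gip (G y) (X y) b) has_derivative
    (\<lambda>z. frechet_derivative (\<lambda>x. gip (G x) (X y) b) (at y) z + gip (G y) (X' z) b)) (at y)"
    by (rule linear_family_has_derivative[OF open_S y linear_gip_left d X])
  then show ?thesis
    by (simp add: christoffel_metric[OF open_S y pos_def_G differentiable_G[OF y]] gip_add_scale add_ac)
qed

section \<open>The curvature tensor and its algebraic symmetries\<close>

definition d\<Gamma> :: "real^'n \<Rightarrow> real^'n \<Rightarrow> real^'n \<Rightarrow> real^'n \<Rightarrow> real^'n" where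
  "d\<Gamma> y u v w = frechet_derivative (\<lambda>y. \<Gamma> y v w) (at y) u"

lemma curvature_op_eq:
  "curvature_op G y u v w =
    d\<Gamma> y u v w - d\<Gamma> y v u w + \<Gamma> y u (\<Gamma> y v w) - \<Gamma> y v (\<Gamma> y u w)"
proof -
  have "nabla_vector G v (\<lambda>_. w) = (\<lambda>y. \<Gamma> y v w)" for v
    by (simp add: nabla_vector_def[abs_def] frechet_derivative_const)
  then show ?thesis by (simp add: curvature_op_def nabla_vector_def d\<Gamma>_def)
qed

lemma curvature_op_anti: "curvature_op G y u v w = - curvature_op G y v u w"
  by (simp add: curvature_op_eq)

lemma d\<Gamma>_sym: "y \<in> S \<Longrightarrow> d\<Gamma> y u v w = d\<Gamma> y u w v"
  unfolding d\<Gamma>_def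
  by (subst frechet_derivative_transform_within_open[OF christoffel_differentiable open_S _ christoffel_sym])
    auto

lemma curvature_op_bianchi:
  "y \<in> S \<Longrightarrow> curvature_op G y u v w + curvature_op G y v w u + curvature_op G y w u v = 0"
  using d\<Gamma>_sym[of y u v w] d\<Gamma>_sym[of y v w u] d\<Gamma>_sym[of y w u v]
    christoffel_sym[of y u v] christoffel_sym[of y v w] christoffel_sym[of y w u]
  by (simp add: curvature_op_eq)

text \<open>Second derivatives of the function g(a,b) commute. Expanding them by metric
  compatibility, the products of two first covariant derivatives cancel and the curvature terms
  remain.\<close>

lemma curvature_op_skew:
  assumes y: "y \<in> S"
  shows "gip (G y) (curvature_op G y u v a) b = - gip (G y) (curvature_op G y u v b) a"
proof -
  let ?P = "\<lambda>y. gip (G y) a b"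
  have 1: "frechet_derivative ?P (at x) v = gip (G x) (\<Gamma> x v a) b + gip (G x) (\<Gamma> x v b) a" if "x \<in> S" for v x
    using christoffel_metric[OF open_S that pos_def_G differentiable_G[OF that]]
      gip_commute[OF pos_def_G[OF that]] by simp
  have 2: "frechet_derivative (\<lambda>x. frechet_derivative ?P (at x) v) (at y) u =
    gip (G y) (d\<Gamma> y u v a + \<Gamma> y u (\<Gamma> y v a)) b + gip (G y) (\<Gamma> y v a) (\<Gamma> y u b) +
    (gip (G y) (d\<Gamma> y u v b + \<Gamma> y u (\<Gamma> y v b)) a + gip (G y) (\<Gamma> y v b) (\<Gamma> y u a))" for u v
  proof -
    have "((\<lambda>x. gip (G x) (\<Gamma> x v a) b + gip (G x) (\<Gamma> x v b) a) has_derivative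
      (\<lambda>u. gip (G y) (d\<Gamma> y u v a + \<Gamma> y u (\<Gamma> y v a)) b + gip (G y) (\<Gamma> y v a) (\<Gamma> y u b) +
    (gip (G y) (d\<Gamma> y u v b + \<Gamma> y u (\<Gamma> y v b)) a + gip (G y) (\<Gamma> y v b) (\<Gamma> y u a)))) (at y)"
      unfolding d\<Gamma>_def
      by (intro has_derivative_add gip_has_derivative[OF y] christoffel_has_derivative[OF y])
    then have "((\<lambda>x. frechet_derivative ?P (at x) v) has_derivative
      (\<lambda>u. gip (G y) (d\<Gamma> y u v a + \<Gamma> y u (\<Gamma> y v a)) b + gip (G y) (\<Gamma> y v a) (\<Gamma> y u b) +
    (gip (G y) (d\<Gamma> y u v b + \<Gamma> y u (\<Gamma> y v b)) a + gip (G y) (\<Gamma> y v b) (\<Gamma> y u a)))) (at y)"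
      by (rule has_derivative_transform_within_open[OF _ open_S y]) (simp add: 1)
    from fun_cong[OF frechet_derivative_at[OF this], of u] show ?thesis by (rule sym)
  qed
  have "frechet_derivative (\<lambda>x. frechet_derivative ?P (at x) v) (at y) u =
    frechet_derivative (\<lambda>x. frechet_derivative ?P (at x) u) (at y) v"
    by (rule Ck_on_2_symmetric_real[OF Ck_on_gip open_S y])
  then have "gip (G y) (curvature_op G y u v a) b + gip (G y) (curvature_op G y u v b) a = 0"
    unfolding 2 curvature_op_eq
    using gip_commute[OF pos_def_G[OF y], of "\<Gamma> y v a" "\<Gamma> y u b"]
      gip_commute[OF pos_def_G[OF y], of "\<Gamma> y v b" "\<Gamma> y u a"]
    by (simp add: gip_add_scale linear_diff[OF linear_gip_left])
  then show ?thesis by linarith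
qed

lemma curvature_form_pair:
  "curvature_form G y [u, v] [a, b] = gip (G y) (curvature_op G y u v b) a"
  by (simp add: curvature_form_def)

lemma curvature_form_degree:
  "length xs \<noteq> 2 \<or> length ys \<noteq> 2 \<Longrightarrow> curvature_form G y xs ys = 0"
  by (auto simp: curvature_form_def split: list.splits)

text \<open>Pair symmetry is the classical linear consequence of skewness in each pair and the first
  Bianchi identity. The instances listed below are the ones that enter this elimination.\<close>

lemma flip_curvature_form:
  assumes y: "y \<in> S" shows "flip (curvature_form G y) = curvature_form G y"
proof -
  let ?K = "\<lambda>u v a b. gip (G y) (curvature_op G y u v b) a"
  have s1: "?K u v a b = - ?K v u a b" for u v a b
    by (subst curvature_op_anti) (simp add: linear_neg[OF linear_gip_left])
  have s2: "?K u v a b = - ?K u v b a" for u v a b by (rule curvature_op_skew[OF y])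
  have B: "?K u v a b + ?K v b a u + ?K b u a v = 0" for u v a b
    using arg_cong[OF curvature_op_bianchi[OF y, of u v b], of "\<lambda>w. gip (G y) w a"]
    by (simp add: gip_add_scale linear_0[OF linear_gip_left])
  have "?K u v a b = ?K a b u v" for u v a b
    using B[of u v a b] B[of v a u b] B[of a b v u] B[of b u v a]
      B[of u v b a] B[of v a b u] B[of a b u v] B[of b u a v]
      s1[of u v a b] s1[of v b a u] s1[of b u a v] s1[of v a u b] s1[of a b u v] s1[of b v u a]
      s1[of a u v b] s1[of u b v a] s1[of a v u b] s1[of u a b v] s1[of b a v u]
      s2[of u v a b] s2[of v b a u] s2[of b u a v] s2[of v a u b] s2[of a b u v] s2[of b v u a]
      s2[of a u v b] s2[of u b v a] s2[of a v u b] s2[of u a b v] s2[of b a v u]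
      s1[of v a b u] s1[of a u b v] s2[of v a b u] s2[of a u b v]
    by linarith
  then have "curvature_form G y [a, b] [u, v] = curvature_form G y [u, v] [a, b]" for a b u v
    by (simp add: curvature_form_pair)
  then have "curvature_form G y ys xs = curvature_form G y xs ys" for xs ys
    using curvature_form_degree[of xs ys y] curvature_form_degree[of ys xs y]
    by (cases "length xs = 2 \<and> length ys = 2") (auto simp: length_Suc_conv numeral_2_eq_2)
  then show ?thesis unfolding flip_def fun_eq_iff by blast
qed

lemma linear_d\<Gamma>:
  assumes y: "y \<in> S"
  shows "linear (\<lambda>u. d\<Gamma> y u v w)" "linear (\<lambda>v. d\<Gamma> y u v w)"
proof -
  show "linear (\<lambda>u. d\<Gamma> y u v w)"
    unfolding d\<Gamma>_def by (rule linear_frechet_derivative[OF christoffel_differentiable[OF y]])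
  show "linear (\<lambda>v. d\<Gamma> y u v w)"
  proof (rule linearI)
    fix a b and c :: real
    have "((\<lambda>y. \<Gamma> y (a + b) w) has_derivative (\<lambda>z. d\<Gamma> y z a w + d\<Gamma> y z b w)) (at y)"
      unfolding d\<Gamma>_def
      by (rule has_derivative_transform_within_open[OF has_derivative_add[OF
            christoffel_has_derivative[OF y] christoffel_has_derivative[OF y]] open_S y])
        (simp add: linear_add[OF linear_christoffel_left])
    from fun_cong[OF frechet_derivative_at[OF this], of u]
    show "d\<Gamma> y u (a + b) w = d\<Gamma> y u a w + d\<Gamma> y u b w" by (simp add: d\<Gamma>_def)
    have "((\<lambda>y. \<Gamma> y (c *\<^sub>R a) w) has_derivative (\<lambda>z. c *\<^sub>R d\<Gamma> y z a w)) (at y)"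
      unfolding d\<Gamma>_def
      by (rule has_derivative_transform_within_open[OF has_derivative_scaleR_right[OF
            christoffel_has_derivative[OF y]] open_S y])
        (simp add: linear_scale[OF linear_christoffel_left])
    from fun_cong[OF frechet_derivative_at[OF this], of u]
    show "d\<Gamma> y u (c *\<^sub>R a) w = c *\<^sub>R d\<Gamma> y u a w" by (simp add: d\<Gamma>_def)
  qed
qed

lemma linear_curvature_op_left:
  assumes y: "y \<in> S" shows "linear (\<lambda>u. curvature_op G y u v w)"
proof -
  have c: "linear (\<lambda>u. \<Gamma> y v (\<Gamma> y u w))"
    using linear_compose[OF linear_christoffel_left[OF y, of w] linear_christoffel_right[OF y, of v]]
    by (simp add: o_def)
  show ?thesis unfolding curvature_op_eq
    by (intro linear_compose_add linear_compose_sub linear_d\<Gamma>[OF y] linear_christoffel_left[OF y] c)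
qed

lemma is_dform_curvature_form:
  assumes y: "y \<in> S" shows "is_dform 2 2 (curvature_form G y)"
proof -
  let ?R = "curvature_form G y"
  have deg: "length xs = 2 \<and> length ys = 2" if "?R xs ys \<noteq> 0" for xs ys
    using that curvature_form_degree by blast
  have alt: "alt1 ?R"
  proof (rule alt1I)
    fix us vs ys :: "(real^'n) list" and a b
    show "?R (us @ a # b # vs) ys = - ?R (us @ b # a # vs) ys"
    proof (cases "us = [] \<and> vs = [] \<and> length ys = 2")
      case True
      then show ?thesis using curvature_op_anti[of y a b]
        by (auto simp: length_Suc_conv numeral_2_eq_2 curvature_form_pair linear_neg[OF linear_gip_left])
    next
      case False
      then have "?R (us @ c # d # vs) ys = 0" for c d
        using deg[of "us @ c # d # vs" ys] by auto
      then show ?thesis by simp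
    qed
  qed
  have lin: "lin1 ?R"
    unfolding lin1_def multilinear_def
  proof (intro allI)
    fix ys us vs :: "(real^'n) list"
    show "linear (\<lambda>x. ?R (us @ x # vs) ys)"
    proof (cases "length us + length vs = 1 \<and> length ys = 2")
      case False
      then have "?R (us @ x # vs) ys = 0" for x using deg[of "us @ x # vs" ys] by auto
      then show ?thesis by simp
    next
      case True
      then obtain a b where ys: "ys = [a, b]" by (auto simp: length_Suc_conv numeral_2_eq_2)
      have g: "linear (\<lambda>x. gip (G y) (curvature_op G y x v b) a)" for v
        using linear_compose[OF linear_curvature_op_left[OF y] linear_gip_left] by (simp add: o_def)
      from True consider v where "us = []" "vs = [v]" | v where "us = [v]" "vs = []"
        by (cases us; cases vs) auto
      then show ?thesis
      proof cases
        case 1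
        then show ?thesis using g by (simp add: ys curvature_form_pair)
      next
        case 2
        have "gip (G y) (curvature_op G y v x b) a = - gip (G y) (curvature_op G y x v b) a" for x
          by (subst curvature_op_anti) (simp add: linear_neg[OF linear_gip_left])
        then show ?thesis using 2 linear_compose_neg[OF g] by (simp add: ys curvature_form_pair)
      qed
    qed
  qed
  show ?thesis
    by (rule is_dformI) (use deg alt lin flip_curvature_form[OF y] in auto)
qed

end

section \<open>Covariant derivatives at a point\<close>

text \<open>The prefix \<open>us\<close> holds arguments that are frozen. Releasing the moving
  arguments one by one gives one product-rule term for each.\<close>

lemma multilinear_family_has_derivative:
  fixes \<phi> :: "'a::real_normed_vector \<Rightarrow> (real^'n) form"
  assumes S: "open S" "x \<in> S" and ml: "\<And>y. y \<in> S \<Longrightarrow> multilinear (\<phi> y)"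
    and diff: "\<And>xs. (\<lambda>y. \<phi> y xs) differentiable (at x)"
    and hs: "\<And>h. h \<in> set hs \<Longrightarrow> (h has_derivative h' h) (at x)"
  shows "((\<lambda>y. \<phi> y (us @ map (\<lambda>h. h y) hs)) has_derivative
    (\<lambda>z. frechet_derivative (\<lambda>y. \<phi> y (us @ map (\<lambda>h. h x) hs)) (at x) z +
      (\<Sum>i<length hs. \<phi> x (us @ (map (\<lambda>h. h x) hs)[i := h' (hs ! i) z])))) (at x)"
  using hs
proof (induction hs arbitrary: us)
  case Nil
  then show ?case using diff[of us] by (simp add: frechet_derivative_works)
next
  case (Cons h hs)
  let ?\<Lambda> = "\<lambda>y w. \<phi> y ((us @ [w]) @ map (\<lambda>h. h y) hs)"
  have IH: "((\<lambda>y. ?\<Lambda> y w) has_derivative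
    (\<lambda>z. frechet_derivative (\<lambda>y. \<phi> y ((us @ [w]) @ map (\<lambda>h. h x) hs)) (at x) z +
      (\<Sum>i<length hs. \<phi> x ((us @ [w]) @ (map (\<lambda>h. h x) hs)[i := h' (hs ! i) z])))) (at x)" for w
    by (rule Cons.IH) (simp add: Cons.prems)
  have "((\<lambda>y. ?\<Lambda> y (h y)) has_derivative
    (\<lambda>z. frechet_derivative (\<lambda>y. ?\<Lambda> y (h x)) (at x) z + ?\<Lambda> x (h' h z))) (at x)"
  proof (rule linear_family_has_derivative[OF S])
    show "linear (?\<Lambda> y)" if "y \<in> S" for y
      using multilinear_linear[OF ml[OF that], of us "map (\<lambda>h. h y) hs"] by simp
    show "(\<lambda>y. ?\<Lambda> y w) differentiable at x" for w
      using IH by (rule differentiableI)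
    show "(h has_derivative h' h) (at x)" by (simp add: Cons.prems)
  qed
  moreover have "frechet_derivative (\<lambda>y. ?\<Lambda> y (h x)) (at x) z =
     frechet_derivative (\<lambda>y. \<phi> y ((us @ [h x]) @ map (\<lambda>h. h x) hs)) (at x) z +
      (\<Sum>i<length hs. \<phi> x ((us @ [h x]) @ (map (\<lambda>h. h x) hs)[i := h' (hs ! i) z]))" for z
    using fun_cong[OF frechet_derivative_at[OF IH], of "h x" z] by (rule sym)
  ultimately show ?case
    by (simp add: sum.lessThan_Suc_shift add_ac del: sum.lessThan_Suc)
qed

locale chart_point = chart G S for G :: "real^'n \<Rightarrow> real^'n^'n" and S +
  fixes x :: "real^'n"
  assumes x: "x \<in> S"
begin

text \<open>Weak enough to be inherited by products and flips, strong enough for the chain rule in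
  moving arguments.\<close>

definition regular :: "(real^'n \<Rightarrow> (real^'n) dform) \<Rightarrow> bool" where
  "regular \<omega> \<longleftrightarrow> (\<forall>y\<in>S. lin1 (\<omega> y) \<and> lin1 (flip (\<omega> y))) \<and>
     (\<forall>xs ys. (\<lambda>y. \<omega> y xs ys) differentiable (at x))"

abbreviation nabla :: "(real^'n \<Rightarrow> (real^'n) dform) \<Rightarrow> real^'n \<Rightarrow> (real^'n) dform" where
  "nabla \<omega> z \<equiv> nabla_dform G z \<omega> x"

text \<open>The covariant derivative is the plain derivative along arguments that are parallel to first
  order.\<close>

lemma nabla_has_derivative:
  assumes reg: "regular \<omega>"
    and hs: "\<And>h. h \<in> set hs \<Longrightarrow> (h has_derivative (\<lambda>z. - \<Gamma> x z (h x))) (at x)"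
    and ks: "\<And>h. h \<in> set ks \<Longrightarrow> (h has_derivative (\<lambda>z. - \<Gamma> x z (h x))) (at x)"
  shows "((\<lambda>y. \<omega> y (map (\<lambda>h. h y) hs) (map (\<lambda>h. h y) ks)) has_derivative
    (\<lambda>z. nabla \<omega> z (map (\<lambda>h. h x) hs) (map (\<lambda>h. h x) ks))) (at x)"
proof -
  let ?xs = "map (\<lambda>h. h x) hs" and ?ys = "map (\<lambda>h. h x) ks"
  have ml1: "multilinear (\<lambda>xs. \<omega> y xs ys)" if "y \<in> S" for y ys
    using reg that by (simp add: regular_def lin1_def)
  have ml2: "multilinear (\<omega> y xs)" if "y \<in> S" for y xs
    using reg that by (simp add: regular_def lin1_def flip_def)
  have diff: "(\<lambda>y. \<omega> y xs ys) differentiable (at x)" for xs ys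
    using reg by (simp add: regular_def)
  have D2: "((\<lambda>y. \<omega> y xs (map (\<lambda>h. h y) ks)) has_derivative
    (\<lambda>z. frechet_derivative (\<lambda>y. \<omega> y xs ?ys) (at x) z +
      (\<Sum>i<length ks. \<omega> x xs (?ys[i := - \<Gamma> x z ((ks ! i) x)])))) (at x)" for xs
    using multilinear_family_has_derivative[where \<phi> = "\<lambda>y. \<omega> y xs" and us = "[]",
      OF open_S x ml2 diff ks] by simp
  have D1: "((\<lambda>y. \<omega> y (map (\<lambda>h. h y) hs) (map (\<lambda>h. h y) ks)) has_derivative
    (\<lambda>z. frechet_derivative (\<lambda>y. \<omega> y ?xs (map (\<lambda>h. h y) ks)) (at x) z +
      (\<Sum>i<length hs. \<omega> x (?xs[i := - \<Gamma> x z ((hs ! i) x)]) ?ys))) (at x)"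
    using multilinear_family_has_derivative[where \<phi> = "\<lambda>y xs. \<omega> y xs (map (\<lambda>h. h y) ks)" and us = "[]",
      OF open_S x ml1 differentiableI[OF D2] hs] by simp
  \<comment> \<open>The derivatives of the arguments are minus Christoffel terms; pulling out the
    minus signs yields exactly the corrections in \<open>nabla_dform\<close>.\<close>
  have neg: "\<phi> (zs[i := - v]) = - \<phi> (zs[i := v])" if "multilinear \<phi>" "i < length zs" for \<phi> zs i and v :: "real^'n"
    using linear_neg[OF multilinear_linear[OF that(1), of "take i zs" "drop (Suc i) zs"]] that(2)
    by (simp add: upd_conv_take_nth_drop)
  have "frechet_derivative (\<lambda>y. \<omega> y ?xs (map (\<lambda>h. h y) ks)) (at x) z +
      (\<Sum>i<length hs. \<omega> x (?xs[i := - \<Gamma> x z ((hs ! i) x)]) ?ys) = nabla \<omega> z ?xs ?ys" for z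
  proof -
    have "(\<Sum>i<length hs. \<omega> x (?xs[i := - \<Gamma> x z ((hs ! i) x)]) ?ys) =
        - (\<Sum>i<length hs. \<omega> x (?xs[i := \<Gamma> x z (?xs ! i)]) ?ys)"
      unfolding sum_negf[symmetric] using neg[OF ml1[OF x], of _ ?xs] by (intro sum.cong) auto
    moreover have "(\<Sum>i<length ks. \<omega> x ?xs (?ys[i := - \<Gamma> x z ((ks ! i) x)])) =
        - (\<Sum>i<length ks. \<omega> x ?xs (?ys[i := \<Gamma> x z (?ys ! i)]))"
      unfolding sum_negf[symmetric] using neg[OF ml2[OF x], of _ ?ys] by (intro sum.cong) auto
    ultimately show ?thesis
      using fun_cong[OF frechet_derivative_at[OF D2[of ?xs]], of z] by (simp add: nabla_dform_def)
  qed
  then show ?thesis using D1 by simp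
qed

text \<open>The field, affine in the coordinates, with value u at x and vanishing covariant
  derivative there.\<close>

definition pfield :: "real^'n \<Rightarrow> real^'n \<Rightarrow> real^'n" where
  "pfield u y = u - \<Gamma> x (y - x) u"

lemma pfield_x [simp]: "pfield u x = u"
  by (simp add: pfield_def linear_0[OF linear_christoffel_left[OF x]])

lemma pfield_has_derivative: "(pfield u has_derivative (\<lambda>z. - \<Gamma> x z u)) (at x)"
proof -
  have "bounded_linear (\<lambda>z. \<Gamma> x z u)"
    using linear_christoffel_left[OF x] by (simp add: linear_conv_bounded_linear)
  then have "((\<lambda>y. \<Gamma> x (y - x) u) has_derivative (\<lambda>z. \<Gamma> x z u)) (at x)"
    by (rule bounded_linear.has_derivative) (auto intro!: derivative_eq_intros)
  from has_derivative_diff[OF has_derivative_const this]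
  show ?thesis by (simp add: pfield_def[abs_def])
qed

lemma linear_pfield: "linear (\<lambda>u. pfield u y)"
  unfolding pfield_def by (intro linear_compose_sub linear_id[unfolded id_def] linear_christoffel_right[OF x])

text \<open>The double form read in fields parallel to first order at x. Its ordinary derivative at
  x is the covariant derivative, and it commutes with the pointwise algebra, so identities near x
  can simply be differentiated.\<close>

definition pull :: "(real^'n \<Rightarrow> (real^'n) dform) \<Rightarrow> real^'n \<Rightarrow> (real^'n) dform" where
  "pull \<omega> y = (\<lambda>xs ys. \<omega> y (map (\<lambda>u. pfield u y) xs) (map (\<lambda>u. pfield u y) ys))"

lemma pull_x: "pull \<omega> x = \<omega> x"
  by (simp add: pull_def)

lemma pull_has_derivative:
  assumes "regular \<omega>"
  shows "((\<lambda>y. pull \<omega> y xs ys) has_derivative (\<lambda>z. nabla \<omega> z xs ys)) (at x)"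
proof -
  have h: "(h has_derivative (\<lambda>z. - \<Gamma> x z (h x))) (at x)" if "h \<in> set (map pfield zs)" for h zs
    using that pfield_has_derivative by auto
  from nabla_has_derivative[where hs = "map pfield xs" and ks = "map pfield ys", OF assms h h]
  show ?thesis
    by (simp add: pull_def o_def)
qed

lemma nabla_eqI:
  assumes "regular \<omega>" and "((\<lambda>y. pull \<omega> y xs ys) has_derivative D) (at x)"
  shows "nabla \<omega> z xs ys = D z"
  using has_derivative_unique[OF pull_has_derivative[OF assms(1)] assms(2)] by metis

lemma linear_nabla: "regular \<omega> \<Longrightarrow> linear (\<lambda>z. nabla \<omega> z xs ys)"
  using pull_has_derivative has_derivative_linear by blast

section \<open>Rules for the covariant derivative\<close>

lemma regular_mult:
  assumes "regular \<omega>" "regular \<theta>"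
  shows "regular (\<lambda>y. \<omega> y \<odot> \<theta> y)"
proof -
  have "(\<lambda>y. (\<omega> y \<odot> \<theta> y) xs ys) differentiable (at x)" for xs ys
    using assms unfolding dform_mult_def regular_def
    by (intro differentiable_sum differentiable_mult differentiable_const) auto
  then show ?thesis using assms by (simp add: regular_def lin1_mult flip_mult)
qed

text \<open>\<open>pull\<close> is multiplicative, so this is the ordinary product rule applied to
  each summand of the shuffle sum.\<close>

lemma nabla_mult:
  assumes "regular \<omega>" "regular \<theta>"
  shows "nabla (\<lambda>y. \<omega> y \<odot> \<theta> y) z = nabla \<omega> z \<odot> \<theta> x + \<omega> x \<odot> nabla \<theta> z"
proof (intro ext)
  fix xs ys
  have "pull (\<lambda>y. \<omega> y \<odot> \<theta> y) y xs ys = (pull \<omega> y \<odot> pull \<theta> y) xs ys" for y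
    by (simp add: pull_def dform_mult_def nths_map)
  moreover have "((\<lambda>y. (pull \<omega> y \<odot> pull \<theta> y) xs ys) has_derivative
      (\<lambda>z. (\<omega> x \<odot> nabla \<theta> z) xs ys + (nabla \<omega> z \<odot> \<theta> x) xs ys)) (at x)"
  proof -
    let ?c = "\<lambda>S T. shuffle_sign (length xs) S * shuffle_sign (length ys) T"
    have "((\<lambda>y. \<Sum>S\<in>Pow {..<length xs}. \<Sum>T\<in>Pow {..<length ys}. ?c S T *
        (pull \<omega> y (nths xs S) (nths ys T) * pull \<theta> y (nths xs (- S)) (nths ys (- T)))) has_derivative
      (\<lambda>z. \<Sum>S\<in>Pow {..<length xs}. \<Sum>T\<in>Pow {..<length ys}. ?c S T *
        (pull \<omega> x (nths xs S) (nths ys T) * nabla \<theta> z (nths xs (- S)) (nths ys (- T)) +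
         nabla \<omega> z (nths xs S) (nths ys T) * pull \<theta> x (nths xs (- S)) (nths ys (- T))))) (at x)"
      by (intro has_derivative_sum has_derivative_mult_right has_derivative_mult
          pull_has_derivative assms)
    then show ?thesis
      by (simp add: dform_mult_def pull_x distrib_left sum.distrib mult.assoc)
  qed
  ultimately show "nabla (\<lambda>y. \<omega> y \<odot> \<theta> y) z xs ys = (nabla \<omega> z \<odot> \<theta> x + \<omega> x \<odot> nabla \<theta> z) xs ys"
    using nabla_eqI[OF regular_mult[OF assms], of xs ys
        "\<lambda>z. (\<omega> x \<odot> nabla \<theta> z) xs ys + (nabla \<omega> z \<odot> \<theta> x) xs ys" z] by (simp add: add.commute)
qed

lemma has_derivative_zero_near:
  assumes "\<And>y. y \<in> S \<Longrightarrow> f y = 0"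
  shows "(f has_derivative (\<lambda>z. 0)) (at x)"
  by (rule has_derivative_transform_within_open[OF has_derivative_const open_S x]) (simp add: assms)

lemma flip_nabla: "flip (nabla \<omega> z) = nabla (\<lambda>y. flip (\<omega> y)) z"
  by (intro ext) (simp add: flip_def nabla_dform_def)

lemma regular_flip: "regular \<omega> \<Longrightarrow> regular (\<lambda>y. flip (\<omega> y))"
  unfolding regular_def flip_flip by (auto simp: flip_def)

text \<open>Alternation holds for \<open>pull\<close> at every point of S, and differentiating that
  identity gives it for the covariant derivative.\<close>

lemma alt1_nabla:
  assumes reg: "regular \<omega>" and alt: "\<And>y. y \<in> S \<Longrightarrow> alt1 (\<omega> y)"
  shows "alt1 (nabla \<omega> z)"
proof (rule alt1I)
  fix us u v vs ys
  have "((\<lambda>y. pull \<omega> y (us @ u # v # vs) ys) has_derivative (\<lambda>z. - nabla \<omega> z (us @ v # u # vs) ys)) (at x)"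
  proof (rule has_derivative_transform_within_open[OF has_derivative_minus[OF pull_has_derivative[OF reg]] open_S x])
    fix y assume "y \<in> S"
    from alt1D[OF alt[OF this]]
    show "- pull \<omega> y (us @ v # u # vs) ys = pull \<omega> y (us @ u # v # vs) ys"
      unfolding pull_def map_append list.map by (rule sym)
  qed
  from nabla_eqI[OF reg this] show "nabla \<omega> z (us @ u # v # vs) ys = - nabla \<omega> z (us @ v # u # vs) ys" .
qed

lemma lin1_nabla:
  assumes reg: "regular \<omega>"
  shows "lin1 (nabla \<omega> z)"
  unfolding lin1_def multilinear_def
proof (intro allI)
  fix ys us vs
  have lin: "linear (\<lambda>v. pull \<omega> y (us @ v # vs) ys)" if "y \<in> S" for y
  proof -
    have "lin1 (\<omega> y)" using reg that by (simp add: regular_def)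
    from linear_compose[OF linear_pfield lin1D[OF this]]
    show ?thesis by (simp add: pull_def o_def)
  qed
  show "linear (\<lambda>v. nabla \<omega> z (us @ v # vs) ys)"
  proof (rule linearI)
    fix a b and c :: real
    have "((\<lambda>y. pull \<omega> y (us @ (a + b) # vs) ys) has_derivative
        (\<lambda>z. nabla \<omega> z (us @ a # vs) ys + nabla \<omega> z (us @ b # vs) ys)) (at x)"
      by (rule has_derivative_transform_within_open[OF has_derivative_add[OF pull_has_derivative[OF reg]
            pull_has_derivative[OF reg]] open_S x]) (simp add: linear_add[OF lin])
    from nabla_eqI[OF reg this]
    show "nabla \<omega> z (us @ (a + b) # vs) ys = nabla \<omega> z (us @ a # vs) ys + nabla \<omega> z (us @ b # vs) ys" .
    have "((\<lambda>y. pull \<omega> y (us @ (c *\<^sub>R a) # vs) ys) has_derivative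
        (\<lambda>z. c *\<^sub>R nabla \<omega> z (us @ a # vs) ys)) (at x)"
      by (rule has_derivative_transform_within_open[OF has_derivative_scaleR_right[OF pull_has_derivative[OF reg]]
            open_S x]) (simp add: linear_scale[OF lin])
    from nabla_eqI[OF reg this]
    show "nabla \<omega> z (us @ (c *\<^sub>R a) # vs) ys = c *\<^sub>R nabla \<omega> z (us @ a # vs) ys" .
  qed
qed

lemma is_dform_nabla:
  assumes reg: "regular \<omega>" and \<omega>: "\<And>y. y \<in> S \<Longrightarrow> is_dform p q (\<omega> y)"
  shows "is_dform p q (nabla \<omega> z)"
proof (rule is_dformI)
  show "length xs = p \<and> length ys = q" if nz: "nabla \<omega> z xs ys \<noteq> 0" for xs ys
  proof (rule ccontr)
    assume "\<not> (length xs = p \<and> length ys = q)"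
    then have "pull \<omega> y xs ys = 0" if "y \<in> S" for y
      unfolding pull_def by (intro is_dform_degree[OF \<omega>[OF that]]) auto
    from nabla_eqI[OF reg has_derivative_zero_near[OF this], of z] nz show False by simp
  qed
  show "alt1 (nabla \<omega> z)" by (rule alt1_nabla[OF reg is_dformD(1)[OF \<omega>]])
  show "alt1 (flip (nabla \<omega> z))"
    unfolding flip_nabla by (rule alt1_nabla[OF regular_flip[OF reg] is_dformD(2)[OF \<omega>]])
  show "lin1 (nabla \<omega> z)" by (rule lin1_nabla[OF reg])
  show "lin1 (flip (nabla \<omega> z))" unfolding flip_nabla by (rule lin1_nabla[OF regular_flip[OF reg]])
qed

lemma regularI:
  assumes "\<And>y. y \<in> S \<Longrightarrow> is_dform p q (\<omega> y)" and "\<And>xs ys. (\<lambda>y. \<omega> y xs ys) differentiable (at x)"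
  shows "regular \<omega>"
  unfolding regular_def using assms is_dformD by blast

lemma regular_one: "regular (\<lambda>y. dform_one)"
  by (rule regularI[OF is_dform_one differentiable_const])

lemma regular_metric: "regular (\<lambda>y. metric_form (G y))"
proof (rule regularI[OF is_dform_metric_form])
  fix xs ys
  show "(\<lambda>y. metric_form (G y) xs ys) differentiable at x"
  proof (cases "length xs = 1 \<and> length ys = 1")
    case True
    then obtain u v where "xs = [u]" "ys = [v]" by (auto simp: length_Suc_conv)
    then show ?thesis using Ck_on_gip[of 1 u v] x by simp
  next
    case False
    then have "metric_form (G y) xs ys = 0" for y
      using is_dform_degree[OF is_dform_metric_form] by blast
    then show ?thesis by simp
  qed
qed

lemma nabla_metric: "nabla (\<lambda>y. metric_form (G y)) z = 0"
proof (intro ext)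
  fix xs ys
  have "nabla (\<lambda>y. metric_form (G y)) z [u] [v] = 0" for u v
    using christoffel_metric[OF open_S x pos_def_G differentiable_G[OF x], of u v z]
    by (simp add: nabla_dform_def)
  moreover have "nabla (\<lambda>y. metric_form (G y)) z xs ys = 0" if "length xs \<noteq> 1 \<or> length ys \<noteq> 1"
    by (rule is_dform_degree[OF is_dform_nabla[OF regular_metric is_dform_metric_form] that])
  ultimately show "nabla (\<lambda>y. metric_form (G y)) z xs ys = 0 xs ys"
    by (cases "length xs = 1 \<and> length ys = 1") (auto simp: length_Suc_conv)
qed

lemma regular_dpow: "regular \<omega> \<Longrightarrow> regular (\<lambda>y. dpow (\<omega> y) k)"
proof (induction k)
  case 0
  show ?case
    using regular_one by (simp add: dform_one_def)
next
  case (Suc k)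
  then show ?case by (simp add: regular_mult)
qed

lemma nabla_one: "nabla (\<lambda>y. dform_one) z = 0"
proof (intro ext)
  fix xs ys
  have "pull (\<lambda>y. dform_one) y xs ys = dform_one xs ys" for y
    by (simp add: pull_def dform_one_def form_tensor_def form_one_def)
  then show "nabla (\<lambda>y. dform_one) z xs ys = 0 xs ys"
    using nabla_eqI[OF regular_one, of xs ys "\<lambda>z. 0" z] by simp
qed

lemma nabla_dpow_Suc:
  assumes "regular \<omega>"
  shows "nabla (\<lambda>y. dpow (\<omega> y) (Suc k)) z =
    nabla \<omega> z \<odot> dpow (\<omega> x) k + \<omega> x \<odot> nabla (\<lambda>y. dpow (\<omega> y) k) z"
  using nabla_mult[OF assms regular_dpow[OF assms]] by simp

lemma nabla_dpow_metric: "nabla (\<lambda>y. dpow (metric_form (G y)) k) z = 0"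
proof (induction k)
  case 0
  then show ?case using nabla_one by (simp add: dform_one_def)
next
  case (Suc k)
  then show ?case unfolding nabla_dpow_Suc[OF regular_metric] nabla_metric by simp
qed

text \<open>By the Leibniz rule every term contains either the closed form itself or the closed
  lower power.\<close>

lemma dD_nabla_dpow:
  assumes reg: "regular \<omega>" and 0: "dD (nabla \<omega>) = 0"
  shows "dD (nabla (\<lambda>y. dpow (\<omega> y) k)) = 0"
proof (induction k)
  case 0
  then show ?case using nabla_one by (auto simp: dform_one_def dD_def fun_eq_iff)
next
  case (Suc k)
  have "dD (nabla (\<lambda>y. dpow (\<omega> y) (Suc k))) =
      dD (nabla \<omega>) \<odot> dpow (\<omega> x) k + sg1 (\<omega> x) \<odot> dD (nabla (\<lambda>y. dpow (\<omega> y) k))"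
    unfolding nabla_dpow_Suc[OF reg] dD_add dD_mult_left dD_mult_right ..
  then show ?case by (simp only: 0 Suc mult_zero add_0_left)
qed

end

section \<open>The Bianchi identity and the Thorpe condition\<close>

context chart_point
begin

definition dd\<Gamma> :: "real^'n \<Rightarrow> real^'n \<Rightarrow> real^'n \<Rightarrow> real^'n \<Rightarrow> real^'n" where
  "dd\<Gamma> z u v w = frechet_derivative (\<lambda>y. d\<Gamma> y u v w) (at x) z"

lemma dd\<Gamma>_sym: "dd\<Gamma> z u v w = dd\<Gamma> u z v w"
  unfolding dd\<Gamma>_def d\<Gamma>_def by (rule Ck_on_2_symmetric[OF Ck_on_christoffel open_S x])

lemma d\<Gamma>_has_derivative: "((\<lambda>y. d\<Gamma> y u v w) has_derivative (\<lambda>z. dd\<Gamma> z u v w)) (at x)"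
proof -
  have "Ck_on (Suc 0) (\<lambda>y. d\<Gamma> y u v w) S"
    using Ck_on_christoffel[of "Suc (Suc 0)" v w] unfolding d\<Gamma>_def Ck_on.simps(2)[of "Suc 0"] by blast
  from Ck_on_Suc_has_derivative[OF this x] show ?thesis by (simp add: dd\<Gamma>_def)
qed

lemma christoffel2_has_derivative:
  "((\<lambda>y. \<Gamma> y u (\<Gamma> y v w)) has_derivative (\<lambda>z. d\<Gamma> x z u (\<Gamma> x v w) + \<Gamma> x u (d\<Gamma> x z v w))) (at x)"
  unfolding d\<Gamma>_def
  by (rule linear_family_has_derivative[OF open_S x linear_christoffel_right
        christoffel_differentiable[OF x] christoffel_has_derivative[OF x]])

text \<open>The plain derivative in direction z of the curvature operator on constant
  fields.\<close>

definition dR :: "real^'n \<Rightarrow> real^'n \<Rightarrow> real^'n \<Rightarrow> real^'n \<Rightarrow> real^'n" where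
  "dR z u v w = dd\<Gamma> z u v w - dd\<Gamma> z v u w + (d\<Gamma> x z u (\<Gamma> x v w) + \<Gamma> x u (d\<Gamma> x z v w))
     - (d\<Gamma> x z v (\<Gamma> x u w) + \<Gamma> x v (d\<Gamma> x z u w))"

lemma curvature_op_has_derivative:
  "((\<lambda>y. curvature_op G y u v w) has_derivative (\<lambda>z. dR z u v w)) (at x)"
  unfolding curvature_op_eq dR_def
  by (intro has_derivative_add has_derivative_diff d\<Gamma>_has_derivative christoffel2_has_derivative)

lemma curvature_pair_has_derivative:
  "((\<lambda>y. curvature_form G y [u, v] [a, b]) has_derivative
    (\<lambda>z. gip (G x) (dR z u v b + \<Gamma> x z (curvature_op G x u v b)) a
      + gip (G x) (curvature_op G x u v b) (\<Gamma> x z a))) (at x)"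
  unfolding curvature_form_pair by (rule gip_has_derivative[OF x curvature_op_has_derivative])

lemma regular_curvature: "regular (curvature_form G)"
proof (rule regularI[OF is_dform_curvature_form])
  fix xs ys
  show "(\<lambda>y. curvature_form G y xs ys) differentiable at x"
  proof (cases "length xs = 2 \<and> length ys = 2")
    case True
    then obtain u v a b where "xs = [u, v]" "ys = [a, b]"
      by (auto simp: length_Suc_conv numeral_2_eq_2)
    then show ?thesis using differentiableI[OF curvature_pair_has_derivative] by simp
  next
    case False
    then show ?thesis using curvature_form_degree by simp
  qed
qed

text \<open>The covariant derivative of the curvature as a vector-valued tensor;
  \<open>nabla_curvature\<close> links it to the double form.\<close>

definition nR :: "real^'n \<Rightarrow> real^'n \<Rightarrow> real^'n \<Rightarrow> real^'n \<Rightarrow> real^'n" where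
  "nR z u v b = dR z u v b + \<Gamma> x z (curvature_op G x u v b) - curvature_op G x (\<Gamma> x z u) v b
    - curvature_op G x u (\<Gamma> x z v) b - curvature_op G x u v (\<Gamma> x z b)"

lemma nabla_curvature: "nabla (curvature_form G) z [u, v] [a, b] = gip (G x) (nR z u v b) a"
  using fun_cong[OF frechet_derivative_at[OF curvature_pair_has_derivative[of u v a b]], of z]
  by (simp add: nabla_dform_def nR_def curvature_form_pair gip_add_scale linear_diff[OF linear_gip_left])

text \<open>In the cyclic sum second derivatives of \<Gamma> cancel since they commute. The
  corrections in the first two slots cancel in pairs by absence of torsion and skewness, and the
  remaining products cancel after expansion.\<close>

lemma second_bianchi: "nR z u v b + nR u v z b + nR v z u b = 0"
proof -
  note lin = linear_add[OF linear_christoffel_right[OF x]] linear_diff[OF linear_christoffel_right[OF x]]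
  show ?thesis
    unfolding nR_def dR_def curvature_op_eq lin
    using christoffel_sym[OF x, of u z] christoffel_sym[OF x, of v z] christoffel_sym[OF x, of v u]
      dd\<Gamma>_sym[of u z v b] dd\<Gamma>_sym[of v z u b] dd\<Gamma>_sym[of v u z b]
    by (simp add: algebra_simps)
qed

lemma dD_curvature: "dD (nabla (curvature_form G)) = 0"
proof (intro ext)
  fix xs ys
  let ?F = "nabla (curvature_form G)"
  have F: "is_dform 2 2 (?F z)" for z
    by (rule is_dform_nabla[OF regular_curvature is_dform_curvature_form])
  show "dD ?F xs ys = 0 xs ys"
  proof (cases "length xs = 3 \<and> length ys = 2")
    case True
    then obtain u v w a b where xs: "xs = [u, v, w]" "ys = [a, b]"
      by (auto simp: length_Suc_conv numeral_2_eq_2 numeral_3_eq_3)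
    have anti: "?F v [u, w] [a, b] = - ?F v [w, u] [a, b]"
      using alt1D[OF is_dformD(1)[OF F], of v "[]" u w "[]" "[a, b]"] by simp
    have "dD ?F xs ys = ?F u [v, w] [a, b] + ?F v [w, u] [a, b] + ?F w [u, v] [a, b]"
      using anti by (simp add: xs dD_Cons ins1_def)
    also have "\<dots> = gip (G x) (nR u v w b + nR v w u b + nR w u v b) a"
      by (simp add: nabla_curvature gip_add_scale)
    also have "nR u v w b + nR v w u b + nR w u v b = 0" by (rule second_bianchi)
    finally show ?thesis by (simp add: linear_0[OF linear_gip_left])
  next
    case False
    have "?F z (take j xs @ drop (Suc j) xs) ys = 0" if "j < length xs" for j z
      by (rule is_dform_degree[OF F]) (use False that in auto)
    then show ?thesis by (simp add: dD_def)
  qed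
qed

text \<open>Pair symmetry of the curvature holds near x, hence passes to its covariant derivative,
  which turns closedness in the first group into closedness in the second.\<close>

lemma dD2_curvature: "dD2 (nabla (curvature_form G)) = 0"
proof -
  have "flip (nabla (curvature_form G) z) = nabla (curvature_form G) z" for z
  proof (intro ext)
    fix xs ys
    have "((\<lambda>y. pull (\<lambda>y. flip (curvature_form G y)) y xs ys) has_derivative
        (\<lambda>z. nabla (curvature_form G) z xs ys)) (at x)"
      by (rule has_derivative_transform_within_open[OF pull_has_derivative[OF regular_curvature] open_S x])
        (simp add: pull_def flip_curvature_form)
    from nabla_eqI[OF regular_flip[OF regular_curvature] this]
    show "flip (nabla (curvature_form G) z) xs ys = nabla (curvature_form G) z xs ys"
      by (simp add: flip_nabla)
  qed
  then show ?thesis by (simp add: dD2_def dD_curvature)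
qed

lemma flip_dpow: "flip (dpow \<omega> k) = dpow (flip \<omega>) k"
  by (induction k) (auto simp: flip_mult, simp add: flip_def form_tensor_def mult.commute)

text \<open>Gram-Schmidt applied to the fields \<open>pfield (onb (G x) i)\<close>, which are orthonormal to first
  order, does not change their first-order behaviour.\<close>

lemma parallel_frame:
  assumes e: "orthonormal_frame (G x) e" and m: "m \<le> CARD('n)"
  shows "\<exists>f. (\<forall>i<m. f i x = e i \<and> (f i has_derivative (\<lambda>z. - \<Gamma> x z (e i))) (at x)) \<and>
    eventually (\<lambda>y. \<forall>i<m. \<forall>j<m. gip (G y) (f i y) (f j y) = (if i = j then 1 else 0)) (nhds x)"
  using m
proof (induction m)
  case 0
  then show ?case by simp
next
  case (Suc m)
  then obtain f where fx: "\<And>i. i < m \<Longrightarrow> f i x = e i"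
    and fd: "\<And>i. i < m \<Longrightarrow> (f i has_derivative (\<lambda>z. - \<Gamma> x z (e i))) (at x)"
    and orth: "eventually (\<lambda>y. \<forall>i<m. \<forall>j<m. gip (G y) (f i y) (f j y) = (if i = j then 1 else 0)) (nhds x)"
    by auto
  have ge: "gip (G x) (e i) (e j) = (if i = j then 1 else 0)" if "i \<le> m" "j \<le> m" for i j
    using e that Suc.prems by (simp add: orthonormal_frame_def)
  \<comment> \<open>Since the metric is parallel, inner products of fields parallel at x are
    constant to first order.\<close>
  have gd: "((\<lambda>y. gip (G y) (h y) (k y)) has_derivative (\<lambda>z. 0)) (at x)"
    if "(h has_derivative (\<lambda>z. - \<Gamma> x z (h x))) (at x)" "(k has_derivative (\<lambda>z. - \<Gamma> x z (k x))) (at x)" for h k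
    using nabla_has_derivative[OF regular_metric, of "[h]" "[k]"] that by (simp add: nabla_metric)
  define h where "h = pfield (e m)"
  have hx: "h x = e m" and hd: "(h has_derivative (\<lambda>z. - \<Gamma> x z (e m))) (at x)"
    using pfield_has_derivative by (auto simp: h_def)
  define w where "w y = h y - (\<Sum>j<m. gip (G y) (h y) (f j y) *\<^sub>R f j y)" for y
  have wx: "w x = e m"
    by (simp add: w_def hx fx ge)
  have c: "((\<lambda>y. gip (G y) (h y) (f j y)) has_derivative (\<lambda>z. 0)) (at x)" if "j < m" for j
    by (rule gd) (use hd hx fd[OF that] fx[OF that] in auto)
  \<comment> \<open>Each projection coefficient vanishes at x together with its derivative, so
    subtracting the projections leaves the first-order behaviour unchanged.\<close>
  have "((\<lambda>y. gip (G y) (h y) (f j y) *\<^sub>R f j y) has_derivative (\<lambda>z. 0)) (at x)" if "j < m" for j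
    using has_derivative_scaleR[OF c[OF that] fd[OF that]] that by (simp add: hx fx ge)
  then have "((\<lambda>y. \<Sum>j<m. gip (G y) (h y) (f j y) *\<^sub>R f j y) has_derivative (\<lambda>z. \<Sum>j<m. 0)) (at x)"
    by (intro has_derivative_sum) simp
  from has_derivative_diff[OF hd this]
  have wd: "(w has_derivative (\<lambda>z. - \<Gamma> x z (e m))) (at x)"
    unfolding w_def[abs_def] by simp
  define N where "N y = gip (G y) (w y) (w y)" for y
  have Nx: "N x = 1" by (simp add: N_def wx ge)
  have Nd: "(N has_derivative (\<lambda>z. 0)) (at x)"
    unfolding N_def[abs_def] by (rule gd) (use wd wx in auto)
  have "continuous (at x) N" using Nd by (rule has_derivative_continuous)
  then have "filterlim N (nhds 1) (nhds x)"
    unfolding continuous_at tendsto_at_iff_tendsto_nhds by (simp only: Nx)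
  then have Npos: "eventually (\<lambda>y. N y > 0) (nhds x)"
    by (rule order_tendstoD(1)) simp
  \<comment> \<open>Only differentiability at 1 matters: N has derivative 0 at x, so the normalising
    factor does too.\<close>
  have "((\<lambda>t. inverse (sqrt t)) has_real_derivative (- ((inverse (sqrt 1)) ^ 2 * (inverse (sqrt 1) / 2)))) (at 1)"
    by (auto intro!: derivative_eq_intros)
  then have "((\<lambda>t. inverse (sqrt t)) has_derivative (*) (- ((inverse (sqrt 1)) ^ 2 * (inverse (sqrt 1) / 2)))) (at (N x))"
    by (simp add: has_field_derivative_def Nx)
  from has_derivative_compose[OF Nd this]
  have sd: "((\<lambda>y. inverse (sqrt (N y))) has_derivative (\<lambda>z. 0)) (at x)" by simp
  define p where "p y = inverse (sqrt (N y)) *\<^sub>R w y" for y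
  have px: "p x = e m" by (simp add: p_def Nx wx)
  have pd: "(p has_derivative (\<lambda>z. - \<Gamma> x z (e m))) (at x)"
    using has_derivative_scaleR[OF sd wd] by (simp add: p_def[abs_def] Nx)
  have "eventually (\<lambda>y. y \<in> S) (nhds x)" using open_S x by (rule eventually_nhds_in_open)
  with orth Npos
  have "eventually (\<lambda>y. \<forall>i<Suc m. \<forall>j<Suc m.
    gip (G y) ((f(m := p)) i y) ((f(m := p)) j y) = (if i = j then 1 else 0)) (nhds x)"
  proof eventually_elim
    case (elim y)
    have com: "gip (G y) a b = gip (G y) b a" for a b using pos_def_G elim(3) by (intro gip_commute) auto
    have wf: "gip (G y) (w y) (f j y) = 0" if "j < m" for j
    proof -
      have "gip (G y) (w y) (f j y) = gip (G y) (h y) (f j y) -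
          (\<Sum>i<m. gip (G y) (h y) (f i y) * gip (G y) (f i y) (f j y))"
        by (simp add: w_def linear_diff[OF linear_gip_left] linear_sum[OF linear_gip_left]
            linear_scale[OF linear_gip_left])
      also have "(\<Sum>i<m. gip (G y) (h y) (f i y) * gip (G y) (f i y) (f j y)) =
          (\<Sum>i<m. if i = j then gip (G y) (h y) (f j y) else 0)"
        using elim(1) that by (intro sum.cong) auto
      finally show ?thesis using that by simp
    qed
    have pf: "gip (G y) (p y) (f j y) = 0" "gip (G y) (f j y) (p y) = 0" if "j < m" for j
      using wf[OF that] com[of "f j y" "w y"]
      by (simp_all add: p_def linear_scale[OF linear_gip_left] linear_scale[OF linear_gip_right])
    have pp: "gip (G y) (p y) (p y) = 1"
    proof -
      have "gip (G y) (p y) (p y) = inverse (sqrt (N y)) * inverse (sqrt (N y)) * N y"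
        by (simp add: p_def N_def linear_scale[OF linear_gip_left] linear_scale[OF linear_gip_right])
      also have "\<dots> = inverse (N y) * N y" using elim(2)
        by (metis inverse_mult_distrib less_imp_le real_sqrt_mult_self abs_of_nonneg)
      finally show ?thesis using elim(2) by simp
    qed
    show ?case
      using elim(1) pf pp by (auto simp: less_Suc_eq)
  qed
  moreover have "\<forall>i<Suc m. (f(m := p)) i x = e i \<and> ((f(m := p)) i has_derivative (\<lambda>z. - \<Gamma> x z (e i))) (at x)"
    using fx fd px pd by (auto simp: less_Suc_eq)
  ultimately show ?case by blast
qed

text \<open>\<open>star_frame\<close> gives the star equation near x in the components of the frame
  of \<open>parallel_frame\<close>. The volume symbols are constants and the components of T
  differentiate to those of its covariant derivative, so the equation can be differentiated term by
  term.\<close>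

lemma nabla_star:
  assumes reg: "regular T" and T: "\<And>y. y \<in> S \<Longrightarrow> is_dform r r (T y)" and n: "CARD('n) = 2 * r"
    and star: "\<And>y xs ys. y \<in> S \<Longrightarrow> double_star (G y) (T y) xs ys = \<epsilon> * T y xs ys"
    and e: "orthonormal_frame (G x) e"
    and K: "K \<in> lists_of CARD('n) r" and L: "L \<in> lists_of CARD('n) r"
  shows "\<epsilon> * nabla T z (map e K) (map e L) =
    star_index CARD('n) r (\<lambda>is js. nabla T z (map e is) (map e js)) K L"
proof -
  let ?n = "CARD('n)"
  obtain f where fx: "\<And>i. i < ?n \<Longrightarrow> f i x = e i"
    and fd: "\<And>i. i < ?n \<Longrightarrow> (f i has_derivative (\<lambda>z. - \<Gamma> x z (e i))) (at x)"
    and orth: "eventually (\<lambda>y. \<forall>i<?n. \<forall>j<?n. gip (G y) (f i y) (f j y) = (if i = j then 1 else 0)) (nhds x)"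
    using parallel_frame[OF e, of ?n] by auto
  have D: "((\<lambda>y. T y (map (\<lambda>i. f i y) is) (map (\<lambda>i. f i y) js)) has_derivative
      (\<lambda>z. nabla T z (map e is) (map e js))) (at x)"
    if "is \<in> lists_of ?n r" "js \<in> lists_of ?n r" for "is" js
  proof -
    have h: "(h has_derivative (\<lambda>z. - \<Gamma> x z (h x))) (at x)" if "h \<in> set (map f ks)" "ks \<in> lists_of ?n r" for h ks
      using that fx fd by (auto simp: lists_of_def subset_iff)
    have eq: "map (\<lambda>i. f i x) ks = map e ks" if "ks \<in> lists_of ?n r" for ks
      using that fx by (auto simp: lists_of_def subset_iff)
    from nabla_has_derivative[where hs = "map f is" and ks = "map f js", OF reg h h] that
    show ?thesis by (simp add: o_def eq)
  qed
  have "((\<lambda>y. \<epsilon> * T y (map (\<lambda>i. f i y) K) (map (\<lambda>i. f i y) L)) has_derivative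
      (\<lambda>z. \<epsilon> * nabla T z (map e K) (map e L))) (at x)"
    by (intro has_derivative_mult_right D K L)
  moreover have "((\<lambda>y. \<epsilon> * T y (map (\<lambda>i. f i y) K) (map (\<lambda>i. f i y) L)) has_derivative
      (\<lambda>z. star_index ?n r (\<lambda>is js. nabla T z (map e is) (map e js)) K L)) (at x)"
  proof -
    obtain U where U: "open U" "x \<in> U" "\<And>y. y \<in> U \<Longrightarrow> y \<in> S"
      "\<And>y i j. y \<in> U \<Longrightarrow> i < ?n \<Longrightarrow> j < ?n \<Longrightarrow> gip (G y) (f i y) (f j y) = (if i = j then 1 else 0)"
      using eventually_conj[OF orth eventually_nhds_in_open[OF open_S x]]
      unfolding eventually_nhds by blast
    have "((\<lambda>y. star_index ?n r (\<lambda>is js. T y (map (\<lambda>i. f i y) is) (map (\<lambda>i. f i y) js)) K L) has_derivative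
      (\<lambda>z. star_index ?n r (\<lambda>is js. nabla T z (map e is) (map e js)) K L)) (at x)"
      unfolding star_index_def divide_inverse
      by (intro has_derivative_sum has_derivative_mult_left D)
    then show ?thesis
    proof (rule has_derivative_transform_within_open[OF _ U(1,2)])
      fix y assume y: "y \<in> U"
      have "euclidean (G y) (\<lambda>i. f i y)"
        using pos_def_G[OF U(3)[OF y]] U(4)[OF y] by unfold_locales (auto simp: orthonormal_frame_def)
      from star_frame[OF this T[OF U(3)[OF y]] n star[OF U(3)[OF y]] K L]
      show "star_index ?n r (\<lambda>is js. T y (map (\<lambda>i. f i y) is) (map (\<lambda>i. f i y) js)) K L =
        \<epsilon> * T y (map (\<lambda>i. f i y) K) (map (\<lambda>i. f i y) L)" by simp
    qed
  qed
  ultimately show ?thesis using has_derivative_unique by (metis (no_types, lifting))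
qed

lemma delta_op_dpow_curvature:
  assumes n: "CARD('n) = 2 * r" and k: "1 \<le> k" "2 * k \<le> r" and \<epsilon>: "\<epsilon> \<noteq> 0"
    and star: "\<And>y xs ys. y \<in> S \<Longrightarrow>
      double_star (G y) (dpow (metric_form (G y)) (r - 2 * k) \<odot> dpow (curvature_form G y) k) xs ys =
      \<epsilon> * (dpow (metric_form (G y)) (r - 2 * k) \<odot> dpow (curvature_form G y) k) xs ys"
  shows "delta_op G (\<lambda>y. dpow (curvature_form G y) k) x xs ys = 0"
proof -
  let ?n = "CARD('n)" let ?e = "onb (G x)" let ?l = "r - 2 * k"
  let ?F = "nabla (\<lambda>y. dpow (curvature_form G y) k)"
  define T where "T y = dpow (metric_form (G y)) ?l \<odot> dpow (curvature_form G y) k" for y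
  have frame: "orthonormal_frame (G x) ?e"
    using orthonormal_frame_exists[OF pos_def_G[OF x]] unfolding onb_def by (rule someI_ex)
  interpret euclidean "G x" ?e
    by unfold_locales (use pos_def_G[OF x] frame in auto)
  have regR: "regular (\<lambda>y. dpow (curvature_form G y) k)"
    by (rule regular_dpow[OF regular_curvature])
  have regT: "regular T"
    unfolding T_def by (intro regular_mult regular_dpow regular_metric regular_curvature)
  have Rform: "is_dform (2 * k) (2 * k) (dpow (curvature_form G y) k)" if "y \<in> S" for y
    using is_dform_dpow[OF is_dform_curvature_form[OF that], of k] by (simp add: mult.commute)
  have Tform: "is_dform r r (T y)" if "y \<in> S" for y
    using is_dform_mult[OF is_dform_dpow[OF is_dform_metric_form] Rform[OF that], of ?l] k(2)
    by (simp add: T_def)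
  have Fform: "is_dform (2 * k) (2 * k) (?F z)" for z
    by (rule is_dform_nabla[OF regR Rform])
  have nT: "nabla T = (\<lambda>z. (gmult ^^ ?l) (?F z))"
    using nabla_mult[OF regular_dpow[OF regular_metric] regR]
    by (auto simp: T_def[abs_def] nabla_dpow_metric dpow_metric_mult)
  have "dD (nabla T) = 0"
    unfolding nT dpow_metric_mult[symmetric] dD_mult_right dD_nabla_dpow[OF regular_curvature dD_curvature]
    by simp
  \<comment> \<open>Closedness is passed to components because \<open>divergence_eq_0_index\<close>
    works with indices.\<close>
  moreover have "dD (\<lambda>i K L. nabla T (?e i) (map ?e K) (map ?e L)) ks L =
      dD (nabla T) (map ?e ks) (map ?e L)" for ks L
    by (auto simp: dD_def take_map drop_map intro!: sum.cong)
  ultimately have closed: "dD (\<lambda>i K L. nabla T (?e i) (map ?e K) (map ?e L)) ks L = 0" for ks L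
    by simp
  have div0: "div_sum (nabla T) (map ?e K) (map ?e L) = 0"
    if "K \<in> lists_of ?n (r - 1)" "L \<in> lists_of ?n r" for K L
    using divergence_eq_0_index[OF \<epsilon> nabla_star[OF regT Tform n _ frame] closed that(1) _ that(2)]
      star k by (simp add: div_sum_def ins1_def T_def)
  have divform: "is_dform (r - 1) r (div_sum (nabla T))"
    unfolding div_sum_def using k is_dform_nabla[OF regT Tform]
    by (intro is_dform_sum is_dform_ins1) simp
  \<comment> \<open>The divergence is known to vanish on frame vectors only; multilinearity in each
    group extends this to all lists of the right lengths.\<close>
  have "div_sum (nabla T) = 0"
  proof (intro ext)
    fix xs ys
    have E: "euclidean (G x) ?e" by unfold_locales
    have m1: "multilinear (\<lambda>xs. div_sum (nabla T) xs ys)" for ys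
      using is_dformD(3)[OF divform] by (simp add: lin1_def)
    have m2: "multilinear (div_sum (nabla T) xs)" for xs
      using is_dformD(4)[OF divform] by (simp add: lin1_def flip_def)
    have m0: "multilinear (\<lambda>xs. 0)" by (simp add: multilinear_def)
    show "div_sum (nabla T) xs ys = 0 xs ys"
    proof (cases "length xs = r - 1 \<and> length ys = r")
      case True
      have "div_sum (nabla T) (map ?e K) ys = 0" if "K \<in> lists_of ?n (r - 1)" for K
        using multilinear_eqI_frame[OF E m2 m0 div0[OF that], where xs = ys] True by blast
      then have "div_sum (nabla T) xs ys = 0"
        using multilinear_eqI_frame[OF E m1 m0, where m = "r - 1" and xs = xs] True by blast
      then show ?thesis by simp
    next
      case False
      then show ?thesis using is_dform_degree[OF divform, of xs ys] by auto
    qed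
  qed
  moreover have D2: "dD2 ?F = 0"
  proof -
    \<comment> \<open>Flipping exchanges the two exterior derivatives, so closedness of the power in
      the second group is closedness of the power of the flipped curvature in the first.\<close>
    have "regular (\<lambda>y. flip (curvature_form G y))" by (rule regular_flip[OF regular_curvature])
    moreover have "dD (nabla (\<lambda>y. flip (curvature_form G y))) = 0"
      using dD2_curvature by (simp add: dD2_def flip_nabla flip_eq_iff[of _ 0, simplified])
    ultimately have "dD (nabla (\<lambda>y. dpow (flip (curvature_form G y)) k)) = 0" by (rule dD_nabla_dpow)
    then show ?thesis by (simp add: dD2_def flip_nabla flip_dpow)
  qed
  ultimately have "dscale ((-1) ^ ?l) ((gmult ^^ ?l) (div_sum ?F)) = 0"
    using div_sum_gmult_pow[OF linear_nabla[OF regR] D2, where m = ?l] unfolding nT by simp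
  then have "(gmult ^^ ?l) (div_sum ?F) = 0"
    by (simp add: dscale_def fun_eq_iff)
  moreover have "is_dform (2 * k - 1) (2 * k) (div_sum ?F)"
    unfolding div_sum_def using k Fform by (intro is_dform_sum is_dform_ins1) simp
  \<comment> \<open>Here the degrees and the exponent add up to r + 2k - 1, which is less than 2r =
    n because 2k <= r.\<close>
  ultimately have "div_sum ?F = 0"
    using gmult_pow_inj[of "2 * k - 1" "2 * k" "div_sum ?F" ?l] n k by simp
  then show ?thesis by (simp add: delta_op_def div_sum_def ins1_def fun_eq_iff)
qed

lemma D_op_dpow_curvature:
  "D_op G (\<lambda>y. dpow (curvature_form G y) k) x xs ys = 0"
  using dD_nabla_dpow[OF regular_curvature dD_curvature, of k]
  by (simp add: D_op_def dD_def fun_eq_iff)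

end

theorem proposition1p2:
  fixes M :: "'m topology" and \<A> :: "('m, 'n::finite) chart set"
    and g :: "('m, 'n) metric" and r k :: nat
  assumes "smooth_manifold M \<A>" and "compact_space M" and "riemannian_metric \<A> g"
    and "CARD('n) = 2 * r" and "2 \<le> 2 * k" and "2 * k \<le> r"
    and "is_thorpe \<A> g r k \<or> is_anti_thorpe \<A> g r k"
  shows "harmonic_dform \<A> g (curvature_power g k)"
  unfolding harmonic_dform_def
proof (intro ballI allI)
  fix c x xs ys
  assume c: "c \<in> \<A>" and x: "x \<in> chart_image c"
  have "open (chart_image c)"
    using assms(1) c by (auto simp: smooth_manifold_def is_chart_def)
  then interpret chart_point "g c" "chart_image c" x
    using assms(3) c x by unfold_locales (auto simp: riemannian_metric_def)
  have "\<exists>\<epsilon>. \<epsilon> \<noteq> 0 \<and> (\<forall>y\<in>chart_image c. \<forall>xs ys.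
    double_star (g c y) (thorpe_form g r k c y) xs ys = \<epsilon> * thorpe_form g r k c y xs ys)"
    using assms(7)
  proof
    assume "is_thorpe \<A> g r k"
    then show ?thesis using c by (intro exI[of _ 1]) (simp add: is_thorpe_def)
  next
    assume "is_anti_thorpe \<A> g r k"
    then show ?thesis using c by (intro exI[of _ "-1"]) (simp add: is_anti_thorpe_def)
  qed
  then obtain \<epsilon> where \<epsilon>: "\<epsilon> \<noteq> 0" "\<And>y xs ys. y \<in> chart_image c \<Longrightarrow>
    double_star (g c y) (thorpe_form g r k c y) xs ys = \<epsilon> * thorpe_form g r k c y xs ys" by blast
  have "delta_op (g c) (curvature_power g k c) x xs ys = 0"
    unfolding curvature_power_def
    by (rule delta_op_dpow_curvature[OF assms(4) _ assms(6) \<epsilon>(1)])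
      (use assms(5) \<epsilon>(2) in \<open>simp_all add: thorpe_form_def curvature_power_def\<close>)
  moreover have "D_op (g c) (curvature_power g k c) x xs ys = 0"
    unfolding curvature_power_def by (rule D_op_dpow_curvature)
  ultimately show "D_op (g c) (curvature_power g k c) x xs ys = 0 \<and>
      delta_op (g c) (curvature_power g k c) x xs ys = 0" by simp
qed

end
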